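(* Let $R=R_1\times R_2\times\cdots\times R_n$ be a direct product of commutative rings $R_1,\dots,R_n$, let $S$ be a multiplicative subset of $R$ (with $0\notin S$), and let $M$ be an $R$-module. Let $e_i\in R$ be the element whose $i$-th component is $1$ and whose other components are $0$. Then: (1) $M$ is an $S$-flat $R$-module if and only if $e_iM$ is an $e_iS$-flat $R_i$-module for each $i\in\{1,\dots,n\}$ with $0\notin e_iS$. (2) $M$ is an $S$-projective $R$-module if and only if $e_iM$ is an $e_iS$-projective $R_i$-module for each $i\in\{1,\dots,n\}$ with $0\notin e_iS$.
   Context: A multiplicative subset $T$ of a commutative ring $A$ satisfies $1\in T$, is closed under multiplication, and $0\notin T$. $N_T\cong N\otimes_A A_T$ denotes localization at $T$. An $A$-module $N$ is $T$-flat if $N_T$ is a flat $A_T$-module, and $T$-projective if $N_T$ is projective as an $A$-module. Each $R$-module $M$ decomposes as $M=e_1M\times\cdots\times e_nM$ with $e_iM$ an $R_i$-module, and $e_iS$ is identified with its image in $R_i$ (the $i$-th projection of $S$), which is a multiplicative subset of $R_i$ whenever $0\notin e_iS$. *)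

theory Defs
  imports "HOL-Algebra.Algebra"
begin

section \<open>Modules and their homomorphisms\<close>

text \<open>
  The record type of modules extends the one of rings, so every module carries the junk fields
  \<open>mult\<close> and \<open>one\<close>.  The locale \<open>module\<close> and everything below ignores them.
\<close>

definition mod_hom ::
    "('a, 'm) ring_scheme \<Rightarrow> ('a, 'c) module \<Rightarrow> ('a, 'd) module \<Rightarrow> ('c \<Rightarrow> 'd) set"
  where "mod_hom A K L = {f \<in> hom (add_monoid K) (add_monoid L).
           \<forall>a\<in>carrier A. \<forall>x\<in>carrier K. f (a \<odot>\<^bsub>K\<^esub> x) = a \<odot>\<^bsub>L\<^esub> f x}"

definition regular_module :: "('a, 'm) ring_scheme \<Rightarrow> ('a, 'a) module"
  where "regular_module A =
    \<lparr>carrier = carrier A, monoid.mult = monoid.mult A, one = one A, ring.zero = ring.zero A, add = add A,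
     smult = monoid.mult A\<rparr>"

definition restrict_scalars :: "('a \<Rightarrow> 'e) \<Rightarrow> ('e, 'b) module \<Rightarrow> ('a, 'b) module"
  where "restrict_scalars h N =
    \<lparr>carrier = carrier N, monoid.mult = monoid.mult N, one = one N, ring.zero = ring.zero N, add = add N,
     smult = (\<lambda>a x. h a \<odot>\<^bsub>N\<^esub> x)\<rparr>"


section \<open>Tensor products and flat modules\<close>

text \<open>
  The tensor product of \<open>K\<close> and \<open>N\<close> over \<open>A\<close>, as an abelian group (the group structure suffices
  to speak about injectivity): the free abelian group on the pairs modulo the bilinearity relations.
\<close>

definition tensor_gens ::
    "('a, 'm) ring_scheme \<Rightarrow> ('a, 'c) module \<Rightarrow> ('a, 'b) module \<Rightarrow> (('c \<times> 'b) \<Rightarrow>\<^sub>0 int) set"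
  where "tensor_gens A K N =
    {frag_of (x \<oplus>\<^bsub>K\<^esub> y, n) - frag_of (x, n) - frag_of (y, n) | x y n.
       x \<in> carrier K \<and> y \<in> carrier K \<and> n \<in> carrier N} \<union>
    {frag_of (x, n \<oplus>\<^bsub>N\<^esub> p) - frag_of (x, n) - frag_of (x, p) | x n p.
       x \<in> carrier K \<and> n \<in> carrier N \<and> p \<in> carrier N} \<union>
    {frag_of (a \<odot>\<^bsub>K\<^esub> x, n) - frag_of (x, a \<odot>\<^bsub>N\<^esub> n) | a x n.
       a \<in> carrier A \<and> x \<in> carrier K \<and> n \<in> carrier N}"

definition tensor_rel ::
    "('a, 'm) ring_scheme \<Rightarrow> ('a, 'c) module \<Rightarrow> ('a, 'b) module \<Rightarrow> (('c \<times> 'b) \<Rightarrow>\<^sub>0 int) set"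
  where "tensor_rel A K N =
    generate (free_Abelian_group (carrier K \<times> carrier N)) (tensor_gens A K N)"

definition tensor_product ::
    "('a, 'm) ring_scheme \<Rightarrow> ('a, 'c) module \<Rightarrow> ('a, 'b) module \<Rightarrow> (('c \<times> 'b) \<Rightarrow>\<^sub>0 int) set monoid"
  where "tensor_product A K N =
    free_Abelian_group (carrier K \<times> carrier N) Mod tensor_rel A K N"

definition tensor_push :: "('c \<Rightarrow> 'd) \<Rightarrow> (('c \<times> 'b) \<Rightarrow>\<^sub>0 int) \<Rightarrow> (('d \<times> 'b) \<Rightarrow>\<^sub>0 int)"
  where "tensor_push f = frag_extend (\<lambda>(x, n). frag_of (f x, n))"

text \<open>The map induced on cosets by \<open>f : K \<rightarrow> L\<close> and the identity of \<open>N\<close>.\<close>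

definition tensor_map ::
    "('a, 'm) ring_scheme \<Rightarrow> ('c \<Rightarrow> 'd) \<Rightarrow> ('a, 'c) module \<Rightarrow> ('a, 'd) module \<Rightarrow> ('a, 'b) module \<Rightarrow>
     (('c \<times> 'b) \<Rightarrow>\<^sub>0 int) set \<Rightarrow> (('d \<times> 'b) \<Rightarrow>\<^sub>0 int) set"
  where "tensor_map A f K L N U =
    (\<Union>x\<in>U. tensor_rel A L N #>\<^bsub>free_Abelian_group (carrier L \<times> carrier N)\<^esub> tensor_push f x)"

text \<open>
  A definition in HOL cannot quantify over the types of the test modules \<open>K\<close> and \<open>L\<close>.  They range
  over the type \<open>'a list set\<close>, which contains a copy of every finitely generated \<open>A\<close>-module;
  theorem \<open>flat_module_inj\<close> below shows that tensoring with \<open>N\<close> then preserves injections between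
  modules of arbitrary types.
\<close>

definition flat_module :: "('a, 'm) ring_scheme \<Rightarrow> ('a, 'b) module \<Rightarrow> bool"
  where "flat_module A N \<longleftrightarrow> module A N \<and>
    (\<forall>(K :: ('a, 'a list set) module) (L :: ('a, 'a list set) module) f.
       module A K \<longrightarrow> module A L \<longrightarrow> f \<in> mod_hom A K L \<longrightarrow> inj_on f (carrier K) \<longrightarrow>
       inj_on (tensor_map A f K L N) (carrier (tensor_product A K N)))"


section \<open>Projective modules\<close>

text \<open>
  The lifting property.  Again the type of the test modules is fixed, now to one that contains a
  copy of \<open>P\<close> and of the free module on the carrier of \<open>P\<close>; theorem \<open>projective_module_lift\<close> below
  shows that the lifting property then holds for test modules of arbitrary types.
\<close>

definition projective_module :: "('a, 'm) ring_scheme \<Rightarrow> ('a, 'b) module \<Rightarrow> bool"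
  where "projective_module A P \<longleftrightarrow> module A P \<and>
    (\<forall>(U :: ('a, ('b \<Rightarrow> 'a) set) module) (V :: ('a, ('b \<Rightarrow> 'a) set) module) g h.
       module A U \<longrightarrow> module A V \<longrightarrow> g \<in> mod_hom A U V \<longrightarrow> g ` carrier U = carrier V \<longrightarrow>
       h \<in> mod_hom A P V \<longrightarrow>
       (\<exists>k\<in>mod_hom A P U. \<forall>p\<in>carrier P. g (k p) = h p))"


section \<open>Localization\<close>

definition multiplicative_subset :: "('a, 'm) ring_scheme \<Rightarrow> 'a set \<Rightarrow> bool"
  where "multiplicative_subset A T \<longleftrightarrow> submonoid T A \<and> \<zero>\<^bsub>A\<^esub> \<notin> T"

definition frac_rel ::
    "('a, 'm) ring_scheme \<Rightarrow> 'a set \<Rightarrow> ('a, 'b) module \<Rightarrow> (('b \<times> 'a) \<times> ('b \<times> 'a)) set"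
  where "frac_rel A T N = {((x, s), (y, t)).
    x \<in> carrier N \<and> y \<in> carrier N \<and> s \<in> T \<and> t \<in> T \<and>
    (\<exists>u\<in>T. u \<odot>\<^bsub>N\<^esub> (t \<odot>\<^bsub>N\<^esub> x) = u \<odot>\<^bsub>N\<^esub> (s \<odot>\<^bsub>N\<^esub> y))}"

definition fraction :: "('a, 'm) ring_scheme \<Rightarrow> 'a set \<Rightarrow> ('a, 'b) module \<Rightarrow> 'b \<Rightarrow> 'a \<Rightarrow> ('b \<times> 'a) set"
  where "fraction A T N x s = frac_rel A T N `` {(x, s)}"

definition frac_add ::
    "('a, 'm) ring_scheme \<Rightarrow> 'a set \<Rightarrow> ('a, 'b) module \<Rightarrow>
     ('b \<times> 'a) set \<Rightarrow> ('b \<times> 'a) set \<Rightarrow> ('b \<times> 'a) set"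
  where "frac_add A T N U V =
    (\<Union>(x, s)\<in>U. \<Union>(y, t)\<in>V. fraction A T N (t \<odot>\<^bsub>N\<^esub> x \<oplus>\<^bsub>N\<^esub> s \<odot>\<^bsub>N\<^esub> y) (s \<otimes>\<^bsub>A\<^esub> t))"

definition frac_smult ::
    "('a, 'm) ring_scheme \<Rightarrow> 'a set \<Rightarrow> ('a, 'b) module \<Rightarrow>
     ('a \<times> 'a) set \<Rightarrow> ('b \<times> 'a) set \<Rightarrow> ('b \<times> 'a) set"
  where "frac_smult A T N U V =
    (\<Union>(a, s)\<in>U. \<Union>(y, t)\<in>V. fraction A T N (a \<odot>\<^bsub>N\<^esub> y) (s \<otimes>\<^bsub>A\<^esub> t))"

definition localize_ring :: "('a, 'm) ring_scheme \<Rightarrow> 'a set \<Rightarrow> ('a \<times> 'a) set ring"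
  where "localize_ring A T =
    \<lparr>carrier = (carrier A \<times> T) // frac_rel A T (regular_module A),
     monoid.mult = frac_smult A T (regular_module A),
     one = fraction A T (regular_module A) \<one>\<^bsub>A\<^esub> \<one>\<^bsub>A\<^esub>,
     ring.zero = fraction A T (regular_module A) \<zero>\<^bsub>A\<^esub> \<one>\<^bsub>A\<^esub>,
     add = frac_add A T (regular_module A)\<rparr>"

definition localize_map :: "('a, 'm) ring_scheme \<Rightarrow> 'a set \<Rightarrow> 'a \<Rightarrow> ('a \<times> 'a) set"
  where "localize_map A T a = fraction A T (regular_module A) a \<one>\<^bsub>A\<^esub>"

definition localize_module ::
    "('a, 'm) ring_scheme \<Rightarrow> 'a set \<Rightarrow> ('a, 'b) module \<Rightarrow> (('a \<times> 'a) set, ('b \<times> 'a) set) module"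
  where "localize_module A T N =
    \<lparr>carrier = (carrier N \<times> T) // frac_rel A T N,
     monoid.mult = undefined, one = undefined,
     ring.zero = fraction A T N \<zero>\<^bsub>N\<^esub> \<one>\<^bsub>A\<^esub>,
     add = frac_add A T N,
     smult = frac_smult A T N\<rparr>"

definition S_flat :: "('a, 'm) ring_scheme \<Rightarrow> 'a set \<Rightarrow> ('a, 'b) module \<Rightarrow> bool"
  where "S_flat A T N \<longleftrightarrow> flat_module (localize_ring A T) (localize_module A T N)"

text \<open>Projectivity of the localization is required over \<open>A\<close> itself, not over the localized ring.\<close>

definition S_projective :: "('a, 'm) ring_scheme \<Rightarrow> 'a set \<Rightarrow> ('a, 'b) module \<Rightarrow> bool"
  where "S_projective A T N \<longleftrightarrow>
    projective_module A (restrict_scalars (localize_map A T) (localize_module A T N))"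


section \<open>Factors of a finite direct product of rings\<close>

text \<open>
  The product of the rings in a list \<open>Rs\<close> is \<open>RDirProd_list Rs\<close>, whose elements are lists.
  Indices start at \<open>0\<close>.  The element of the product whose component at \<open>i\<close> is \<open>r\<close> and whose other
  components are zero:
\<close>

definition factor_incl :: "('a, 'm) ring_scheme list \<Rightarrow> nat \<Rightarrow> 'a \<Rightarrow> 'a list"
  where "factor_incl Rs i r = (map ring.zero Rs)[i := r]"

definition factor_idem :: "('a, 'm) ring_scheme list \<Rightarrow> nat \<Rightarrow> 'a list"
  where "factor_idem Rs i = factor_incl Rs i \<one>\<^bsub>Rs ! i\<^esub>"

definition factor_set :: "nat \<Rightarrow> 'a list set \<Rightarrow> 'a set"
  where "factor_set i S = (\<lambda>s. s ! i) ` S"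

definition factor_module ::
    "('a, 'm) ring_scheme list \<Rightarrow> nat \<Rightarrow> ('a list, 'b) module \<Rightarrow> ('a, 'b) module"
  where "factor_module Rs i M =
    \<lparr>carrier = (\<lambda>x. factor_idem Rs i \<odot>\<^bsub>M\<^esub> x) ` carrier M,
     monoid.mult = monoid.mult M, one = one M, ring.zero = ring.zero M, add = add M,
     smult = (\<lambda>r x. factor_incl Rs i r \<odot>\<^bsub>M\<^esub> x)\<rparr>"


section \<open>Basic facts about these notions\<close>

subsection \<open>Transporting modules along injections\<close>

definition copy_module :: "('c \<Rightarrow> 'd) \<Rightarrow> ('a, 'c) module \<Rightarrow> ('a, 'd) module"
  where "copy_module j K = (let j' = inv_into (carrier K) j in
    \<lparr>carrier = j ` carrier K, monoid.mult = undefined, one = undefined, ring.zero = j \<zero>\<^bsub>K\<^esub>,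
     add = (\<lambda>x y. j (j' x \<oplus>\<^bsub>K\<^esub> j' y)), smult = (\<lambda>a x. j (a \<odot>\<^bsub>K\<^esub> j' x))\<rparr>)"

lemma copy_module_simps:
  assumes "inj_on j (carrier K)"
  shows "carrier (copy_module j K) = j ` carrier K"
    and "\<zero>\<^bsub>copy_module j K\<^esub> = j \<zero>\<^bsub>K\<^esub>"
    and "x \<in> carrier K \<Longrightarrow> y \<in> carrier K \<Longrightarrow> j x \<oplus>\<^bsub>copy_module j K\<^esub> j y = j (x \<oplus>\<^bsub>K\<^esub> y)"
    and "x \<in> carrier K \<Longrightarrow> a \<odot>\<^bsub>copy_module j K\<^esub> j x = j (a \<odot>\<^bsub>K\<^esub> x)"
  using assms by (simp_all add: copy_module_def Let_def)

lemma module_copy_module: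
  assumes K: "Module.module A K" and j: "inj_on j (carrier K)"
  shows "Module.module A (copy_module j K)"
proof -
  interpret K: Module.module A K by fact
  note s = copy_module_simps[OF j]
  show ?thesis
  proof (rule moduleI)
    show "cring A" by (rule K.R.cring_axioms)
    show "abelian_group (copy_module j K)"
    proof (rule abelian_groupI)
      fix x assume "x \<in> carrier (copy_module j K)"
      then obtain x' where "x' \<in> carrier K" "x = j x'" by (auto simp: s)
      then show "\<exists>y\<in>carrier (copy_module j K). y \<oplus>\<^bsub>copy_module j K\<^esub> x = \<zero>\<^bsub>copy_module j K\<^esub>"
        by (intro bexI[of _ "j (\<ominus>\<^bsub>K\<^esub> x')"]) (auto simp: s K.M.l_neg)
    qed (auto simp: s K.M.a_ac)
  qed (auto simp: s K.smult_l_distr K.smult_r_distr K.smult_assoc1)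
qed

lemma mod_homI:
  assumes "\<And>x. x \<in> carrier K \<Longrightarrow> f x \<in> carrier L"
    and "\<And>x y. x \<in> carrier K \<Longrightarrow> y \<in> carrier K \<Longrightarrow> f (x \<oplus>\<^bsub>K\<^esub> y) = f x \<oplus>\<^bsub>L\<^esub> f y"
    and "\<And>a x. a \<in> carrier A \<Longrightarrow> x \<in> carrier K \<Longrightarrow> f (a \<odot>\<^bsub>K\<^esub> x) = a \<odot>\<^bsub>L\<^esub> f x"
  shows "f \<in> mod_hom A K L"
  using assms by (auto simp: mod_hom_def hom_def)

lemma mod_homD:
  assumes "f \<in> mod_hom A K L"
  shows "x \<in> carrier K \<Longrightarrow> f x \<in> carrier L"
    and "x \<in> carrier K \<Longrightarrow> y \<in> carrier K \<Longrightarrow> f (x \<oplus>\<^bsub>K\<^esub> y) = f x \<oplus>\<^bsub>L\<^esub> f y"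
    and "a \<in> carrier A \<Longrightarrow> x \<in> carrier K \<Longrightarrow> f (a \<odot>\<^bsub>K\<^esub> x) = a \<odot>\<^bsub>L\<^esub> f x"
  using assms by (auto simp: mod_hom_def hom_def)

lemma mod_hom_comp:
  assumes "f \<in> mod_hom A K L" "g \<in> mod_hom A L N"
  shows "g \<circ> f \<in> mod_hom A K N"
  using mod_homD[OF assms(1)] mod_homD[OF assms(2)] by (intro mod_homI) auto

lemma mod_hom_copy:
  assumes j: "inj_on j (carrier K)"
  shows "j \<in> mod_hom A K (copy_module j K)"
  by (intro mod_homI) (auto simp: copy_module_simps[OF j])

lemma mod_hom_copy_inv:
  assumes K: "Module.module A K" and j: "inj_on j (carrier K)"
  shows "inv_into (carrier K) j \<in> mod_hom A (copy_module j K) K"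
proof -
  interpret K: Module.module A K by fact
  show ?thesis
    by (intro mod_homI) (auto simp: copy_module_simps[OF j] inv_into_f_f[OF j])
qed


subsection \<open>Functoriality of the tensor relations\<close>

lemma tensor_gens_keys:
  assumes "Module.module A K" "Module.module A N" "g \<in> tensor_gens A K N"
  shows "Poly_Mapping.keys g \<subseteq> carrier K \<times> carrier N"
proof -
  interpret K: Module.module A K by fact
  interpret N: Module.module A N by fact
  have *: "Poly_Mapping.keys (frag_of a - frag_of b) \<subseteq> {a, b}"
    "Poly_Mapping.keys (frag_of a - frag_of b - frag_of c) \<subseteq> {a, b, c}" for a b c :: "'c \<times> 'd"
    using keys_diff[of "frag_of a" "frag_of b"] keys_diff[of "frag_of a - frag_of b" "frag_of c"]
    by auto
  from assms(3) consider
      x y n where "g = frag_of (x \<oplus>\<^bsub>K\<^esub> y, n) - frag_of (x, n) - frag_of (y, n)"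
        "x \<in> carrier K" "y \<in> carrier K" "n \<in> carrier N"
    | x n p where "g = frag_of (x, n \<oplus>\<^bsub>N\<^esub> p) - frag_of (x, n) - frag_of (x, p)"
        "x \<in> carrier K" "n \<in> carrier N" "p \<in> carrier N"
    | a x n where "g = frag_of (a \<odot>\<^bsub>K\<^esub> x, n) - frag_of (x, a \<odot>\<^bsub>N\<^esub> n)"
        "a \<in> carrier A" "x \<in> carrier K" "n \<in> carrier N"
    unfolding tensor_gens_def by blast
  then show ?thesis
  proof cases
    case 1
    show ?thesis unfolding 1(1) by (rule order_trans[OF *(2)]) (use 1 in simp)
  next
    case 2
    show ?thesis unfolding 2(1) by (rule order_trans[OF *(2)]) (use 2 in simp)
  next
    case 3
    show ?thesis unfolding 3(1) by (rule order_trans[OF *(1)]) (use 3 in simp)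
  qed
qed

lemma tensor_rel_subgroup:
  assumes "Module.module A K" "Module.module A N"
  shows "subgroup (tensor_rel A K N) (free_Abelian_group (carrier K \<times> carrier N))"
  unfolding tensor_rel_def
  by (intro group.generate_is_subgroup subsetI)
    (simp_all only: group_free_Abelian_group carrier_free_Abelian_group_iff tensor_gens_keys[OF assms])

lemma tensor_rel_closed:
  assumes "Module.module A K" "Module.module A N"
  shows "0 \<in> tensor_rel A K N"
    and "x \<in> tensor_rel A K N \<Longrightarrow> y \<in> tensor_rel A K N \<Longrightarrow> x + y \<in> tensor_rel A K N"
    and "x \<in> tensor_rel A K N \<Longrightarrow> - x \<in> tensor_rel A K N"
    and "x \<in> tensor_rel A K N \<Longrightarrow> Poly_Mapping.keys x \<subseteq> carrier K \<times> carrier N"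
    and "x \<in> tensor_gens A K N \<Longrightarrow> x \<in> tensor_rel A K N"
proof -
  interpret S: subgroup "tensor_rel A K N" "free_Abelian_group (carrier K \<times> carrier N)"
    by (rule tensor_rel_subgroup[OF assms])
  show "0 \<in> tensor_rel A K N" using S.one_closed by simp
  show "x \<in> tensor_rel A K N \<Longrightarrow> y \<in> tensor_rel A K N \<Longrightarrow> x + y \<in> tensor_rel A K N"
    using S.m_closed by simp
  show k: "Poly_Mapping.keys x \<subseteq> carrier K \<times> carrier N" if "x \<in> tensor_rel A K N"
    using S.mem_carrier[OF that] by (simp only: carrier_free_Abelian_group_iff)
  show "- x \<in> tensor_rel A K N" if "x \<in> tensor_rel A K N"
    using S.m_inv_closed[OF that] by (simp only: inv_free_Abelian_group[OF k[OF that]])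
  show "x \<in> tensor_gens A K N \<Longrightarrow> x \<in> tensor_rel A K N"
    unfolding tensor_rel_def by (rule generate.incl)
qed

lemma tensor_rel_induct [consumes 3, case_names zero gen neg add]:
  assumes "Module.module A K" "Module.module A N" "x \<in> tensor_rel A K N"
    and "P 0" and gen: "\<And>g. g \<in> tensor_gens A K N \<Longrightarrow> P g"
    and neg: "\<And>x. x \<in> tensor_rel A K N \<Longrightarrow> P x \<Longrightarrow> P (- x)"
    and add: "\<And>x y. x \<in> tensor_rel A K N \<Longrightarrow> y \<in> tensor_rel A K N \<Longrightarrow> P x \<Longrightarrow> P y \<Longrightarrow> P (x + y)"
  shows "P x"
  using assms(3) unfolding tensor_rel_def
proof (induction rule: generate.induct)
  case (inv h)
  then show ?case
    using tensor_gens_keys[OF assms(1,2) inv] neg[OF _ gen] tensor_rel_closed(5)[OF assms(1,2)]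
    by simp
next
  case (eng x y)
  then show ?case using add by (simp add: tensor_rel_def)
qed (use assms in auto)

lemma tensor_push_simps [simp]:
  "tensor_push f 0 = 0" "tensor_push f (frag_of (x, n)) = frag_of (f x, n)"
  "tensor_push f (u + v) = tensor_push f u + tensor_push f v"
  "tensor_push f (u - v) = tensor_push f u - tensor_push f v"
  "tensor_push f (- u) = - tensor_push f u"
  by (simp_all add: tensor_push_def frag_extend_add frag_extend_diff frag_extend_minus)

lemma tensor_push_comp: "tensor_push g (tensor_push f u) = tensor_push (g \<circ> f) u"
proof -
  have "Poly_Mapping.keys u \<subseteq> UNIV" by simp
  then show ?thesis
  proof (induction u rule: frag_induction)
    case (one p)
    then show ?case by (cases p) simp
  qed simp_all
qed

lemma tensor_push_ident:
  assumes "Poly_Mapping.keys u \<subseteq> C \<times> D" and "\<And>x. x \<in> C \<Longrightarrow> f x = x"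
  shows "tensor_push f u = u"
  using assms(1)
proof (induction u rule: frag_induction)
  case (one p)
  then show ?case by (cases p) (simp add: assms(2))
qed simp_all

lemma tensor_push_cong:
  assumes "Poly_Mapping.keys u \<subseteq> C \<times> D" and "\<And>x. x \<in> C \<Longrightarrow> f x = g x"
  shows "tensor_push f u = tensor_push g u"
  using assms(1)
proof (induction u rule: frag_induction)
  case (one p)
  then show ?case by (cases p) (simp add: assms(2))
qed simp_all

lemma tensor_push_keys:
  assumes "Poly_Mapping.keys u \<subseteq> C \<times> D" and "\<And>x. x \<in> C \<Longrightarrow> f x \<in> E"
  shows "Poly_Mapping.keys (tensor_push f u) \<subseteq> E \<times> D"
  using assms(1)
proof (induction u rule: frag_induction)
  case (one p)
  then show ?case by (cases p) (simp add: assms(2))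
next
  case (diff a b)
  then show ?case
    unfolding tensor_push_simps by (intro order_trans[OF keys_diff] Un_least)
qed simp

lemma tensor_push_gens:
  assumes "f \<in> mod_hom A K L" and "u \<in> tensor_gens A K N"
  shows "tensor_push f u \<in> tensor_gens A L N"
proof -
  note h = mod_homD[OF assms(1)]
  from assms(2) consider
      x y n where "u = frag_of (x \<oplus>\<^bsub>K\<^esub> y, n) - frag_of (x, n) - frag_of (y, n)"
        "x \<in> carrier K" "y \<in> carrier K" "n \<in> carrier N"
    | x n p where "u = frag_of (x, n \<oplus>\<^bsub>N\<^esub> p) - frag_of (x, n) - frag_of (x, p)"
        "x \<in> carrier K" "n \<in> carrier N" "p \<in> carrier N"
    | a x n where "u = frag_of (a \<odot>\<^bsub>K\<^esub> x, n) - frag_of (x, a \<odot>\<^bsub>N\<^esub> n)"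
        "a \<in> carrier A" "x \<in> carrier K" "n \<in> carrier N"
    unfolding tensor_gens_def by blast
  then show ?thesis
  proof cases
    case 1
    then have "tensor_push f u =
        frag_of (f x \<oplus>\<^bsub>L\<^esub> f y, n) - frag_of (f x, n) - frag_of (f y, n)"
      by (simp add: h(2))
    then show ?thesis unfolding tensor_gens_def using 1 h(1) by blast
  next
    case 2
    then have "tensor_push f u =
        frag_of (f x, n \<oplus>\<^bsub>N\<^esub> p) - frag_of (f x, n) - frag_of (f x, p)"
      by simp
    then show ?thesis unfolding tensor_gens_def using 2 h(1) by blast
  next
    case 3
    then have "tensor_push f u = frag_of (a \<odot>\<^bsub>L\<^esub> f x, n) - frag_of (f x, a \<odot>\<^bsub>N\<^esub> n)"
      by (simp add: h(3))
    then show ?thesis unfolding tensor_gens_def using 3 h(1) by blast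
  qed
qed

lemma tensor_push_rel:
  assumes K: "Module.module A K" and L: "Module.module A L" and N: "Module.module A N"
    and f: "f \<in> mod_hom A K L" and u: "u \<in> tensor_rel A K N"
  shows "tensor_push f u \<in> tensor_rel A L N"
  using K N u
  by (induction rule: tensor_rel_induct)
    (auto intro: tensor_rel_closed[OF L N] tensor_push_gens[OF f])

lemma tensor_map_coset:
  assumes K: "Module.module A K" and L: "Module.module A L" and N: "Module.module A N"
    and f: "f \<in> mod_hom A K L"
  shows "tensor_map A f K L N
      (tensor_rel A K N #>\<^bsub>free_Abelian_group (carrier K \<times> carrier N)\<^esub> u) =
    tensor_rel A L N #>\<^bsub>free_Abelian_group (carrier L \<times> carrier N)\<^esub> tensor_push f u"
    (is "?l = ?r")
proof -
  note cl = tensor_rel_closed[OF L N]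
  have "?l = (\<Union>h\<in>tensor_rel A K N. \<Union>h'\<in>tensor_rel A L N. {h' + (tensor_push f h + tensor_push f u)})"
    by (auto simp: tensor_map_def r_coset_def)
  also have "\<dots> = (\<Union>h\<in>tensor_rel A L N. {h + tensor_push f u})"
  proof (intro equalityI subsetI)
    fix w assume "w \<in> (\<Union>h\<in>tensor_rel A K N. \<Union>h'\<in>tensor_rel A L N.
      {h' + (tensor_push f h + tensor_push f u)})"
    then obtain h h' where h: "h \<in> tensor_rel A K N" "h' \<in> tensor_rel A L N"
      and w: "w = (h' + tensor_push f h) + tensor_push f u"
      by (auto simp: add.assoc)
    from h have "h' + tensor_push f h \<in> tensor_rel A L N"
      by (intro cl(2) tensor_push_rel[OF K L N f])
    then show "w \<in> (\<Union>h\<in>tensor_rel A L N. {h + tensor_push f u})" unfolding w by blast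
  next
    fix w assume "w \<in> (\<Union>h\<in>tensor_rel A L N. {h + tensor_push f u})"
    then obtain h where "h \<in> tensor_rel A L N" "w = h + (tensor_push f 0 + tensor_push f u)"
      by auto
    then show "w \<in> (\<Union>h\<in>tensor_rel A K N. \<Union>h'\<in>tensor_rel A L N.
        {h' + (tensor_push f h + tensor_push f u)})"
      using tensor_rel_closed(1)[OF K N] by blast
  qed
  also have "\<dots> = ?r" by (simp add: r_coset_def)
  finally show ?thesis .
qed

lemma tensor_coset_eq_iff:
  assumes "Module.module A K" "Module.module A N"
  shows "tensor_rel A K N #>\<^bsub>free_Abelian_group (carrier K \<times> carrier N)\<^esub> u =
      tensor_rel A K N #>\<^bsub>free_Abelian_group (carrier K \<times> carrier N)\<^esub> v \<longleftrightarrow> u - v \<in> tensor_rel A K N"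
    (is "?l u = ?l v \<longleftrightarrow> _")
proof -
  note cl = tensor_rel_closed[OF assms]
  have l: "?l w = {h + w | h. h \<in> tensor_rel A K N}" for w
    by (auto simp: r_coset_def)
  show ?thesis
  proof
    assume "?l u = ?l v"
    moreover have "u \<in> ?l u" using cl(1) by (force simp: l)
    ultimately show "u - v \<in> tensor_rel A K N" by (auto simp: l)
  next
    assume r: "u - v \<in> tensor_rel A K N"
    have "h + u \<in> ?l v" if "h \<in> tensor_rel A K N" for h
      using cl(2)[OF that r] by (auto simp: l intro!: exI[of _ "h + (u - v)"])
    moreover have "h + v \<in> ?l u" if "h \<in> tensor_rel A K N" for h
      using cl(2)[OF that cl(3)[OF r]] by (auto simp: l intro!: exI[of _ "h + (v - u)"])
    ultimately show "?l u = ?l v" by (auto simp: l[of u] l[of v])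
  qed
qed

lemma inj_on_tensor_map_iff:
  assumes K: "Module.module A K" and L: "Module.module A L" and N: "Module.module A N"
    and f: "f \<in> mod_hom A K L"
  shows "inj_on (tensor_map A f K L N) (carrier (tensor_product A K N)) \<longleftrightarrow>
    (\<forall>u. Poly_Mapping.keys u \<subseteq> carrier K \<times> carrier N \<longrightarrow>
       tensor_push f u \<in> tensor_rel A L N \<longrightarrow> u \<in> tensor_rel A K N)"
    (is "?l \<longleftrightarrow> ?r")
proof -
  let ?c = "\<lambda>u. tensor_rel A K N #>\<^bsub>free_Abelian_group (carrier K \<times> carrier N)\<^esub> u"
  have car: "carrier (tensor_product A K N) = ?c ` {u. Poly_Mapping.keys u \<subseteq> carrier K \<times> carrier N}"
    by (auto simp: tensor_product_def FactGroup_def RCOSETS_def free_Abelian_group_def)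
  have "?l \<longleftrightarrow> (\<forall>u v. Poly_Mapping.keys u \<subseteq> carrier K \<times> carrier N \<longrightarrow>
      Poly_Mapping.keys v \<subseteq> carrier K \<times> carrier N \<longrightarrow>
      tensor_push f u - tensor_push f v \<in> tensor_rel A L N \<longrightarrow> u - v \<in> tensor_rel A K N)"
    unfolding car inj_on_def
    by (auto simp: tensor_map_coset[OF K L N f] tensor_coset_eq_iff[OF L N] tensor_coset_eq_iff[OF K N])
  also have "\<dots> \<longleftrightarrow> ?r"
  proof (intro iffI allI impI)
    fix u assume "\<forall>u v. Poly_Mapping.keys u \<subseteq> carrier K \<times> carrier N \<longrightarrow>
      Poly_Mapping.keys v \<subseteq> carrier K \<times> carrier N \<longrightarrow>
      tensor_push f u - tensor_push f v \<in> tensor_rel A L N \<longrightarrow> u - v \<in> tensor_rel A K N"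
      "Poly_Mapping.keys u \<subseteq> carrier K \<times> carrier N" "tensor_push f u \<in> tensor_rel A L N"
    then show "u \<in> tensor_rel A K N"
      by (metis diff_zero empty_subsetI keys_zero tensor_push_simps(1))
  next
    fix u v assume r: ?r and k: "Poly_Mapping.keys u \<subseteq> carrier K \<times> carrier N"
      "Poly_Mapping.keys v \<subseteq> carrier K \<times> carrier N"
      "tensor_push f u - tensor_push f v \<in> tensor_rel A L N"
    have "Poly_Mapping.keys (u - v) \<subseteq> carrier K \<times> carrier N"
      by (rule order_trans[OF keys_diff]) (use k in blast)
    then show "u - v \<in> tensor_rel A K N" using r k(3) by simp
  qed
  finally show ?thesis .
qed


subsection \<open>Finitely generated submodules\<close>

fun lincomb :: "('a, 'b, 'n) module_scheme \<Rightarrow> 'a list \<Rightarrow> 'b list \<Rightarrow> 'b"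
  where "lincomb K (a # as) (x # xs) = a \<odot>\<^bsub>K\<^esub> x \<oplus>\<^bsub>K\<^esub> lincomb K as xs"
  | "lincomb K _ _ = \<zero>\<^bsub>K\<^esub>"

definition list_span :: "('a, 'm) ring_scheme \<Rightarrow> ('a, 'b, 'n) module_scheme \<Rightarrow> 'b list \<Rightarrow> 'b set"
  where "list_span A K xs = {lincomb K as xs | as. length as = length xs \<and> set as \<subseteq> carrier A}"

lemma list_spanI:
  "x = lincomb K as xs \<Longrightarrow> length as = length xs \<Longrightarrow> set as \<subseteq> carrier A \<Longrightarrow> x \<in> list_span A K xs"
  by (auto simp: list_span_def)

context Module.module
begin

lemma lincomb_closed:
  "set as \<subseteq> carrier R \<Longrightarrow> set xs \<subseteq> carrier M \<Longrightarrow> lincomb M as xs \<in> carrier M"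
  by (induction as xs rule: list_induct2') auto

lemma lincomb_add:
  assumes "length as = length xs" "length bs = length xs"
    "set as \<subseteq> carrier R" "set bs \<subseteq> carrier R" "set xs \<subseteq> carrier M"
  shows "lincomb M as xs \<oplus>\<^bsub>M\<^esub> lincomb M bs xs = lincomb M (map2 (add R) as bs) xs"
  using assms
proof (induction xs arbitrary: as bs)
  case (Cons x xs)
  obtain a as' b bs' where ab: "as = a # as'" "bs = b # bs'"
    using Cons.prems(1,2) by (metis length_Suc_conv list.size(4) add_Suc_right add_0_right)
  have "(a \<odot>\<^bsub>M\<^esub> x \<oplus>\<^bsub>M\<^esub> lincomb M as' xs) \<oplus>\<^bsub>M\<^esub> (b \<odot>\<^bsub>M\<^esub> x \<oplus>\<^bsub>M\<^esub> lincomb M bs' xs) =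
      (a \<odot>\<^bsub>M\<^esub> x \<oplus>\<^bsub>M\<^esub> b \<odot>\<^bsub>M\<^esub> x) \<oplus>\<^bsub>M\<^esub> (lincomb M as' xs \<oplus>\<^bsub>M\<^esub> lincomb M bs' xs)"
    using Cons.prems ab by (simp add: M.a_ac lincomb_closed)
  then show ?case
    using Cons.prems Cons.IH[of as' bs'] ab by (simp add: smult_l_distr)
qed auto

lemma lincomb_smult:
  assumes "c \<in> carrier R" "length as = length xs" "set as \<subseteq> carrier R" "set xs \<subseteq> carrier M"
  shows "c \<odot>\<^bsub>M\<^esub> lincomb M as xs = lincomb M (map (\<lambda>a. c \<otimes>\<^bsub>R\<^esub> a) as) xs"
  using assms
proof (induction xs arbitrary: as)
  case (Cons x xs)
  obtain a as' where "as = a # as'" using Cons.prems(2) by (cases as) auto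
  then show ?case
    using Cons.prems Cons.IH[of as'] by (simp add: smult_r_distr smult_assoc1 lincomb_closed)
qed auto

lemma lincomb_zero:
  "set xs \<subseteq> carrier M \<Longrightarrow> lincomb M (replicate (length xs) \<zero>\<^bsub>R\<^esub>) xs = \<zero>\<^bsub>M\<^esub>"
  by (induction xs) auto

lemma lincomb_mem:
  "set xs \<subseteq> carrier M \<Longrightarrow> x \<in> set xs \<Longrightarrow> x \<in> list_span R M xs"
proof (induction xs)
  case (Cons y xs)
  show ?case
  proof (cases "x = y")
    case True
    have "lincomb M (\<one>\<^bsub>R\<^esub> # replicate (length xs) \<zero>\<^bsub>R\<^esub>) (y # xs) = x"
      using Cons.prems True lincomb_zero[of xs] by simp
    moreover have "set (\<one>\<^bsub>R\<^esub> # replicate (length xs) \<zero>\<^bsub>R\<^esub>) \<subseteq> carrier R"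
      by (auto simp: in_set_replicate)
    ultimately show ?thesis
      using list_spanI[of x M "\<one>\<^bsub>R\<^esub> # replicate (length xs) \<zero>\<^bsub>R\<^esub>" "y # xs" R] by simp
  next
    case False
    then obtain as where as: "x = lincomb M as xs" "length as = length xs" "set as \<subseteq> carrier R"
      using Cons by (auto simp: list_span_def)
    then have "lincomb M (\<zero>\<^bsub>R\<^esub> # as) (y # xs) = x"
      using Cons.prems lincomb_closed[of as xs] by simp
    then show ?thesis using list_spanI[of x M "\<zero>\<^bsub>R\<^esub> # as" "y # xs" R] as by simp
  qed
qed simp

lemma list_span_submodule:
  assumes xs: "set xs \<subseteq> carrier M"
  shows "submodule (list_span R M xs) R M"
proof -
  have smult: "c \<odot>\<^bsub>M\<^esub> x \<in> list_span R M xs" if c: "c \<in> carrier R" and x: "x \<in> list_span R M xs" for c x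
  proof -
    from x obtain as where as: "x = lincomb M as xs" "length as = length xs" "set as \<subseteq> carrier R"
      by (auto simp: list_span_def)
    then have "c \<odot>\<^bsub>M\<^esub> x = lincomb M (map (\<lambda>a. c \<otimes>\<^bsub>R\<^esub> a) as) xs"
      using lincomb_smult c xs by simp
    then show ?thesis
      by (rule list_spanI) (use as c in auto)
  qed
  have sub: "list_span R M xs \<subseteq> carrier M"
    using xs by (auto simp: list_span_def lincomb_closed)
  show ?thesis
  proof (rule submoduleI)
    show "\<zero>\<^bsub>M\<^esub> \<in> list_span R M xs"
      by (rule list_spanI[OF lincomb_zero[OF xs, symmetric]]) (auto simp: in_set_replicate)
    show "\<ominus>\<^bsub>M\<^esub> x \<in> list_span R M xs" if x: "x \<in> list_span R M xs" for x
    proof -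
      have "\<ominus>\<^bsub>M\<^esub> x = (\<ominus>\<^bsub>R\<^esub> \<one>\<^bsub>R\<^esub>) \<odot>\<^bsub>M\<^esub> x"
        using x sub by (subst smult_l_minus) auto
      then show ?thesis using smult x by simp
    qed
    show "x \<oplus>\<^bsub>M\<^esub> y \<in> list_span R M xs" if xy: "x \<in> list_span R M xs" "y \<in> list_span R M xs" for x y
    proof -
      from xy obtain as bs where ab: "x = lincomb M as xs" "length as = length xs" "set as \<subseteq> carrier R"
        "y = lincomb M bs xs" "length bs = length xs" "set bs \<subseteq> carrier R"
        by (auto simp: list_span_def)
      have "set (map2 (add R) as bs) \<subseteq> carrier R"
        using ab(3,6) by (auto dest: set_zip_leftD set_zip_rightD)
      then show ?thesis
        using list_spanI[OF lincomb_add[OF ab(2,5,3,6) xs]] ab by simp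
    qed
  qed (use sub smult in auto)
qed

text \<open>
  Sending an element of a finitely generated submodule to the set of its coefficient lists embeds
  the submodule into the type \<open>'a list set\<close>.
\<close>

lemma list_span_embedding:
  obtains j :: "'c \<Rightarrow> 'a list set" where "inj_on j (list_span R M xs)"
proof
  show "inj_on (\<lambda>x. {as. length as = length xs \<and> set as \<subseteq> carrier R \<and> lincomb M as xs = x})
    (list_span R M xs)"
    by (rule inj_onI) (auto simp: list_span_def)
qed

end


lemma mod_hom_zero:
  assumes "Module.module A K" "Module.module A L" and f: "f \<in> mod_hom A K L"
  shows "f \<zero>\<^bsub>K\<^esub> = \<zero>\<^bsub>L\<^esub>"
proof -
  interpret K: Module.module A K by fact
  interpret L: Module.module A L by fact
  have "f (\<zero>\<^bsub>A\<^esub> \<odot>\<^bsub>K\<^esub> \<zero>\<^bsub>K\<^esub>) = \<zero>\<^bsub>A\<^esub> \<odot>\<^bsub>L\<^esub> f \<zero>\<^bsub>K\<^esub>"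
    by (rule mod_homD(3)[OF f]) auto
  then show ?thesis using mod_homD(1)[OF f K.M.zero_closed] by simp
qed


subsection \<open>Flatness does not depend on the type of the test modules\<close>

lemma submodule_mod_hom:
  assumes f: "f \<in> mod_hom A K L" and "H \<subseteq> carrier K" and "f ` H \<subseteq> I"
  shows "f \<in> mod_hom A (K\<lparr>carrier := H\<rparr>) (L\<lparr>carrier := I\<rparr>)"
  by (intro mod_homI) (use subsetD[OF assms(2)] assms(3) in \<open>auto simp: mod_homD(2,3)[OF f]\<close>)

lemma tensor_gensI:
  "x \<in> carrier K \<Longrightarrow> y \<in> carrier K \<Longrightarrow> n \<in> carrier N \<Longrightarrow>
    frag_of (x \<oplus>\<^bsub>K\<^esub> y, n) - frag_of (x, n) - frag_of (y, n) \<in> tensor_gens A K N"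
  "x \<in> carrier K \<Longrightarrow> n \<in> carrier N \<Longrightarrow> p \<in> carrier N \<Longrightarrow>
    frag_of (x, n \<oplus>\<^bsub>N\<^esub> p) - frag_of (x, n) - frag_of (x, p) \<in> tensor_gens A K N"
  "a \<in> carrier A \<Longrightarrow> x \<in> carrier K \<Longrightarrow> n \<in> carrier N \<Longrightarrow>
    frag_of (a \<odot>\<^bsub>K\<^esub> x, n) - frag_of (x, a \<odot>\<^bsub>N\<^esub> n) \<in> tensor_gens A K N"
  unfolding tensor_gens_def by blast+

lemma tensor_rel_finitely_generated:
  assumes L: "Module.module A L" and N: "Module.module A N" and u: "u \<in> tensor_rel A L N"
  shows "\<exists>F. finite F \<and> F \<subseteq> carrier L \<and>
    (\<forall>H. submodule H A L \<longrightarrow> F \<subseteq> H \<longrightarrow> u \<in> tensor_rel A (L\<lparr>carrier := H\<rparr>) N)"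
proof -
  note mL = submodule.submodule_is_module[OF _ L]
  from L N u show ?thesis
  proof (induction rule: tensor_rel_induct)
    case zero
    show ?case by (intro exI[of _ "{}"]) (simp add: tensor_rel_closed(1)[OF mL N])
  next
    case (gen g)
    then consider
        x y n where "g = frag_of (x \<oplus>\<^bsub>L\<^esub> y, n) - frag_of (x, n) - frag_of (y, n)"
          "x \<in> carrier L" "y \<in> carrier L" "n \<in> carrier N"
      | x n p where "g = frag_of (x, n \<oplus>\<^bsub>N\<^esub> p) - frag_of (x, n) - frag_of (x, p)"
          "x \<in> carrier L" "n \<in> carrier N" "p \<in> carrier N"
      | a x n where "g = frag_of (a \<odot>\<^bsub>L\<^esub> x, n) - frag_of (x, a \<odot>\<^bsub>N\<^esub> n)"
          "a \<in> carrier A" "x \<in> carrier L" "n \<in> carrier N"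
      unfolding tensor_gens_def by blast
    then show ?case
    proof cases
      case 1
      have "g \<in> tensor_rel A (L\<lparr>carrier := H\<rparr>) N" if H: "submodule H A L" "{x, y} \<subseteq> H" for H
        by (rule tensor_rel_closed(5)[OF mL[OF H(1)] N]) (use tensor_gensI(1)[of x "L\<lparr>carrier := H\<rparr>" y n N A] 1 H(2) in simp)
      then show ?thesis using 1 by (intro exI[of _ "{x, y}"]) simp
    next
      case 2
      have "g \<in> tensor_rel A (L\<lparr>carrier := H\<rparr>) N" if H: "submodule H A L" "{x} \<subseteq> H" for H
        by (rule tensor_rel_closed(5)[OF mL[OF H(1)] N]) (use tensor_gensI(2)[of x "L\<lparr>carrier := H\<rparr>" n N p A] 2 H(2) in simp)
      then show ?thesis using 2 by (intro exI[of _ "{x}"]) simp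
    next
      case 3
      have "g \<in> tensor_rel A (L\<lparr>carrier := H\<rparr>) N" if H: "submodule H A L" "{x} \<subseteq> H" for H
        by (rule tensor_rel_closed(5)[OF mL[OF H(1)] N]) (use tensor_gensI(3)[of a A x "L\<lparr>carrier := H\<rparr>" n N] 3 H(2) in simp)
      then show ?thesis using 3 by (intro exI[of _ "{x}"]) simp
    qed
  next
    case (neg x)
    then obtain F where F: "finite F" "F \<subseteq> carrier L"
      and "\<And>H. submodule H A L \<Longrightarrow> F \<subseteq> H \<Longrightarrow> x \<in> tensor_rel A (L\<lparr>carrier := H\<rparr>) N"
      by blast
    then show ?case by (intro exI[of _ F]) (simp add: tensor_rel_closed(3)[OF mL N])
  next
    case (add x y)
    then obtain F G where FG: "finite F" "F \<subseteq> carrier L" "finite G" "G \<subseteq> carrier L"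
      and "\<And>H. submodule H A L \<Longrightarrow> F \<subseteq> H \<Longrightarrow> x \<in> tensor_rel A (L\<lparr>carrier := H\<rparr>) N"
      and "\<And>H. submodule H A L \<Longrightarrow> G \<subseteq> H \<Longrightarrow> y \<in> tensor_rel A (L\<lparr>carrier := H\<rparr>) N"
      by blast
    then have "\<forall>H. submodule H A L \<longrightarrow> F \<union> G \<subseteq> H \<longrightarrow> x + y \<in> tensor_rel A (L\<lparr>carrier := H\<rparr>) N"
      using tensor_rel_closed(2)[OF mL N] by simp
    with FG show ?case by (intro exI[of _ "F \<union> G"]) simp
  qed
qed

theorem flat_module_inj:
  fixes A :: "('a, 'm) ring_scheme" and N :: "('a, 'b) module"
    and K :: "('a, 'c) module" and L :: "('a, 'd) module"
  assumes flat: "flat_module A N"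
    and K: "Module.module A K" and L: "Module.module A L"
    and f: "f \<in> mod_hom A K L" and inj: "inj_on f (carrier K)"
  shows "inj_on (tensor_map A f K L N) (carrier (tensor_product A K N))"
proof -
  have N: "Module.module A N" using flat by (simp add: flat_module_def)
  interpret K: Module.module A K by fact
  interpret L: Module.module A L by fact
  have "u \<in> tensor_rel A K N"
    if ku: "Poly_Mapping.keys u \<subseteq> carrier K \<times> carrier N" and u: "tensor_push f u \<in> tensor_rel A L N" for u
  proof -
    obtain F where F: "finite F" "F \<subseteq> carrier L"
      and FH: "\<And>H. submodule H A L \<Longrightarrow> F \<subseteq> H \<Longrightarrow> tensor_push f u \<in> tensor_rel A (L\<lparr>carrier := H\<rparr>) N"
      using tensor_rel_finitely_generated[OF L N u] by blast
    have "finite (fst ` Poly_Mapping.keys u)" by simp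
    then obtain xs where xs: "set xs = fst ` Poly_Mapping.keys u" using finite_list by blast
    obtain ys where ys: "set ys = F \<union> f ` set xs" using finite_list F(1) by (metis List.finite_set finite_UnI finite_imageI)
    have xsK: "set xs \<subseteq> carrier K" using ku xs by auto
    have ysL: "set ys \<subseteq> carrier L" using ys F(2) xsK mod_homD(1)[OF f] by auto
    define H where "H = list_span A K xs"
    define I where "I = list_span A L ys"
    have H: "submodule H A K" unfolding H_def by (rule K.list_span_submodule[OF xsK])
    have I: "submodule I A L" unfolding I_def by (rule L.list_span_submodule[OF ysL])
    have HK: "H \<subseteq> carrier K" by (rule K.submoduleE(1)[OF H])
    have IL: "I \<subseteq> carrier L" by (rule L.submoduleE(1)[OF I])
    have ysI: "set ys \<subseteq> I" unfolding I_def using L.lincomb_mem[OF ysL] by blast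
    have xsH: "set xs \<subseteq> H" unfolding H_def using K.lincomb_mem[OF xsK] by blast
    interpret I: submodule I A L by fact
    have f_span: "f (lincomb K as zs) \<in> I" if "set as \<subseteq> carrier A" "set zs \<subseteq> set xs" for as zs
      using that
    proof (induction as zs rule: list_induct2')
      case (4 a as z zs)
      then have "f (a \<odot>\<^bsub>K\<^esub> z \<oplus>\<^bsub>K\<^esub> lincomb K as zs) = a \<odot>\<^bsub>L\<^esub> f z \<oplus>\<^bsub>L\<^esub> f (lincomb K as zs)"
        using xsK K.lincomb_closed[of as zs] by (subst mod_homD(2)[OF f]) (auto simp: mod_homD(3)[OF f])
      moreover have "f z \<in> I" using 4 ysI ys by auto
      ultimately show ?case using 4 L.submoduleE(4,5)[OF I] by simp
    qed (use mod_hom_zero[OF K L f] I.one_closed in simp_all)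
    have fHI: "f ` H \<subseteq> I" unfolding H_def list_span_def using f_span by blast
    let ?K = "K\<lparr>carrier := H\<rparr>" and ?L = "L\<lparr>carrier := I\<rparr>"
    have mK: "Module.module A ?K" by (rule submodule.submodule_is_module[OF H K])
    have mL: "Module.module A ?L" by (rule submodule.submodule_is_module[OF I L])
    have f': "f \<in> mod_hom A ?K ?L" by (rule submodule_mod_hom[OF f HK fHI])
    obtain i :: "'c \<Rightarrow> 'a list set" where i: "inj_on i (carrier ?K)"
      using K.list_span_embedding[of xs] by (auto simp: H_def)
    obtain j :: "'d \<Rightarrow> 'a list set" where j: "inj_on j (carrier ?L)"
      using L.list_span_embedding[of ys] by (auto simp: I_def)
    let ?i = "inv_into (carrier ?K) i"
    let ?K' = "copy_module i ?K" and ?L' = "copy_module j ?L"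
    have mK': "Module.module A ?K'" by (rule module_copy_module[OF mK i])
    have mL': "Module.module A ?L'" by (rule module_copy_module[OF mL j])
    have hi: "i \<in> mod_hom A ?K ?K'" by (rule mod_hom_copy[OF i])
    have hj: "j \<in> mod_hom A ?L ?L'" by (rule mod_hom_copy[OF j])
    have hi': "?i \<in> mod_hom A ?K' ?K" by (rule mod_hom_copy_inv[OF mK i])
    define g where "g = j \<circ> f \<circ> ?i"
    have g: "g \<in> mod_hom A ?K' ?L'"
      unfolding g_def by (intro mod_hom_comp[OF hi'] mod_hom_comp[OF f'] hj)
    have "inj_on g (carrier ?K')"
    proof -
      have "inj_on f H" using inj HK by (rule inj_on_subset)
      then have "inj_on (j \<circ> f) H" using j fHI by (intro comp_inj_on) (auto intro: inj_on_subset)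
      moreover have "?i ` carrier ?K' = H" using i by (simp add: copy_module_simps)
      moreover have "inj_on ?i (carrier ?K')" using i
        by (simp add: copy_module_simps inj_on_inv_into)
      ultimately show ?thesis unfolding g_def by (intro comp_inj_on[of ?i _ "j \<circ> f"]) simp_all
    qed
    then have "inj_on (tensor_map A g ?K' ?L' N) (carrier (tensor_product A ?K' N))"
      using flat mK' mL' g unfolding flat_module_def by blast
    then have key: "v \<in> tensor_rel A ?K' N"
      if "Poly_Mapping.keys v \<subseteq> carrier ?K' \<times> carrier N" "tensor_push g v \<in> tensor_rel A ?L' N" for v
      using that unfolding inj_on_tensor_map_iff[OF mK' mL' N g] by blast
    have uH: "Poly_Mapping.keys u \<subseteq> H \<times> carrier N"
      using ku xs xsH by force
    have "tensor_push f u \<in> tensor_rel A ?L N" using FH[OF I] ysI ys by blast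
    then have "tensor_push j (tensor_push f u) \<in> tensor_rel A ?L' N"
      by (rule tensor_push_rel[OF mL mL' N hj])
    moreover have "tensor_push j (tensor_push f u) = tensor_push g (tensor_push i u)"
      unfolding tensor_push_comp by (rule tensor_push_cong[OF uH]) (use i in \<open>simp add: g_def\<close>)
    ultimately have "tensor_push g (tensor_push i u) \<in> tensor_rel A ?L' N" by simp
    moreover have "Poly_Mapping.keys (tensor_push i u) \<subseteq> carrier ?K' \<times> carrier N"
      by (rule tensor_push_keys[OF uH]) (use i in \<open>simp add: copy_module_simps\<close>)
    ultimately have "tensor_push i u \<in> tensor_rel A ?K' N" by (intro key)
    then have "tensor_push ?i (tensor_push i u) \<in> tensor_rel A ?K N"
      by (rule tensor_push_rel[OF mK' mK N hi'])
    also have "tensor_push ?i (tensor_push i u) = u"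
      unfolding tensor_push_comp by (rule tensor_push_ident[OF uH]) (use i in simp)
    finally have "u \<in> tensor_rel A ?K N" .
    moreover have "(\<lambda>x. x) \<in> mod_hom A ?K K" using HK by (intro mod_homI) auto
    ultimately have "tensor_push (\<lambda>x. x) u \<in> tensor_rel A K N"
      by (intro tensor_push_rel[OF mK K N])
    then show ?thesis using tensor_push_ident[OF ku, of "\<lambda>x. x"] by simp
  qed
  then show ?thesis unfolding inj_on_tensor_map_iff[OF K L N f] by blast
qed


subsection \<open>Projectivity does not depend on the type of the test modules\<close>

definition free_module :: "('a, 'm) ring_scheme \<Rightarrow> 'b set \<Rightarrow> ('a, 'b \<Rightarrow> 'a) module"
  where "free_module A C =
    \<lparr>carrier = {v. range v \<subseteq> carrier A \<and> finite {p. v p \<noteq> \<zero>\<^bsub>A\<^esub>} \<and> {p. v p \<noteq> \<zero>\<^bsub>A\<^esub>} \<subseteq> C},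
     monoid.mult = undefined, one = undefined, ring.zero = (\<lambda>_. \<zero>\<^bsub>A\<^esub>),
     add = (\<lambda>v w p. v p \<oplus>\<^bsub>A\<^esub> w p), smult = (\<lambda>a v p. a \<otimes>\<^bsub>A\<^esub> v p)\<rparr>"

lemma free_module_simps [simp]:
  "\<zero>\<^bsub>free_module A C\<^esub> = (\<lambda>_. \<zero>\<^bsub>A\<^esub>)"
  "v \<oplus>\<^bsub>free_module A C\<^esub> w = (\<lambda>p. v p \<oplus>\<^bsub>A\<^esub> w p)"
  "a \<odot>\<^bsub>free_module A C\<^esub> v = (\<lambda>p. a \<otimes>\<^bsub>A\<^esub> v p)"
  by (simp_all add: free_module_def)

lemma free_module_carrier:
  "v \<in> carrier (free_module A C) \<longleftrightarrow>
    (\<forall>p. v p \<in> carrier A) \<and> finite {p. v p \<noteq> \<zero>\<^bsub>A\<^esub>} \<and> {p. v p \<noteq> \<zero>\<^bsub>A\<^esub>} \<subseteq> C"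
  by (auto simp: free_module_def)

lemma module_free_module:
  assumes "cring A"
  shows "Module.module A (free_module A C)"
proof -
  interpret A: cring A by fact
  have add: "(\<lambda>p. v p \<oplus>\<^bsub>A\<^esub> w p) \<in> carrier (free_module A C)"
    if "v \<in> carrier (free_module A C)" "w \<in> carrier (free_module A C)" for v w
  proof -
    have sub: "{p. v p \<oplus>\<^bsub>A\<^esub> w p \<noteq> \<zero>\<^bsub>A\<^esub>} \<subseteq> {p. v p \<noteq> \<zero>\<^bsub>A\<^esub>} \<union> {p. w p \<noteq> \<zero>\<^bsub>A\<^esub>}"
      by auto
    have "finite ({p. v p \<noteq> \<zero>\<^bsub>A\<^esub>} \<union> {p. w p \<noteq> \<zero>\<^bsub>A\<^esub>})"
      using that by (simp add: free_module_carrier)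
    then show ?thesis
      using that finite_subset[OF sub] sub unfolding free_module_carrier by auto
  qed
  have smult: "(\<lambda>p. a \<otimes>\<^bsub>A\<^esub> v p) \<in> carrier (free_module A C)"
    if "a \<in> carrier A" "v \<in> carrier (free_module A C)" for a v
  proof -
    have sub: "{p. a \<otimes>\<^bsub>A\<^esub> v p \<noteq> \<zero>\<^bsub>A\<^esub>} \<subseteq> {p. v p \<noteq> \<zero>\<^bsub>A\<^esub>}"
      using that(1) by auto
    then show ?thesis
      using that finite_subset[OF sub] unfolding free_module_carrier by auto
  qed
  have car: "v p \<in> carrier A" if "v \<in> carrier (free_module A C)" for v p
    using that by (simp add: free_module_carrier)
  show ?thesis
  proof (rule moduleI)
    show "cring A" by fact
    show "abelian_group (free_module A C)"
    proof (rule abelian_groupI)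
      fix v assume v: "v \<in> carrier (free_module A C)"
      show "\<exists>w\<in>carrier (free_module A C). w \<oplus>\<^bsub>free_module A C\<^esub> v = \<zero>\<^bsub>free_module A C\<^esub>"
        using smult[OF _ v, of "\<ominus>\<^bsub>A\<^esub> \<one>\<^bsub>A\<^esub>"] car[OF v]
        by (intro bexI[of _ "\<lambda>p. (\<ominus>\<^bsub>A\<^esub> \<one>\<^bsub>A\<^esub>) \<otimes>\<^bsub>A\<^esub> v p"]) (auto simp: A.l_minus A.l_neg)
    next
      show "\<zero>\<^bsub>free_module A C\<^esub> \<in> carrier (free_module A C)"
        by (simp add: free_module_carrier)
    qed (simp_all add: add car A.a_ac)
  qed (auto simp: smult car A.l_distr A.r_distr A.m_assoc)
qed

definition free_eval :: "('a, 'm) ring_scheme \<Rightarrow> ('a, 'd) module \<Rightarrow> ('b \<Rightarrow> 'd) \<Rightarrow> ('b \<Rightarrow> 'a) \<Rightarrow> 'd"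
  where "free_eval A L x v = finsum L (\<lambda>p. v p \<odot>\<^bsub>L\<^esub> x p) {p. v p \<noteq> \<zero>\<^bsub>A\<^esub>}"

context
  fixes A :: "('a, 'm) ring_scheme" and L :: "('a, 'd) module" and C :: "'b set" and x :: "'b \<Rightarrow> 'd"
  assumes L: "Module.module A L" and x: "x ` C \<subseteq> carrier L"
begin

interpretation L: Module.module A L by (rule L)

lemma free_eval_superset:
  assumes v: "v \<in> carrier (free_module A C)" and B: "finite B" "{p. v p \<noteq> \<zero>\<^bsub>A\<^esub>} \<subseteq> B" "B \<subseteq> C"
  shows "free_eval A L x v = finsum L (\<lambda>p. v p \<odot>\<^bsub>L\<^esub> x p) B"
  unfolding free_eval_def
proof (rule L.M.add.finprod_mono_neutral_cong_left)
  show "(\<lambda>p. v p \<odot>\<^bsub>L\<^esub> x p) \<in> B \<rightarrow> carrier L"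
    using v B x by (auto simp: free_module_carrier intro!: L.smult_closed)
  show "v p \<odot>\<^bsub>L\<^esub> x p = \<zero>\<^bsub>L\<^esub>" if "p \<in> B - {p. v p \<noteq> \<zero>\<^bsub>A\<^esub>}" for p
  proof -
    have "x p \<in> carrier L" "v p = \<zero>\<^bsub>A\<^esub>" using that B x by auto
    then show ?thesis by simp
  qed
qed (use B in auto)

lemma free_eval_hom: "free_eval A L x \<in> mod_hom A (free_module A C) L"
proof (rule mod_homI)
  interpret F: Module.module A "free_module A C" by (rule module_free_module[OF L.R.cring_axioms])
  have fn: "(\<lambda>p. v p \<odot>\<^bsub>L\<^esub> x p) \<in> B \<rightarrow> carrier L" if "v \<in> carrier (free_module A C)" "B \<subseteq> C" for v B
    using that x by (auto simp: free_module_carrier intro!: L.smult_closed)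
  fix v assume v: "v \<in> carrier (free_module A C)"
  let ?v = "{p. v p \<noteq> \<zero>\<^bsub>A\<^esub>}"
  have fv: "finite ?v" "?v \<subseteq> C" and cv: "v p \<in> carrier A" for p
    using v by (auto simp: free_module_carrier)
  show "free_eval A L x v \<in> carrier L"
    unfolding free_eval_def using fn[OF v fv(2)] by (rule L.M.finsum_closed)
  show "free_eval A L x (a \<odot>\<^bsub>free_module A C\<^esub> v) = a \<odot>\<^bsub>L\<^esub> free_eval A L x v" if a: "a \<in> carrier A" for a
  proof -
    have "free_eval A L x (a \<odot>\<^bsub>free_module A C\<^esub> v) =
        finsum L (\<lambda>p. (a \<odot>\<^bsub>free_module A C\<^esub> v) p \<odot>\<^bsub>L\<^esub> x p) ?v"
      by (rule free_eval_superset[OF F.smult_closed[OF a v] fv(1) _ fv(2)]) (use a in auto)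
    also have "\<dots> = finsum L (\<lambda>p. a \<odot>\<^bsub>L\<^esub> (v p \<odot>\<^bsub>L\<^esub> x p)) ?v"
      by (rule L.M.finsum_cong')
        (use a cv fn[OF v fv(2)] fv(2) x in \<open>auto simp: Pi_def image_subset_iff subset_iff L.smult_assoc1\<close>)
    also have "\<dots> = a \<odot>\<^bsub>L\<^esub> free_eval A L x v"
      unfolding free_eval_def by (rule L.finsum_smult_ldistr[OF fv(1) a fn[OF v fv(2)], symmetric])
    finally show ?thesis .
  qed
  fix w assume w: "w \<in> carrier (free_module A C)"
  let ?w = "{p. w p \<noteq> \<zero>\<^bsub>A\<^esub>}"
  have fw: "finite ?w" "?w \<subseteq> C" and cw: "w p \<in> carrier A" for p
    using w by (auto simp: free_module_carrier)
  have B: "finite (?v \<union> ?w)" "?v \<union> ?w \<subseteq> C" using fv fw by auto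
  have "free_eval A L x (v \<oplus>\<^bsub>free_module A C\<^esub> w) =
      finsum L (\<lambda>p. (v \<oplus>\<^bsub>free_module A C\<^esub> w) p \<odot>\<^bsub>L\<^esub> x p) (?v \<union> ?w)"
    by (rule free_eval_superset[OF F.M.a_closed[OF v w] B(1) _ B(2)]) auto
  also have "\<dots> = finsum L (\<lambda>p. v p \<odot>\<^bsub>L\<^esub> x p \<oplus>\<^bsub>L\<^esub> w p \<odot>\<^bsub>L\<^esub> x p) (?v \<union> ?w)"
    by (rule L.M.finsum_cong')
      (use cv cw fn[OF v B(2)] fn[OF w B(2)] B(2) x in \<open>auto simp: Pi_def image_subset_iff subset_iff L.smult_l_distr\<close>)
  also have "\<dots> = free_eval A L x v \<oplus>\<^bsub>L\<^esub> free_eval A L x w"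
    using L.M.finsum_addf[OF fn[OF v B(2)] fn[OF w B(2)]] B
    by (simp add: free_eval_superset[OF v B(1) _ B(2)] free_eval_superset[OF w B(1) _ B(2)])
  finally show "free_eval A L x (v \<oplus>\<^bsub>free_module A C\<^esub> w) = free_eval A L x v \<oplus>\<^bsub>L\<^esub> free_eval A L x w" .
qed

lemma mod_hom_free_eval:
  assumes N: "Module.module A N" and g: "g \<in> mod_hom A L N" and v: "v \<in> carrier (free_module A C)"
  shows "g (free_eval A L x v) = free_eval A N (\<lambda>p. g (x p)) v"
proof -
  interpret N: Module.module A N by (rule N)
  have cv: "v p \<in> carrier A" for p using v by (simp add: free_module_carrier)
  have "g (finsum L (\<lambda>p. v p \<odot>\<^bsub>L\<^esub> x p) B) = finsum N (\<lambda>p. v p \<odot>\<^bsub>N\<^esub> g (x p)) B"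
    if "finite B" "B \<subseteq> C" for B
    using that
  proof (induction B rule: finite_induct)
    case empty
    then show ?case by (simp add: mod_hom_zero[OF L N g])
  next
    case (insert p B)
    have xB: "x q \<in> carrier L" if "q \<in> insert p B" for q using that insert.prems x by auto
    have 1: "(\<lambda>p. v p \<odot>\<^bsub>L\<^esub> x p) \<in> B \<rightarrow> carrier L" "v p \<odot>\<^bsub>L\<^esub> x p \<in> carrier L"
      "(\<lambda>p. v p \<odot>\<^bsub>N\<^esub> g (x p)) \<in> B \<rightarrow> carrier N" "v p \<odot>\<^bsub>N\<^esub> g (x p) \<in> carrier N"
      using xB cv mod_homD(1)[OF g] by auto
    show ?case
      using insert 1 xB[of p] cv
      by (simp add: mod_homD(2)[OF g] mod_homD(3)[OF g])
  qed
  then show ?thesis using v by (simp add: free_eval_def free_module_carrier)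
qed

end

theorem projective_module_lift:
  fixes A :: "('a, 'm) ring_scheme" and P :: "('a, 'b) module"
    and U :: "('a, 'c) module" and V :: "('a, 'd) module"
  assumes proj: "projective_module A P"
    and U: "Module.module A U" and V: "Module.module A V"
    and g: "g \<in> mod_hom A U V" and surj: "g ` carrier U = carrier V"
    and h: "h \<in> mod_hom A P V"
  shows "\<exists>k\<in>mod_hom A P U. \<forall>p\<in>carrier P. g (k p) = h p"
proof -
  have P: "Module.module A P" using proj by (simp add: projective_module_def)
  interpret P: Module.module A P by (rule P)
  let ?F = "free_module A (carrier P)"
  have F: "Module.module A ?F" by (rule module_free_module[OF P.R.cring_axioms])
  define e where "e = free_eval A P (\<lambda>p. p)"
  have e: "e \<in> mod_hom A ?F P" unfolding e_def by (rule free_eval_hom[OF P]) simp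
  have e_surj: "\<exists>v\<in>carrier ?F. e v = p" if p: "p \<in> carrier P" for p
  proof
    let ?d = "\<lambda>q. if q = p then \<one>\<^bsub>A\<^esub> else \<zero>\<^bsub>A\<^esub>"
    have sub: "{q. ?d q \<noteq> \<zero>\<^bsub>A\<^esub>} \<subseteq> {p}" by auto
    show d: "?d \<in> carrier ?F"
      using p sub finite_subset[OF sub] unfolding free_module_carrier by auto
    have "e ?d = finsum P (\<lambda>q. ?d q \<odot>\<^bsub>P\<^esub> q) {p}"
      unfolding e_def by (rule free_eval_superset[OF P _ d _ sub]) (use p in auto)
    also have "\<dots> = p" using p by simp
    finally show "e ?d = p" .
  qed
  define i :: "('b \<Rightarrow> 'a) \<Rightarrow> ('b \<Rightarrow> 'a) set" where "i v = {v}" for v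
  define j :: "'b \<Rightarrow> ('b \<Rightarrow> 'a) set" where "j p = {v \<in> carrier ?F. e v = p}" for p
  have i: "inj_on i (carrier ?F)" by (auto simp: i_def inj_on_def)
  have j: "inj_on j (carrier P)"
  proof (rule inj_onI)
    fix p q assume "p \<in> carrier P" "q \<in> carrier P" and eq: "j p = j q"
    then obtain v where "v \<in> j p" using e_surj by (auto simp: j_def)
    then show "p = q" using eq by (auto simp: j_def)
  qed
  let ?i = "inv_into (carrier ?F) i" and ?F' = "copy_module i ?F" and ?P' = "copy_module j P"
  have F': "Module.module A ?F'" by (rule module_copy_module[OF F i])
  have P': "Module.module A ?P'" by (rule module_copy_module[OF P j])
  have hi': "?i \<in> mod_hom A ?F' ?F" by (rule mod_hom_copy_inv[OF F i])
  have hj: "j \<in> mod_hom A P ?P'" by (rule mod_hom_copy[OF j])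
  have g': "j \<circ> e \<circ> ?i \<in> mod_hom A ?F' ?P'"
    by (intro mod_hom_comp[OF hi'] mod_hom_comp[OF e] hj)
  have surj': "(j \<circ> e \<circ> ?i) ` carrier ?F' = carrier ?P'"
  proof -
    have 1: "e ` carrier ?F = carrier P" using e_surj mod_homD(1)[OF e] by blast
    have 2: "?i ` carrier ?F' = carrier ?F" using i by (simp add: copy_module_simps)
    have 3: "carrier ?P' = j ` carrier P" by (rule copy_module_simps(1)[OF j])
    show ?thesis by (simp only: image_comp[symmetric] 1 2 3)
  qed
  have "\<exists>k\<in>mod_hom A P ?F'. \<forall>p\<in>carrier P. (j \<circ> e \<circ> ?i) (k p) = j p"
    by (rule proj[unfolded projective_module_def, THEN conjunct2, rule_format, OF F' P' g' surj' hj])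
  then obtain s' where s': "s' \<in> mod_hom A P ?F'"
    and s'_eq: "\<And>p. p \<in> carrier P \<Longrightarrow> (j \<circ> e \<circ> ?i) (s' p) = j p"
    by blast
  define s where "s = ?i \<circ> s'"
  have s: "s \<in> mod_hom A P ?F" unfolding s_def by (rule mod_hom_comp[OF s' hi'])
  have es: "e (s p) = p" if "p \<in> carrier P" for p
  proof (rule inj_onD[OF j])
    show "j (e (s p)) = j p" using s'_eq[OF that] unfolding s_def o_apply .
  qed (use that mod_homD(1)[OF e mod_homD(1)[OF s that]] in blast)+
  have "\<forall>p\<in>carrier P. \<exists>y\<in>carrier U. g y = h p"
  proof
    fix p assume "p \<in> carrier P"
    then have "h p \<in> g ` carrier U" unfolding surj by (rule mod_homD(1)[OF h])
    then show "\<exists>y\<in>carrier U. g y = h p" by auto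
  qed
  then obtain y where "\<forall>p\<in>carrier P. y p \<in> carrier U \<and> g (y p) = h p"
    unfolding Bex_def by (rule bchoice[THEN exE])
  then have y: "\<And>p. p \<in> carrier P \<Longrightarrow> y p \<in> carrier U \<and> g (y p) = h p" by blast
  define k where "k = free_eval A U y \<circ> s"
  have "free_eval A U y \<in> mod_hom A ?F U" by (rule free_eval_hom[OF U]) (use y in auto)
  then have "k \<in> mod_hom A P U" unfolding k_def by (rule mod_hom_comp[OF s])
  moreover have "g (k p) = h p" if p: "p \<in> carrier P" for p
  proof -
    have sp: "s p \<in> carrier ?F" by (rule mod_homD(1)[OF s p])
    have cong: "free_eval A V (\<lambda>p. g (y p)) (s p) = free_eval A V h (s p)"
      unfolding free_eval_def
    proof (rule abelian_monoid.finsum_cong')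
      show "abelian_monoid V" using V by (simp add: module_def abelian_group_def)
      show "(\<lambda>q. s p q \<odot>\<^bsub>V\<^esub> h q) \<in> {q. s p q \<noteq> \<zero>\<^bsub>A\<^esub>} \<rightarrow> carrier V"
        using sp mod_homD(1)[OF h] Module.module.smult_closed[OF V]
        by (auto simp: free_module_carrier Pi_def subset_iff)
      show "s p q \<odot>\<^bsub>V\<^esub> g (y q) = s p q \<odot>\<^bsub>V\<^esub> h q" if "q \<in> {q. s p q \<noteq> \<zero>\<^bsub>A\<^esub>}" for q
      proof -
        have "q \<in> carrier P" using sp that by (auto simp: free_module_carrier)
        then show ?thesis using y by simp
      qed
    qed simp
    have "g (k p) = free_eval A V (\<lambda>p. g (y p)) (s p)"
      unfolding k_def o_apply by (rule mod_hom_free_eval[OF U _ V g sp]) (use y in auto)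
    also have "\<dots> = free_eval A V h (s p)" by (rule cong)
    also have "\<dots> = h (e (s p))"
      unfolding e_def by (rule mod_hom_free_eval[OF P _ V h sp, symmetric]) simp
    finally show ?thesis using es p by simp
  qed
  ultimately show ?thesis by blast
qed


subsection \<open>Localizations are rings and modules\<close>

lemma UN_pairs_const:
  assumes "(x, s) \<in> U" "(y, t) \<in> V"
    and "\<And>x s y t. (x, s) \<in> U \<Longrightarrow> (y, t) \<in> V \<Longrightarrow> F x s y t = c"
  shows "(\<Union>(x, s)\<in>U. \<Union>(y, t)\<in>V. F x s y t) = c"
proof -
  have "(\<Union>(x, s)\<in>U. \<Union>(y, t)\<in>V. F x s y t) = (\<Union>w\<in>U. \<Union>z\<in>V. c)"
    by (intro SUP_cong refl) (auto simp: assms(3))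
  also have "\<dots> = c" using assms(1,2) by auto
  finally show ?thesis .
qed

lemma regular_module_simps [simp]:
  "carrier (regular_module A) = carrier A" "\<zero>\<^bsub>regular_module A\<^esub> = \<zero>\<^bsub>A\<^esub>"
  "x \<oplus>\<^bsub>regular_module A\<^esub> y = x \<oplus>\<^bsub>A\<^esub> y" "a \<odot>\<^bsub>regular_module A\<^esub> x = a \<otimes>\<^bsub>A\<^esub> x"
  by (simp_all add: regular_module_def)

lemma localize_module_simps:
  "carrier (localize_module A T N) = (carrier N \<times> T) // frac_rel A T N"
  "\<zero>\<^bsub>localize_module A T N\<^esub> = fraction A T N \<zero>\<^bsub>N\<^esub> \<one>\<^bsub>A\<^esub>"
  "add (localize_module A T N) = frac_add A T N"
  "smult (localize_module A T N) = frac_smult A T N"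
  by (simp_all add: localize_module_def)

lemma localize_ring_simps:
  "carrier (localize_ring A T) = (carrier A \<times> T) // frac_rel A T (regular_module A)"
  "\<zero>\<^bsub>localize_ring A T\<^esub> = fraction A T (regular_module A) \<zero>\<^bsub>A\<^esub> \<one>\<^bsub>A\<^esub>"
  "\<one>\<^bsub>localize_ring A T\<^esub> = fraction A T (regular_module A) \<one>\<^bsub>A\<^esub> \<one>\<^bsub>A\<^esub>"
  "add (localize_ring A T) = frac_add A T (regular_module A)"
  "monoid.mult (localize_ring A T) = frac_smult A T (regular_module A)"
  by (simp_all add: localize_ring_def)

lemma module_regular_module:
  assumes "cring A"
  shows "Module.module A (regular_module A)"
proof -
  interpret A: cring A by fact
  show ?thesis
  proof (rule moduleI)
    show "abelian_group (regular_module A)"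
    proof (rule abelian_groupI)
      fix x assume "x \<in> carrier (regular_module A)"
      then show "\<exists>y\<in>carrier (regular_module A). y \<oplus>\<^bsub>regular_module A\<^esub> x = \<zero>\<^bsub>regular_module A\<^esub>"
        by (intro bexI[of _ "\<ominus>\<^bsub>A\<^esub> x"]) (auto simp: A.l_neg)
    qed (auto simp: A.a_ac)
  qed (auto simp: A.cring_axioms A.l_distr A.r_distr A.m_assoc)
qed

context
  fixes A :: "('a, 'm) ring_scheme" and T :: "'a set" and N :: "('a, 'b) module"
  assumes N: "Module.module A N" and T: "submonoid T A"
begin

interpretation N: Module.module A N by (rule N)
interpretation T: submonoid T A by (rule T)

lemma frac_rel_iff:
  "((x, s), (y, t)) \<in> frac_rel A T N \<longleftrightarrow>
    x \<in> carrier N \<and> y \<in> carrier N \<and> s \<in> T \<and> t \<in> T \<and>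
    (\<exists>u\<in>T. (u \<otimes>\<^bsub>A\<^esub> t) \<odot>\<^bsub>N\<^esub> x = (u \<otimes>\<^bsub>A\<^esub> s) \<odot>\<^bsub>N\<^esub> y)"
  by (auto simp: frac_rel_def N.smult_assoc1[OF T.mem_carrier T.mem_carrier])

lemma frac_rel_equiv: "equiv (carrier N \<times> T) (frac_rel A T N)"
proof (rule equivI)
  show "frac_rel A T N \<subseteq> (carrier N \<times> T) \<times> (carrier N \<times> T)"
    by (auto simp: frac_rel_def)
  show "refl_on (carrier N \<times> T) (frac_rel A T N)"
    using T.one_closed by (auto simp: refl_on_def frac_rel_def)
  show "sym (frac_rel A T N)"
    by (rule symI) (auto simp: frac_rel_def eq_commute)
  show "trans (frac_rel A T N)"
  proof (rule transI, clarify)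
    fix x s y t z r
    assume "((x, s), (y, t)) \<in> frac_rel A T N" "((y, t), (z, r)) \<in> frac_rel A T N"
    then obtain u v where c: "x \<in> carrier N" "y \<in> carrier N" "z \<in> carrier N" "s \<in> T" "t \<in> T" "r \<in> T"
      "u \<in> T" "v \<in> T"
      and u: "(u \<otimes>\<^bsub>A\<^esub> t) \<odot>\<^bsub>N\<^esub> x = (u \<otimes>\<^bsub>A\<^esub> s) \<odot>\<^bsub>N\<^esub> y"
      and v: "(v \<otimes>\<^bsub>A\<^esub> r) \<odot>\<^bsub>N\<^esub> y = (v \<otimes>\<^bsub>A\<^esub> t) \<odot>\<^bsub>N\<^esub> z"
      by (auto simp: frac_rel_iff)
    have a: "s \<in> carrier A" "t \<in> carrier A" "r \<in> carrier A" "u \<in> carrier A" "v \<in> carrier A"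
      using c by auto
    let ?w = "u \<otimes>\<^bsub>A\<^esub> v \<otimes>\<^bsub>A\<^esub> t"
    have "(?w \<otimes>\<^bsub>A\<^esub> r) \<odot>\<^bsub>N\<^esub> x = (v \<otimes>\<^bsub>A\<^esub> r) \<odot>\<^bsub>N\<^esub> ((u \<otimes>\<^bsub>A\<^esub> t) \<odot>\<^bsub>N\<^esub> x)"
      using a c by (simp add: N.smult_assoc1[symmetric] N.R.m_ac)
    also have "\<dots> = (u \<otimes>\<^bsub>A\<^esub> s) \<odot>\<^bsub>N\<^esub> ((v \<otimes>\<^bsub>A\<^esub> r) \<odot>\<^bsub>N\<^esub> y)"
      unfolding u using a c by (simp add: N.smult_assoc1[symmetric] N.R.m_ac)
    also have "\<dots> = (?w \<otimes>\<^bsub>A\<^esub> s) \<odot>\<^bsub>N\<^esub> z"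
      unfolding v using a c by (simp add: N.smult_assoc1[symmetric] N.R.m_ac)
    finally show "((x, s), (z, r)) \<in> frac_rel A T N"
      using c T.m_closed by (auto simp: frac_rel_iff)
  qed
qed

lemma frac_eq_iff:
  assumes "x \<in> carrier N" "s \<in> T" "y \<in> carrier N" "t \<in> T"
  shows "fraction A T N x s = fraction A T N y t \<longleftrightarrow>
    (\<exists>u\<in>T. (u \<otimes>\<^bsub>A\<^esub> t) \<odot>\<^bsub>N\<^esub> x = (u \<otimes>\<^bsub>A\<^esub> s) \<odot>\<^bsub>N\<^esub> y)"
  unfolding fraction_def using eq_equiv_class_iff[OF frac_rel_equiv] assms by (simp add: frac_rel_iff)

lemma frac_mem:
  "(y, t) \<in> fraction A T N x s \<longleftrightarrow> ((x, s), (y, t)) \<in> frac_rel A T N"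
  by (simp add: fraction_def)

lemma frac_self: "x \<in> carrier N \<Longrightarrow> s \<in> T \<Longrightarrow> (x, s) \<in> fraction A T N x s"
  using T.one_closed by (auto simp: frac_mem frac_rel_iff)

lemma frac_cases:
  assumes "w \<in> (carrier N \<times> T) // frac_rel A T N"
  obtains x s where "x \<in> carrier N" "s \<in> T" "w = fraction A T N x s"
  using assms unfolding fraction_def by (auto elim!: quotientE)

lemma frac_closed: "x \<in> carrier N \<Longrightarrow> s \<in> T \<Longrightarrow> fraction A T N x s \<in> (carrier N \<times> T) // frac_rel A T N"
  unfolding fraction_def by (rule quotientI) simp

lemma frac_add_frac:
  assumes c: "x \<in> carrier N" "s \<in> T" "y \<in> carrier N" "t \<in> T"
  shows "frac_add A T N (fraction A T N x s) (fraction A T N y t) =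
    fraction A T N (t \<odot>\<^bsub>N\<^esub> x \<oplus>\<^bsub>N\<^esub> s \<odot>\<^bsub>N\<^esub> y) (s \<otimes>\<^bsub>A\<^esub> t)"
proof -
  have "fraction A T N (t' \<odot>\<^bsub>N\<^esub> x' \<oplus>\<^bsub>N\<^esub> s' \<odot>\<^bsub>N\<^esub> y') (s' \<otimes>\<^bsub>A\<^esub> t') =
      fraction A T N (t \<odot>\<^bsub>N\<^esub> x \<oplus>\<^bsub>N\<^esub> s \<odot>\<^bsub>N\<^esub> y) (s \<otimes>\<^bsub>A\<^esub> t)"
    if xs: "(x', s') \<in> fraction A T N x s" and yt: "(y', t') \<in> fraction A T N y t" for x' s' y' t'
  proof -
    obtain u v where c': "x' \<in> carrier N" "s' \<in> T" "y' \<in> carrier N" "t' \<in> T" "u \<in> T" "v \<in> T"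
      and u: "(u \<otimes>\<^bsub>A\<^esub> s') \<odot>\<^bsub>N\<^esub> x = (u \<otimes>\<^bsub>A\<^esub> s) \<odot>\<^bsub>N\<^esub> x'"
      and v: "(v \<otimes>\<^bsub>A\<^esub> t') \<odot>\<^bsub>N\<^esub> y = (v \<otimes>\<^bsub>A\<^esub> t) \<odot>\<^bsub>N\<^esub> y'"
      using xs yt by (auto simp: frac_mem frac_rel_iff)
    have a: "s \<in> carrier A" "t \<in> carrier A" "s' \<in> carrier A" "t' \<in> carrier A" "u \<in> carrier A" "v \<in> carrier A"
      using c c' by auto
    have 1: "((u \<otimes>\<^bsub>A\<^esub> v) \<otimes>\<^bsub>A\<^esub> (s \<otimes>\<^bsub>A\<^esub> t)) \<odot>\<^bsub>N\<^esub> (t' \<odot>\<^bsub>N\<^esub> x') =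
        ((u \<otimes>\<^bsub>A\<^esub> v) \<otimes>\<^bsub>A\<^esub> (s' \<otimes>\<^bsub>A\<^esub> t')) \<odot>\<^bsub>N\<^esub> (t \<odot>\<^bsub>N\<^esub> x)"
    proof -
      have "((u \<otimes>\<^bsub>A\<^esub> v) \<otimes>\<^bsub>A\<^esub> (s \<otimes>\<^bsub>A\<^esub> t)) \<odot>\<^bsub>N\<^esub> (t' \<odot>\<^bsub>N\<^esub> x') =
          (v \<otimes>\<^bsub>A\<^esub> t \<otimes>\<^bsub>A\<^esub> t') \<odot>\<^bsub>N\<^esub> ((u \<otimes>\<^bsub>A\<^esub> s) \<odot>\<^bsub>N\<^esub> x')"
        using a c' by (simp add: N.smult_assoc1[symmetric] N.R.m_ac)
      also have "\<dots> = ((u \<otimes>\<^bsub>A\<^esub> v) \<otimes>\<^bsub>A\<^esub> (s' \<otimes>\<^bsub>A\<^esub> t')) \<odot>\<^bsub>N\<^esub> (t \<odot>\<^bsub>N\<^esub> x)"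
        unfolding u[symmetric] using a c by (simp add: N.smult_assoc1[symmetric] N.R.m_ac)
      finally show ?thesis .
    qed
    have 2: "((u \<otimes>\<^bsub>A\<^esub> v) \<otimes>\<^bsub>A\<^esub> (s \<otimes>\<^bsub>A\<^esub> t)) \<odot>\<^bsub>N\<^esub> (s' \<odot>\<^bsub>N\<^esub> y') =
        ((u \<otimes>\<^bsub>A\<^esub> v) \<otimes>\<^bsub>A\<^esub> (s' \<otimes>\<^bsub>A\<^esub> t')) \<odot>\<^bsub>N\<^esub> (s \<odot>\<^bsub>N\<^esub> y)"
    proof -
      have "((u \<otimes>\<^bsub>A\<^esub> v) \<otimes>\<^bsub>A\<^esub> (s \<otimes>\<^bsub>A\<^esub> t)) \<odot>\<^bsub>N\<^esub> (s' \<odot>\<^bsub>N\<^esub> y') =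
          (u \<otimes>\<^bsub>A\<^esub> s \<otimes>\<^bsub>A\<^esub> s') \<odot>\<^bsub>N\<^esub> ((v \<otimes>\<^bsub>A\<^esub> t) \<odot>\<^bsub>N\<^esub> y')"
        using a c' by (simp add: N.smult_assoc1[symmetric] N.R.m_ac)
      also have "\<dots> = ((u \<otimes>\<^bsub>A\<^esub> v) \<otimes>\<^bsub>A\<^esub> (s' \<otimes>\<^bsub>A\<^esub> t')) \<odot>\<^bsub>N\<^esub> (s \<odot>\<^bsub>N\<^esub> y)"
        unfolding v[symmetric] using a c by (simp add: N.smult_assoc1[symmetric] N.R.m_ac)
      finally show ?thesis .
    qed
    show ?thesis
    proof (rule frac_eq_iff[THEN iffD2])
      have "((u \<otimes>\<^bsub>A\<^esub> v) \<otimes>\<^bsub>A\<^esub> (s \<otimes>\<^bsub>A\<^esub> t)) \<odot>\<^bsub>N\<^esub> (t' \<odot>\<^bsub>N\<^esub> x' \<oplus>\<^bsub>N\<^esub> s' \<odot>\<^bsub>N\<^esub> y') =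
          ((u \<otimes>\<^bsub>A\<^esub> v) \<otimes>\<^bsub>A\<^esub> (s' \<otimes>\<^bsub>A\<^esub> t')) \<odot>\<^bsub>N\<^esub> (t \<odot>\<^bsub>N\<^esub> x \<oplus>\<^bsub>N\<^esub> s \<odot>\<^bsub>N\<^esub> y)"
        using a c c' by (simp only: N.smult_r_distr 1 2 N.smult_closed N.R.m_closed)
      then show "\<exists>w\<in>T. (w \<otimes>\<^bsub>A\<^esub> (s \<otimes>\<^bsub>A\<^esub> t)) \<odot>\<^bsub>N\<^esub> (t' \<odot>\<^bsub>N\<^esub> x' \<oplus>\<^bsub>N\<^esub> s' \<odot>\<^bsub>N\<^esub> y') =
          (w \<otimes>\<^bsub>A\<^esub> (s' \<otimes>\<^bsub>A\<^esub> t')) \<odot>\<^bsub>N\<^esub> (t \<odot>\<^bsub>N\<^esub> x \<oplus>\<^bsub>N\<^esub> s \<odot>\<^bsub>N\<^esub> y)"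
        using T.m_closed[OF c'(5,6)] by (rule bexI)
    qed (use a c c' in simp_all)
  qed
  then show ?thesis
    unfolding frac_add_def by (intro UN_pairs_const[OF frac_self[OF c(1,2)] frac_self[OF c(3,4)]])
qed

end

context
  fixes A :: "('a, 'm) ring_scheme" and T :: "'a set" and N :: "('a, 'b) module"
  assumes N: "Module.module A N" and T: "submonoid T A"
begin

interpretation N: Module.module A N by (rule N)
interpretation T: submonoid T A by (rule T)

lemma frac_smult_frac:
  assumes c: "b \<in> carrier A" "s \<in> T" "y \<in> carrier N" "t \<in> T"
  shows "frac_smult A T N (fraction A T (regular_module A) b s) (fraction A T N y t) =
    fraction A T N (b \<odot>\<^bsub>N\<^esub> y) (s \<otimes>\<^bsub>A\<^esub> t)"
proof -
  note reg = module_regular_module[OF N.R.cring_axioms]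
  have "fraction A T N (b' \<odot>\<^bsub>N\<^esub> y') (s' \<otimes>\<^bsub>A\<^esub> t') = fraction A T N (b \<odot>\<^bsub>N\<^esub> y) (s \<otimes>\<^bsub>A\<^esub> t)"
    if bs: "(b', s') \<in> fraction A T (regular_module A) b s" and yt: "(y', t') \<in> fraction A T N y t" for b' s' y' t'
  proof -
    obtain u v where c': "b' \<in> carrier A" "s' \<in> T" "y' \<in> carrier N" "t' \<in> T" "u \<in> T" "v \<in> T"
      and u: "(u \<otimes>\<^bsub>A\<^esub> s') \<otimes>\<^bsub>A\<^esub> b = (u \<otimes>\<^bsub>A\<^esub> s) \<otimes>\<^bsub>A\<^esub> b'"
      and v: "(v \<otimes>\<^bsub>A\<^esub> t') \<odot>\<^bsub>N\<^esub> y = (v \<otimes>\<^bsub>A\<^esub> t) \<odot>\<^bsub>N\<^esub> y'"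
      using bs yt by (auto simp: frac_mem[OF N T] frac_mem[OF reg T] frac_rel_iff[OF N T] frac_rel_iff[OF reg T])
    have a: "s \<in> carrier A" "t \<in> carrier A" "s' \<in> carrier A" "t' \<in> carrier A" "u \<in> carrier A" "v \<in> carrier A"
      using c c' by auto
    have "((u \<otimes>\<^bsub>A\<^esub> v) \<otimes>\<^bsub>A\<^esub> (s \<otimes>\<^bsub>A\<^esub> t)) \<odot>\<^bsub>N\<^esub> (b' \<odot>\<^bsub>N\<^esub> y') =
        ((u \<otimes>\<^bsub>A\<^esub> s) \<otimes>\<^bsub>A\<^esub> b') \<odot>\<^bsub>N\<^esub> ((v \<otimes>\<^bsub>A\<^esub> t) \<odot>\<^bsub>N\<^esub> y')"
      using a c' by (simp add: N.smult_assoc1[symmetric] N.R.m_ac)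
    also have "\<dots> = ((u \<otimes>\<^bsub>A\<^esub> v) \<otimes>\<^bsub>A\<^esub> (s' \<otimes>\<^bsub>A\<^esub> t')) \<odot>\<^bsub>N\<^esub> (b \<odot>\<^bsub>N\<^esub> y)"
      unfolding u[symmetric] v[symmetric] using a c by (simp add: N.smult_assoc1[symmetric] N.R.m_ac)
    finally have "\<exists>w\<in>T. (w \<otimes>\<^bsub>A\<^esub> (s \<otimes>\<^bsub>A\<^esub> t)) \<odot>\<^bsub>N\<^esub> (b' \<odot>\<^bsub>N\<^esub> y') =
        (w \<otimes>\<^bsub>A\<^esub> (s' \<otimes>\<^bsub>A\<^esub> t')) \<odot>\<^bsub>N\<^esub> (b \<odot>\<^bsub>N\<^esub> y)"
      using T.m_closed[OF c'(5,6)] by (rule bexI)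
    then show ?thesis
      by (rule frac_eq_iff[OF N T, THEN iffD2, rotated -1]) (use a c c' in simp_all)
  qed
  then show ?thesis
    unfolding frac_smult_def
    by (intro UN_pairs_const[OF frac_self[OF reg T] frac_self[OF N T c(3,4)]]) (use c in simp_all)
qed

lemma frac_eqI:
  assumes "x \<in> carrier N" "s \<in> T" "y \<in> carrier N" "t \<in> T" "t \<odot>\<^bsub>N\<^esub> x = s \<odot>\<^bsub>N\<^esub> y"
  shows "fraction A T N x s = fraction A T N y t"
  using assms by (subst frac_eq_iff[OF N T]) (auto intro!: bexI[of _ "\<one>\<^bsub>A\<^esub>"])

lemma abelian_group_localize_module: "abelian_group (localize_module A T N)"
proof (rule abelian_groupI; unfold localize_module_simps)
  note add = frac_add_frac[OF N T]
  show "fraction A T N \<zero>\<^bsub>N\<^esub> \<one>\<^bsub>A\<^esub> \<in> (carrier N \<times> T) // frac_rel A T N"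
    by (rule frac_closed[OF N T]) auto
  fix x assume "x \<in> (carrier N \<times> T) // frac_rel A T N"
  then obtain x' r where x: "x' \<in> carrier N" "r \<in> T" "x = fraction A T N x' r"
    by (rule frac_cases[OF N T])
  have r: "r \<in> carrier A" using x by auto
  show "frac_add A T N (fraction A T N \<zero>\<^bsub>N\<^esub> \<one>\<^bsub>A\<^esub>) x = x"
    using x r by (simp add: add)
  show "\<exists>y\<in>(carrier N \<times> T) // frac_rel A T N. frac_add A T N y x = fraction A T N \<zero>\<^bsub>N\<^esub> \<one>\<^bsub>A\<^esub>"
  proof
    show "fraction A T N (\<ominus>\<^bsub>N\<^esub> x') r \<in> (carrier N \<times> T) // frac_rel A T N"
      using x by (intro frac_closed[OF N T]) auto
    have "frac_add A T N (fraction A T N (\<ominus>\<^bsub>N\<^esub> x') r) x = fraction A T N \<zero>\<^bsub>N\<^esub> (r \<otimes>\<^bsub>A\<^esub> r)"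
      using x r by (simp add: add N.smult_r_distr[symmetric] N.M.l_neg)
    also have "\<dots> = fraction A T N \<zero>\<^bsub>N\<^esub> \<one>\<^bsub>A\<^esub>"
      using x r by (intro frac_eqI) auto
    finally show "frac_add A T N (fraction A T N (\<ominus>\<^bsub>N\<^esub> x') r) x = fraction A T N \<zero>\<^bsub>N\<^esub> \<one>\<^bsub>A\<^esub>" .
  qed
  fix y assume "y \<in> (carrier N \<times> T) // frac_rel A T N"
  then obtain y' s where y: "y' \<in> carrier N" "s \<in> T" "y = fraction A T N y' s"
    by (rule frac_cases[OF N T])
  have s: "s \<in> carrier A" using y by auto
  show "frac_add A T N x y \<in> (carrier N \<times> T) // frac_rel A T N"
    unfolding x(3) y(3) add[OF x(1,2) y(1,2)] using x y r s by (intro frac_closed[OF N T]) auto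
  show "frac_add A T N x y = frac_add A T N y x"
    using x y r s by (simp add: add N.M.a_comm N.R.m_comm)
  fix z assume "z \<in> (carrier N \<times> T) // frac_rel A T N"
  then obtain z' t where z: "z' \<in> carrier N" "t \<in> T" "z = fraction A T N z' t"
    by (rule frac_cases[OF N T])
  have t: "t \<in> carrier A" using z by auto
  show "frac_add A T N (frac_add A T N x y) z = frac_add A T N x (frac_add A T N y z)"
    using x y z r s t
    by (simp add: add N.smult_r_distr N.smult_assoc1[symmetric] N.M.a_assoc N.R.m_ac)
qed

end

lemma cring_localize_ring:
  assumes A: "cring A" and T: "submonoid T A"
  shows "cring (localize_ring A T)"
proof -
  interpret A: cring A by fact
  interpret T: submonoid T A by fact
  note reg = module_regular_module[OF A]
  note add = frac_add_frac[OF reg T, simplified]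
  note mult = frac_smult_frac[OF reg T, simplified]
  note simps = localize_ring_simps
  note cases = frac_cases[OF reg T, simplified]
  note closed = frac_closed[OF reg T, simplified]
  note eqI = frac_eqI[OF reg T, simplified]
  interpret M: abelian_group "localize_module A T (regular_module A)"
    by (rule abelian_group_localize_module[OF reg T])
  have eq: "carrier (localize_ring A T) = carrier (localize_module A T (regular_module A))"
    "\<zero>\<^bsub>localize_ring A T\<^esub> = \<zero>\<^bsub>localize_module A T (regular_module A)\<^esub>"
    "add (localize_ring A T) = add (localize_module A T (regular_module A))"
    by (simp_all add: localize_ring_simps localize_module_simps)
  have neg: "\<exists>y\<in>carrier (localize_module A T (regular_module A)).
      y \<oplus>\<^bsub>localize_module A T (regular_module A)\<^esub> x = \<zero>\<^bsub>localize_module A T (regular_module A)\<^esub>"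
    if "x \<in> carrier (localize_module A T (regular_module A))" for x
    using M.l_neg[OF that] M.a_inv_closed[OF that] by (rule bexI)
  have ag: "abelian_group (localize_ring A T)"
    by (rule abelian_groupI; unfold eq) (simp_all add: M.a_ac neg)
  have cm: "comm_monoid (localize_ring A T)"
  proof (rule comm_monoidI; unfold simps)
    show "fraction A T (regular_module A) \<one>\<^bsub>A\<^esub> \<one>\<^bsub>A\<^esub> \<in> (carrier A \<times> T) // frac_rel A T (regular_module A)"
      by (rule closed) auto
    fix x assume "x \<in> (carrier A \<times> T) // frac_rel A T (regular_module A)"
    then obtain x' r where x: "x' \<in> carrier A" "r \<in> T" "x = fraction A T (regular_module A) x' r"
      by (rule cases)
    have r: "r \<in> carrier A" using x by auto
    show "frac_smult A T (regular_module A) (fraction A T (regular_module A) \<one>\<^bsub>A\<^esub> \<one>\<^bsub>A\<^esub>) x = x"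
      using x r by (simp add: mult)
    fix y assume "y \<in> (carrier A \<times> T) // frac_rel A T (regular_module A)"
    then obtain y' s where y: "y' \<in> carrier A" "s \<in> T" "y = fraction A T (regular_module A) y' s"
      by (rule cases)
    have s: "s \<in> carrier A" using y by auto
    show "frac_smult A T (regular_module A) x y \<in> (carrier A \<times> T) // frac_rel A T (regular_module A)"
      unfolding x(3) y(3) mult[OF x(1,2) y(1,2)] using x y by (intro closed) auto
    show "frac_smult A T (regular_module A) x y = frac_smult A T (regular_module A) y x"
      using x y r s by (simp add: mult A.m_comm)
    fix z assume "z \<in> (carrier A \<times> T) // frac_rel A T (regular_module A)"
    then obtain z' t where z: "z' \<in> carrier A" "t \<in> T" "z = fraction A T (regular_module A) z' t"
      by (rule cases)
    have t: "t \<in> carrier A" using z by auto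
    show "frac_smult A T (regular_module A) (frac_smult A T (regular_module A) x y) z =
        frac_smult A T (regular_module A) x (frac_smult A T (regular_module A) y z)"
      using x y z r s t by (simp add: mult A.m_assoc)
  qed
  show ?thesis
  proof (rule cringI[OF ag cm]; unfold simps)
    fix x y z
    assume "x \<in> (carrier A \<times> T) // frac_rel A T (regular_module A)"
      "y \<in> (carrier A \<times> T) // frac_rel A T (regular_module A)"
      "z \<in> (carrier A \<times> T) // frac_rel A T (regular_module A)"
    then obtain x' r y' s z' t where
      x: "x' \<in> carrier A" "r \<in> T" "x = fraction A T (regular_module A) x' r" and
      y: "y' \<in> carrier A" "s \<in> T" "y = fraction A T (regular_module A) y' s" and
      z: "z' \<in> carrier A" "t \<in> T" "z = fraction A T (regular_module A) z' t"
      by (metis cases)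
    have r: "r \<in> carrier A" "s \<in> carrier A" "t \<in> carrier A" using x y z by auto
    show "frac_smult A T (regular_module A) (frac_add A T (regular_module A) x y) z =
        frac_add A T (regular_module A) (frac_smult A T (regular_module A) x z)
          (frac_smult A T (regular_module A) y z)"
      unfolding x(3) y(3) z(3) using x(1,2) y(1,2) z(1,2) r
      by (simp add: mult add) (rule eqI; simp add: A.l_distr A.r_distr A.m_ac)
  qed
qed

lemma module_localize_module:
  assumes N: "Module.module A N" and T: "submonoid T A"
  shows "Module.module (localize_ring A T) (localize_module A T N)"
proof -
  interpret N: Module.module A N by (rule N)
  interpret T: submonoid T A by (rule T)
  note reg = module_regular_module[OF N.R.cring_axioms]
  note add = frac_add_frac[OF N T]
  note add_reg = frac_add_frac[OF reg T, simplified]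
  note mult_reg = frac_smult_frac[OF reg T, simplified]
  note mult = frac_smult_frac[OF N T]
  show ?thesis
  proof (rule moduleI)
    show "cring (localize_ring A T)" by (rule cring_localize_ring[OF N.R.cring_axioms T])
    show "abelian_group (localize_module A T N)" by (rule abelian_group_localize_module[OF N T])
  next
    fix x assume "x \<in> carrier (localize_module A T N)"
    then obtain x' t where x: "x' \<in> carrier N" "t \<in> T" "x = fraction A T N x' t"
      unfolding localize_module_simps by (rule frac_cases[OF N T])
    have t: "t \<in> carrier A" using x by auto
    show "\<one>\<^bsub>localize_ring A T\<^esub> \<odot>\<^bsub>localize_module A T N\<^esub> x = x"
      unfolding localize_module_simps localize_ring_simps x(3) using x t by (simp add: mult)
    fix a assume "a \<in> carrier (localize_ring A T)"
    then obtain a' r where a: "a' \<in> carrier A" "r \<in> T" "a = fraction A T (regular_module A) a' r"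
      unfolding localize_ring_simps by (rule frac_cases[OF reg T, simplified])
    have r: "r \<in> carrier A" using a by auto
    show "a \<odot>\<^bsub>localize_module A T N\<^esub> x \<in> carrier (localize_module A T N)"
      unfolding localize_module_simps a(3) x(3) mult[OF a(1,2) x(1,2)]
      using a x by (intro frac_closed[OF N T]) auto
    {
      fix b assume "b \<in> carrier (localize_ring A T)"
      then obtain b' s where b: "b' \<in> carrier A" "s \<in> T" "b = fraction A T (regular_module A) b' s"
        unfolding localize_ring_simps by (rule frac_cases[OF reg T, simplified])
      have s: "s \<in> carrier A" using b by auto
      show "(a \<oplus>\<^bsub>localize_ring A T\<^esub> b) \<odot>\<^bsub>localize_module A T N\<^esub> x =
          a \<odot>\<^bsub>localize_module A T N\<^esub> x \<oplus>\<^bsub>localize_module A T N\<^esub> b \<odot>\<^bsub>localize_module A T N\<^esub> x"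
        unfolding localize_module_simps localize_ring_simps a(3) b(3) x(3)
        using a(1,2) b(1,2) x(1,2) r s t
        by (simp add: mult add add_reg)
          (rule frac_eqI[OF N T];
            simp add: N.smult_l_distr N.smult_r_distr N.smult_assoc1[symmetric] N.R.m_ac N.R.r_distr)
      show "(a \<otimes>\<^bsub>localize_ring A T\<^esub> b) \<odot>\<^bsub>localize_module A T N\<^esub> x =
          a \<odot>\<^bsub>localize_module A T N\<^esub> (b \<odot>\<^bsub>localize_module A T N\<^esub> x)"
        unfolding localize_module_simps localize_ring_simps a(3) b(3) x(3)
        using a(1,2) b(1,2) x(1,2) r s t
        by (simp add: mult mult_reg N.smult_assoc1 N.R.m_assoc)
    next
      fix y assume "y \<in> carrier (localize_module A T N)"
      then obtain y' s where y: "y' \<in> carrier N" "s \<in> T" "y = fraction A T N y' s"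
        unfolding localize_module_simps by (rule frac_cases[OF N T])
      have s: "s \<in> carrier A" using y by auto
      show "a \<odot>\<^bsub>localize_module A T N\<^esub> (x \<oplus>\<^bsub>localize_module A T N\<^esub> y) =
          a \<odot>\<^bsub>localize_module A T N\<^esub> x \<oplus>\<^bsub>localize_module A T N\<^esub> a \<odot>\<^bsub>localize_module A T N\<^esub> y"
        unfolding localize_module_simps a(3) x(3) y(3)
        using a(1,2) x(1,2) y(1,2) r s t
        by (simp add: mult add)
          (rule frac_eqI[OF N T]; simp add: N.smult_r_distr N.smult_assoc1[symmetric] N.R.m_ac)
    }
  qed
qed
lemma localize_map_hom:
  assumes A: "cring A" and T: "submonoid T A"
  shows "localize_map A T \<in> ring_hom A (localize_ring A T)"
proof -
  interpret A: cring A by fact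
  interpret T: submonoid T A by fact
  note reg = module_regular_module[OF A]
  show ?thesis
  proof (rule ring_hom_memI)
    fix x y assume x: "x \<in> carrier A" and y: "y \<in> carrier A"
    show "localize_map A T x \<in> carrier (localize_ring A T)"
      unfolding localize_map_def localize_ring_simps
      using frac_closed[OF reg T] x by simp
    show "localize_map A T (x \<otimes>\<^bsub>A\<^esub> y) = localize_map A T x \<otimes>\<^bsub>localize_ring A T\<^esub> localize_map A T y"
      unfolding localize_map_def localize_ring_simps
      using frac_smult_frac[OF reg T] x y by simp
    show "localize_map A T (x \<oplus>\<^bsub>A\<^esub> y) = localize_map A T x \<oplus>\<^bsub>localize_ring A T\<^esub> localize_map A T y"
      unfolding localize_map_def localize_ring_simps
      using frac_add_frac[OF reg T] x y by simp
  qed (simp add: localize_map_def localize_ring_simps)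
qed

lemma module_restrict_scalars:
  assumes A: "cring A" and N: "Module.module B N" and h: "h \<in> ring_hom A B"
  shows "Module.module A (restrict_scalars h N)"
proof -
  interpret A: cring A by fact
  interpret N: Module.module B N by (rule N)
  show ?thesis
  proof (rule moduleI)
    show "abelian_group (restrict_scalars h N)"
    proof (rule abelian_groupI)
      fix x assume x: "x \<in> carrier (restrict_scalars h N)"
      show "\<exists>y\<in>carrier (restrict_scalars h N). y \<oplus>\<^bsub>restrict_scalars h N\<^esub> x = \<zero>\<^bsub>restrict_scalars h N\<^esub>"
        by (rule bexI[of _ "\<ominus>\<^bsub>N\<^esub> x"]) (use x in \<open>simp_all add: restrict_scalars_def N.M.l_neg\<close>)
    qed (simp_all add: restrict_scalars_def N.M.a_ac)
  qed (simp_all add: restrict_scalars_def A ring_hom_closed[OF h] ring_hom_add[OF h]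
      ring_hom_mult[OF h] ring_hom_one[OF h] N.smult_l_distr N.smult_r_distr N.smult_assoc1)
qed

lemma module_localize_restrict:
  assumes N: "Module.module A N" and T: "submonoid T A"
  shows "Module.module A (restrict_scalars (localize_map A T) (localize_module A T N))"
  using N module_restrict_scalars[OF _ module_localize_module[OF N T] localize_map_hom[OF _ T]]
  by (simp add: module_def)


subsection \<open>The factors of a module over a product are modules\<close>

lemma RDirProd_list_Cons_ops:
  assumes "a \<in> carrier R" "as \<in> carrier (RDirProd_list Rs)" "b \<in> carrier R" "bs \<in> carrier (RDirProd_list Rs)"
  shows "(a # as) \<otimes>\<^bsub>RDirProd_list (R # Rs)\<^esub> (b # bs) =
      (a \<otimes>\<^bsub>R\<^esub> b) # (as \<otimes>\<^bsub>RDirProd_list Rs\<^esub> bs)"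
    and "(a # as) \<oplus>\<^bsub>RDirProd_list (R # Rs)\<^esub> (b # bs) =
      (a \<oplus>\<^bsub>R\<^esub> b) # (as \<oplus>\<^bsub>RDirProd_list Rs\<^esub> bs)"
proof -
  have c: "(a, as) \<in> carrier (RDirProd R (RDirProd_list Rs))" "(b, bs) \<in> carrier (RDirProd R (RDirProd_list Rs))"
    using assms by (simp_all add: RDirProd_carrier)
  show "(a # as) \<otimes>\<^bsub>RDirProd_list (R # Rs)\<^esub> (b # bs) =
      (a \<otimes>\<^bsub>R\<^esub> b) # (as \<otimes>\<^bsub>RDirProd_list Rs\<^esub> bs)"
    using ring_hom_mult[OF RDirProd_list_hom1[of R Rs] c]
    by (simp add: RDirProd_def DirProd_def monoid.defs)
  show "(a # as) \<oplus>\<^bsub>RDirProd_list (R # Rs)\<^esub> (b # bs) =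
      (a \<oplus>\<^bsub>R\<^esub> b) # (as \<oplus>\<^bsub>RDirProd_list Rs\<^esub> bs)"
    using ring_hom_add[OF RDirProd_list_hom1[of R Rs] c]
    by (simp add: RDirProd_def DirProd_def monoid.defs)
qed

lemma RDirProd_list_ops:
  fixes Rs :: "('a, 'c) ring_scheme list"
  assumes "as \<in> carrier (RDirProd_list Rs)" "bs \<in> carrier (RDirProd_list Rs)"
  shows "as \<otimes>\<^bsub>RDirProd_list Rs\<^esub> bs = map (\<lambda>i. as ! i \<otimes>\<^bsub>Rs ! i\<^esub> bs ! i) [0..<length Rs]"
    and "as \<oplus>\<^bsub>RDirProd_list Rs\<^esub> bs = map (\<lambda>i. as ! i \<oplus>\<^bsub>Rs ! i\<^esub> bs ! i) [0..<length Rs]"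
    and "\<one>\<^bsub>RDirProd_list Rs\<^esub> = map one Rs" and "\<zero>\<^bsub>RDirProd_list Rs\<^esub> = map ring.zero Rs"
proof -
  have "as \<otimes>\<^bsub>RDirProd_list Rs\<^esub> bs = map (\<lambda>i. as ! i \<otimes>\<^bsub>Rs ! i\<^esub> bs ! i) [0..<length Rs] \<and>
      as \<oplus>\<^bsub>RDirProd_list Rs\<^esub> bs = map (\<lambda>i. as ! i \<oplus>\<^bsub>Rs ! i\<^esub> bs ! i) [0..<length Rs]"
    using assms
  proof (induction Rs arbitrary: as bs)
    case Nil
    then show ?case by (simp add: monoid.defs)
  next
    case (Cons R Rs)
    obtain a as' b bs' where ab: "as = a # as'" "bs = b # bs'" "a \<in> carrier R" "b \<in> carrier R"
      "as' \<in> carrier (RDirProd_list Rs)" "bs' \<in> carrier (RDirProd_list Rs)"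
      using Cons.prems unfolding RDirProd_list_carrier by auto
    show ?case
      unfolding ab(1,2) using Cons.IH[OF ab(5,6)] RDirProd_list_Cons_ops[OF ab(3,5,4,6)]
      by (simp add: map_upt_Suc del: upt_Suc)
  qed
  then show "as \<otimes>\<^bsub>RDirProd_list Rs\<^esub> bs = map (\<lambda>i. as ! i \<otimes>\<^bsub>Rs ! i\<^esub> bs ! i) [0..<length Rs]"
    and "as \<oplus>\<^bsub>RDirProd_list Rs\<^esub> bs = map (\<lambda>i. as ! i \<oplus>\<^bsub>Rs ! i\<^esub> bs ! i) [0..<length Rs]" by auto
  have "foldr (\<lambda>R tl. F R # tl) Rs [] = map F Rs" for F :: "('a, 'c) ring_scheme \<Rightarrow> 'a"
    by (induction Rs) simp_all
  then show "\<one>\<^bsub>RDirProd_list Rs\<^esub> = map one Rs" and "\<zero>\<^bsub>RDirProd_list Rs\<^esub> = map ring.zero Rs"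
    by (simp_all only: RDirProd_list_one RDirProd_list_zero)
qed

context
  fixes Rs :: "('a, 'm) ring_scheme list" and i :: nat
  assumes Rs: "\<And>i. i < length Rs \<Longrightarrow> cring (Rs ! i)" and i: "i < length Rs"
begin

lemma factor_incl_carrier:
  assumes "r \<in> carrier (Rs ! i)"
  shows "factor_incl Rs i r \<in> carrier (RDirProd_list Rs)"
proof (rule RDirProd_list_carrier_memI)
  fix k assume k: "k < length Rs"
  then interpret cring "Rs ! k" by (rule Rs)
  show "factor_incl Rs i r ! k \<in> carrier (Rs ! k)"
    using assms k i by (auto simp: factor_incl_def nth_list_update)
qed (simp add: factor_incl_def)

lemma factor_incl_ops:
  assumes r: "r \<in> carrier (Rs ! i)" and s: "s \<in> carrier (Rs ! i)"
  shows "factor_incl Rs i r \<otimes>\<^bsub>RDirProd_list Rs\<^esub> factor_incl Rs i s = factor_incl Rs i (r \<otimes>\<^bsub>Rs ! i\<^esub> s)"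
    and "factor_incl Rs i r \<oplus>\<^bsub>RDirProd_list Rs\<^esub> factor_incl Rs i s = factor_incl Rs i (r \<oplus>\<^bsub>Rs ! i\<^esub> s)"
proof -
  have z: "\<zero>\<^bsub>Rs ! k\<^esub> \<otimes>\<^bsub>Rs ! k\<^esub> \<zero>\<^bsub>Rs ! k\<^esub> = \<zero>\<^bsub>Rs ! k\<^esub>" "\<zero>\<^bsub>Rs ! k\<^esub> \<oplus>\<^bsub>Rs ! k\<^esub> \<zero>\<^bsub>Rs ! k\<^esub> = \<zero>\<^bsub>Rs ! k\<^esub>"
    if "k < length Rs" for k
  proof -
    interpret cring "Rs ! k" by (rule Rs[OF that])
    show "\<zero>\<^bsub>Rs ! k\<^esub> \<otimes>\<^bsub>Rs ! k\<^esub> \<zero>\<^bsub>Rs ! k\<^esub> = \<zero>\<^bsub>Rs ! k\<^esub>" "\<zero>\<^bsub>Rs ! k\<^esub> \<oplus>\<^bsub>Rs ! k\<^esub> \<zero>\<^bsub>Rs ! k\<^esub> = \<zero>\<^bsub>Rs ! k\<^esub>"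
      by simp_all
  qed
  note c = factor_incl_carrier[OF r] factor_incl_carrier[OF s]
  show "factor_incl Rs i r \<otimes>\<^bsub>RDirProd_list Rs\<^esub> factor_incl Rs i s = factor_incl Rs i (r \<otimes>\<^bsub>Rs ! i\<^esub> s)"
    unfolding RDirProd_list_ops(1)[OF c]
    by (rule nth_equalityI) (use i in \<open>auto simp: factor_incl_def nth_list_update z\<close>)
  show "factor_incl Rs i r \<oplus>\<^bsub>RDirProd_list Rs\<^esub> factor_incl Rs i s = factor_incl Rs i (r \<oplus>\<^bsub>Rs ! i\<^esub> s)"
    unfolding RDirProd_list_ops(2)[OF c]
    by (rule nth_equalityI) (use i in \<open>auto simp: factor_incl_def nth_list_update z\<close>)
qed

lemma module_factor_module:
  fixes M :: "('a list, 'b) module"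
  assumes M: "Module.module (RDirProd_list Rs) M"
  shows "Module.module (Rs ! i) (factor_module Rs i M)"
proof -
  interpret M: Module.module "RDirProd_list Rs" M by (rule M)
  interpret Ri: cring "Rs ! i" by (rule Rs[OF i])
  let ?e = "factor_idem Rs i" and ?E = "factor_module Rs i M"
  have e: "?e \<in> carrier (RDirProd_list Rs)"
    unfolding factor_idem_def by (rule factor_incl_carrier) simp
  have car: "x \<in> carrier ?E \<longleftrightarrow> x \<in> carrier M \<and> ?e \<odot>\<^bsub>M\<^esub> x = x" for x
  proof
    assume "x \<in> carrier ?E"
    then obtain y where y: "y \<in> carrier M" "x = ?e \<odot>\<^bsub>M\<^esub> y" by (auto simp: factor_module_def)
    have "?e \<otimes>\<^bsub>RDirProd_list Rs\<^esub> ?e = ?e"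
      unfolding factor_idem_def by (subst factor_incl_ops) auto
    then show "x \<in> carrier M \<and> ?e \<odot>\<^bsub>M\<^esub> x = x"
      using y e by (simp add: M.smult_assoc1[symmetric])
  next
    assume "x \<in> carrier M \<and> ?e \<odot>\<^bsub>M\<^esub> x = x"
    then have "x \<in> carrier M" "x = ?e \<odot>\<^bsub>M\<^esub> x" by simp_all
    then show "x \<in> carrier ?E" unfolding factor_module_def by simp
  qed
  have ops: "\<zero>\<^bsub>?E\<^esub> = \<zero>\<^bsub>M\<^esub>" "add ?E = add M" "r \<odot>\<^bsub>?E\<^esub> x = factor_incl Rs i r \<odot>\<^bsub>M\<^esub> x" for r x
    by (simp_all add: factor_module_def)
  have absorb: "?e \<odot>\<^bsub>M\<^esub> (factor_incl Rs i r \<odot>\<^bsub>M\<^esub> x) = factor_incl Rs i r \<odot>\<^bsub>M\<^esub> x"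
    if "r \<in> carrier (Rs ! i)" "x \<in> carrier M" for r x
  proof -
    have "?e \<otimes>\<^bsub>RDirProd_list Rs\<^esub> factor_incl Rs i r = factor_incl Rs i r"
      unfolding factor_idem_def using that by (subst factor_incl_ops) auto
    then show ?thesis
      using that e factor_incl_carrier by (simp add: M.smult_assoc1[symmetric])
  qed
  show ?thesis
  proof (rule moduleI)
    show "abelian_group ?E"
    proof (rule abelian_groupI)
      fix x assume "x \<in> carrier ?E"
      then have x: "x \<in> carrier M" "?e \<odot>\<^bsub>M\<^esub> x = x" by (simp_all add: car)
      show "\<exists>y\<in>carrier ?E. y \<oplus>\<^bsub>?E\<^esub> x = \<zero>\<^bsub>?E\<^esub>"
        by (rule bexI[of _ "\<ominus>\<^bsub>M\<^esub> x"]) (use x e in \<open>simp_all add: car ops M.M.l_neg M.smult_r_minus\<close>)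
    qed (simp_all add: car ops e M.smult_r_distr M.M.a_ac)
  next
    fix x assume "x \<in> carrier ?E"
    then show "\<one>\<^bsub>Rs ! i\<^esub> \<odot>\<^bsub>?E\<^esub> x = x" by (simp add: car ops factor_idem_def)
  qed (simp_all add: Ri.cring_axioms car ops e absorb factor_incl_carrier factor_incl_ops[symmetric]
      M.smult_l_distr M.smult_r_distr M.smult_assoc1)
qed

end

end

theory Submission
  imports Defs
begin

text \<open>
  For an idempotent \<open>e\<close> of a commutative ring \<open>A\<close>, the ring \<open>eA\<close> is a quotient of \<open>A\<close>, and an
  \<open>A\<close>-module \<open>N\<close> has the piece \<open>eN\<close>, an \<open>eA\<close>-module that is both a quotient and a summand of \<open>N\<close>.
  Cutting out such a piece commutes with localization: with \<open>e = e\<^sub>i / 1\<close> and \<open>A = R\<^sub>S\<close>, the ring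
  \<open>eA\<close> is the localization of \<open>R\<^sub>i\<close> at \<open>e\<^sub>iS\<close>, and \<open>e M\<^sub>S\<close> is the localization of \<open>e\<^sub>iM\<close>.  So both
  claims compare one module \<open>N\<close> with its pieces \<open>e\<^sub>iN\<close>: for flatness over the localized ring, and for
  projectivity over \<open>R\<close> itself, whose quotient \<open>e\<^sub>iR\<close> is \<open>R\<^sub>i\<close>.
  
  The property passes from \<open>N\<close> to \<open>eN\<close> because a test problem over \<open>eA\<close> is also one over \<open>A\<close>, by
  restriction of scalars, and its solution restricts to the summand \<open>eN\<close>.  For the converse, fix a test
  problem for \<open>N\<close>: a tensor that an injection sends to zero and that should be zero, or a map that
  should be lifted along a surjection.  The elements \<open>a\<close> of \<open>A\<close> for which \<open>a\<close> times the problem has a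
  solution form an ideal.  It contains the annihilator of \<open>N\<close>, and it contains each \<open>e\<^sub>i\<close> for which
  \<open>e\<^sub>iN\<close> has the property, because multiplication by \<open>e\<^sub>i\<close> turns the problem into one over \<open>e\<^sub>iA\<close>.  If
  these elements generate the unit ideal, the problem itself is solvable.  This is
  \<open>flat_module_iff_corners\<close> and \<open>projective_module_iff_corners\<close>.
  
  In a finite product the \<open>e\<^sub>i\<close> generate the unit ideal.  The indices with \<open>0 \<in> e\<^sub>iS\<close> may be left out:
  for them some \<open>s \<in> S\<close> satisfies \<open>s e\<^sub>i = 0\<close>, so \<open>e\<^sub>i\<close> annihilates every module of fractions with
  denominators in \<open>S\<close>.
\<close>

section \<open>Rings and modules cut out by an idempotent\<close>

text \<open>
  The map \<open>p\<close> exhibits \<open>B\<close> as a copy of \<open>eA\<close>.  Working with a copy rather than with \<open>eA\<close> itself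
  covers a factor \<open>R\<^sub>i\<close> of a product, whose elements have another type, and its localizations.
\<close>

locale ring_corner = A: cring A + B: cring B
  for A :: "('a, 'm) ring_scheme" and B :: "('b, 'n) ring_scheme" +
  fixes e :: 'a and p :: "'a \<Rightarrow> 'b"
  assumes idem_closed: "e \<in> carrier A"
    and idem: "e \<otimes>\<^bsub>A\<^esub> e = e"
    and proj_hom: "p \<in> ring_hom A B"
    and proj_surj: "p ` carrier A = carrier B"
    and proj_eq_iff: "\<lbrakk>a \<in> carrier A; b \<in> carrier A\<rbrakk> \<Longrightarrow> p a = p b \<longleftrightarrow> e \<otimes>\<^bsub>A\<^esub> a = e \<otimes>\<^bsub>A\<^esub> b"

text \<open>
  In the same way, \<open>\<pi>\<close> exhibits \<open>N'\<close> as a copy of \<open>eN\<close>.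
\<close>

locale module_corner = ring_corner A B e p + N: Module.module A N + N': Module.module B N'
  for A :: "('a, 'm) ring_scheme" and B :: "('b, 'n) ring_scheme" and e p
    and N :: "('a, 'c) module" and N' :: "('b, 'd) module" +
  fixes \<pi> :: "'c \<Rightarrow> 'd"
  assumes pi_surj: "\<pi> ` carrier N = carrier N'"
    and pi_add: "\<lbrakk>x \<in> carrier N; y \<in> carrier N\<rbrakk> \<Longrightarrow> \<pi> (x \<oplus>\<^bsub>N\<^esub> y) = \<pi> x \<oplus>\<^bsub>N'\<^esub> \<pi> y"
    and pi_smult: "\<lbrakk>a \<in> carrier A; x \<in> carrier N\<rbrakk> \<Longrightarrow> \<pi> (a \<odot>\<^bsub>N\<^esub> x) = p a \<odot>\<^bsub>N'\<^esub> \<pi> x"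
    and pi_eq_iff: "\<lbrakk>x \<in> carrier N; y \<in> carrier N\<rbrakk> \<Longrightarrow> \<pi> x = \<pi> y \<longleftrightarrow> e \<odot>\<^bsub>N\<^esub> x = e \<odot>\<^bsub>N\<^esub> y"

context ring_corner
begin

lemma proj_closed: "a \<in> carrier A \<Longrightarrow> p a \<in> carrier B"
  using proj_hom by (rule ring_hom_closed)

lemma proj_preimage:
  assumes "b \<in> carrier B"
  obtains a where "a \<in> carrier A" "b = p a"
  using assms proj_surj by blast

lemma idem_proj_preimage:
  assumes "a \<in> carrier A" "q (p a) \<in> carrier A" "p (q (p a)) = p a"
  shows "e \<otimes>\<^bsub>A\<^esub> q (p a) = e \<otimes>\<^bsub>A\<^esub> a"
  using assms proj_eq_iff by simp

text \<open>
  Every module axiom is an equation between elements of \<open>L\<close> and \<open>B\<close>, so it holds because it holds for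
  preimages under \<open>f\<close> and \<open>p\<close>.
\<close>

lemma module_semilinear_image:
  fixes K :: "('a, 'c) module" and L :: "('b, 'd) module"
  assumes K: "Module.module A K"
    and surj: "f ` carrier K = carrier L"
    and zero: "f \<zero>\<^bsub>K\<^esub> = \<zero>\<^bsub>L\<^esub>"
    and add: "\<And>x y. \<lbrakk>x \<in> carrier K; y \<in> carrier K\<rbrakk> \<Longrightarrow> f (x \<oplus>\<^bsub>K\<^esub> y) = f x \<oplus>\<^bsub>L\<^esub> f y"
    and smult: "\<And>a x. \<lbrakk>a \<in> carrier A; x \<in> carrier K\<rbrakk> \<Longrightarrow> f (a \<odot>\<^bsub>K\<^esub> x) = p a \<odot>\<^bsub>L\<^esub> f x"
  shows "Module.module B L"
proof -
  interpret K: Module.module A K by fact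
  have pre: "\<exists>x\<in>carrier K. y = f x" if "y \<in> carrier L" for y
    using that surj by blast
  have closed: "f x \<in> carrier L" if "x \<in> carrier K" for x
    using that surj by blast
  have addc: "x \<oplus>\<^bsub>L\<^esub> y \<in> carrier L" if xy: "x \<in> carrier L" "y \<in> carrier L" for x y
    using pre[OF xy(1)] pre[OF xy(2)] closed by (auto simp: add[symmetric])
  show ?thesis
  proof (rule moduleI)
    show "cring B" by (rule B.cring_axioms)
    show "abelian_group L"
    proof (rule abelian_groupI)
      show "\<zero>\<^bsub>L\<^esub> \<in> carrier L" using closed[OF K.M.zero_closed] zero by simp
      fix x assume x: "x \<in> carrier L"
      then obtain x' where x': "x' \<in> carrier K" "x = f x'" using pre by blast
      show "\<zero>\<^bsub>L\<^esub> \<oplus>\<^bsub>L\<^esub> x = x" using x' by (simp add: zero[symmetric] add[symmetric])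
      show "\<exists>y\<in>carrier L. y \<oplus>\<^bsub>L\<^esub> x = \<zero>\<^bsub>L\<^esub>"
        using x' closed
        by (intro bexI[of _ "f (\<ominus>\<^bsub>K\<^esub> x')"]) (simp_all add: zero[symmetric] add[symmetric] K.M.l_neg)
      fix y assume y: "y \<in> carrier L"
      then obtain y' where y': "y' \<in> carrier K" "y = f y'" using pre by blast
      show "x \<oplus>\<^bsub>L\<^esub> y \<in> carrier L" using x y by (rule addc)
      show "x \<oplus>\<^bsub>L\<^esub> y = y \<oplus>\<^bsub>L\<^esub> x" using x' y' by (simp add: add[symmetric] K.M.a_comm)
      fix z assume "z \<in> carrier L"
      then obtain z' where z': "z' \<in> carrier K" "z = f z'" using pre by blast
      show "x \<oplus>\<^bsub>L\<^esub> y \<oplus>\<^bsub>L\<^esub> z = x \<oplus>\<^bsub>L\<^esub> (y \<oplus>\<^bsub>L\<^esub> z)"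
        using x' y' z' by (simp add: add[symmetric] K.M.a_assoc)
    qed
  next
    fix x assume "x \<in> carrier L"
    then obtain x' where x': "x' \<in> carrier K" "x = f x'" using pre by blast
    show "\<one>\<^bsub>B\<^esub> \<odot>\<^bsub>L\<^esub> x = x"
      using x' smult[of "\<one>\<^bsub>A\<^esub>" x'] by (simp add: ring_hom_one[OF proj_hom])
    fix a assume "a \<in> carrier B"
    then obtain a' where a': "a' \<in> carrier A" "a = p a'" by (rule proj_preimage)
    show "a \<odot>\<^bsub>L\<^esub> x \<in> carrier L"
      using a' x' closed[of "a' \<odot>\<^bsub>K\<^esub> x'"] by (simp add: smult)
    {
      fix b assume "b \<in> carrier B"
      then obtain b' where b': "b' \<in> carrier A" "b = p b'" by (rule proj_preimage)
      show "(a \<oplus>\<^bsub>B\<^esub> b) \<odot>\<^bsub>L\<^esub> x = a \<odot>\<^bsub>L\<^esub> x \<oplus>\<^bsub>L\<^esub> b \<odot>\<^bsub>L\<^esub> x"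
        using a' b' x' by (simp add: ring_hom_add[OF proj_hom, symmetric] smult[symmetric] add[symmetric] K.smult_l_distr)
      show "(a \<otimes>\<^bsub>B\<^esub> b) \<odot>\<^bsub>L\<^esub> x = a \<odot>\<^bsub>L\<^esub> (b \<odot>\<^bsub>L\<^esub> x)"
        using a' b' x' by (simp add: ring_hom_mult[OF proj_hom, symmetric] smult[symmetric] K.smult_assoc1)
    next
      fix y assume "y \<in> carrier L"
      then obtain y' where y': "y' \<in> carrier K" "y = f y'" using pre by blast
      show "a \<odot>\<^bsub>L\<^esub> (x \<oplus>\<^bsub>L\<^esub> y) = a \<odot>\<^bsub>L\<^esub> x \<oplus>\<^bsub>L\<^esub> a \<odot>\<^bsub>L\<^esub> y"
        using a' x' y' by (simp add: smult[symmetric] add[symmetric] K.smult_r_distr)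
    }
  qed
qed

end

text \<open>
  The piece \<open>eK\<close> as a module over the copy \<open>B\<close> of \<open>eA\<close>; here \<open>q\<close> picks a representative in \<open>A\<close> of
  each element of \<open>B\<close>.  Representatives of one element differ only by something that \<open>e\<close> kills, so
  all of them act alike on \<open>eK\<close>.
\<close>

definition corner_module :: "'a \<Rightarrow> ('b \<Rightarrow> 'a) \<Rightarrow> ('a, 'c) module \<Rightarrow> ('b, 'c) module"
  where "corner_module e q K =
    \<lparr>carrier = (\<lambda>x. e \<odot>\<^bsub>K\<^esub> x) ` carrier K,
     monoid.mult = monoid.mult K, one = one K, ring.zero = ring.zero K, add = add K,
     smult = (\<lambda>b x. q b \<odot>\<^bsub>K\<^esub> x)\<rparr>"

lemma (in ring_corner) module_corner_corner_module:
  assumes K: "Module.module A K"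
    and q: "\<And>b. b \<in> carrier B \<Longrightarrow> q b \<in> carrier A \<and> p (q b) = b"
  shows "module_corner A B e p K (corner_module e q K) (\<lambda>x. e \<odot>\<^bsub>K\<^esub> x)"
proof -
  interpret K: Module.module A K by fact
  let ?L = "corner_module e q K"
  have surj: "(\<lambda>x. e \<odot>\<^bsub>K\<^esub> x) ` carrier K = carrier ?L"
    by (simp add: corner_module_def)
  have zero: "e \<odot>\<^bsub>K\<^esub> \<zero>\<^bsub>K\<^esub> = \<zero>\<^bsub>?L\<^esub>"
    using idem_closed by (simp add: corner_module_def)
  have add: "e \<odot>\<^bsub>K\<^esub> (x \<oplus>\<^bsub>K\<^esub> y) = e \<odot>\<^bsub>K\<^esub> x \<oplus>\<^bsub>?L\<^esub> e \<odot>\<^bsub>K\<^esub> y"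
    if "x \<in> carrier K" "y \<in> carrier K" for x y
    using that idem_closed by (simp add: corner_module_def K.smult_r_distr)
  have smult: "e \<odot>\<^bsub>K\<^esub> (a \<odot>\<^bsub>K\<^esub> x) = p a \<odot>\<^bsub>?L\<^esub> (e \<odot>\<^bsub>K\<^esub> x)"
    if a: "a \<in> carrier A" and x: "x \<in> carrier K" for a x
  proof -
    have c: "q (p a) \<in> carrier A" "p (q (p a)) = p a" using q proj_closed[OF a] by auto
    have "q (p a) \<odot>\<^bsub>K\<^esub> (e \<odot>\<^bsub>K\<^esub> x) = (e \<otimes>\<^bsub>A\<^esub> q (p a)) \<odot>\<^bsub>K\<^esub> x"
      using c x idem_closed by (simp add: K.smult_assoc1[symmetric] A.m_comm)
    also have "\<dots> = e \<odot>\<^bsub>K\<^esub> (a \<odot>\<^bsub>K\<^esub> x)"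
      unfolding idem_proj_preimage[of a q, OF a c] using a x idem_closed by (simp add: K.smult_assoc1)
    finally show ?thesis by (simp add: corner_module_def)
  qed
  interpret L: Module.module B ?L
    by (rule module_semilinear_image[OF K surj zero add smult])
  show ?thesis
    by unfold_locales (use surj add smult in auto)
qed

context module_corner
begin

lemma pi_closed: "x \<in> carrier N \<Longrightarrow> \<pi> x \<in> carrier N'"
  using pi_surj by blast

text \<open>
  The inclusion of the summand \<open>eN\<close> into \<open>N\<close>, read on the copy \<open>N'\<close>.  Multiplying an arbitrary
  preimage by \<open>e\<close> removes the dependence on the choice and makes the map additive and \<open>A\<close>-linear.
\<close>

definition sec :: "'d \<Rightarrow> 'c"
  where "sec y = e \<odot>\<^bsub>N\<^esub> inv_into (carrier N) \<pi> y"

lemma sec_pi: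
  assumes x: "x \<in> carrier N"
  shows "sec (\<pi> x) = e \<odot>\<^bsub>N\<^esub> x"
proof -
  have "inv_into (carrier N) \<pi> (\<pi> x) \<in> carrier N" "\<pi> (inv_into (carrier N) \<pi> (\<pi> x)) = \<pi> x"
    using x by (auto intro: inv_into_into f_inv_into_f)
  then show ?thesis using x pi_eq_iff by (simp add: sec_def)
qed

lemma pi_preimage:
  assumes "y \<in> carrier N'"
  obtains x where "x \<in> carrier N" "y = \<pi> x"
  using assms pi_surj by blast

lemma sec_closed: "y \<in> carrier N' \<Longrightarrow> sec y \<in> carrier N"
  by (erule pi_preimage) (simp add: sec_pi idem_closed)

lemma pi_idem: "x \<in> carrier N \<Longrightarrow> \<pi> (e \<odot>\<^bsub>N\<^esub> x) = \<pi> x"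
  using pi_eq_iff[of "e \<odot>\<^bsub>N\<^esub> x" x] idem_closed by (simp add: N.smult_assoc1[symmetric] idem)

lemma pi_sec: "y \<in> carrier N' \<Longrightarrow> \<pi> (sec y) = y"
  by (erule pi_preimage) (simp add: sec_pi pi_idem)

lemma sec_add: "y \<in> carrier N' \<Longrightarrow> z \<in> carrier N' \<Longrightarrow> sec (y \<oplus>\<^bsub>N'\<^esub> z) = sec y \<oplus>\<^bsub>N\<^esub> sec z"
  by (elim pi_preimage) (simp add: sec_pi pi_add[symmetric] N.smult_r_distr idem_closed)

lemma sec_smult: "a \<in> carrier A \<Longrightarrow> y \<in> carrier N' \<Longrightarrow> sec (p a \<odot>\<^bsub>N'\<^esub> y) = a \<odot>\<^bsub>N\<^esub> sec y"
  by (elim pi_preimage)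
    (simp add: sec_pi pi_smult[symmetric] N.smult_assoc1[symmetric] idem_closed A.m_comm)

end


section \<open>Projectivity and idempotents\<close>

text \<open>
  A lifting problem over \<open>B\<close> becomes one over \<open>A\<close> by restriction of scalars along \<open>p\<close> and composition
  with \<open>\<pi>\<close>.  The lift on \<open>N\<close>, restricted to the summand \<open>eN\<close>, solves the original problem.
\<close>

lemma (in module_corner) projective_module_corner:
  assumes "projective_module A N"
  shows "projective_module B N'"
  unfolding projective_module_def
proof (intro conjI allI impI)
  show "Module.module B N'" by (rule N'.module_axioms)
  fix U V :: "('b, ('d \<Rightarrow> 'b) set) module" and g h
  assume U: "Module.module B U" and V: "Module.module B V" and g: "g \<in> mod_hom B U V"
    and surj: "g ` carrier U = carrier V" and h: "h \<in> mod_hom B N' V"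
  let ?U = "restrict_scalars p U" and ?V = "restrict_scalars p V"
  have UV: "Module.module A ?U" "Module.module A ?V"
    using module_restrict_scalars[OF A.cring_axioms _ proj_hom] U V by blast+
  have "\<exists>k\<in>mod_hom A N ?U. \<forall>x\<in>carrier N. g (k x) = (h \<circ> \<pi>) x"
  proof (rule projective_module_lift[OF assms UV])
    show "g \<in> mod_hom A ?U ?V"
      using mod_homD[OF g] proj_closed by (intro mod_homI) (auto simp: restrict_scalars_def)
    show "g ` carrier ?U = carrier ?V" using surj by (simp add: restrict_scalars_def)
    show "h \<circ> \<pi> \<in> mod_hom A N ?V"
      using mod_homD[OF h] proj_closed pi_closed
      by (intro mod_homI) (auto simp: restrict_scalars_def pi_add pi_smult)
  qed
  then obtain k where k: "k \<in> mod_hom A N ?U" and lift: "\<And>x. x \<in> carrier N \<Longrightarrow> g (k x) = h (\<pi> x)"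
    by auto
  note k' = mod_homD[OF k, unfolded restrict_scalars_def, simplified]
  have "k \<circ> sec \<in> mod_hom B N' U"
  proof (rule mod_homI)
    fix b y assume "b \<in> carrier B" and y: "y \<in> carrier N'"
    then obtain a where a: "a \<in> carrier A" "b = p a" using proj_preimage by blast
    then show "(k \<circ> sec) (b \<odot>\<^bsub>N'\<^esub> y) = b \<odot>\<^bsub>U\<^esub> (k \<circ> sec) y"
      using y by (simp add: sec_smult k' sec_closed)
  qed (simp_all add: k' sec_closed sec_add)
  then show "\<exists>k\<in>mod_hom B N' U. \<forall>y\<in>carrier N'. g (k y) = h y"
    by (rule bexI[rotated]) (simp add: lift sec_closed pi_sec)
qed

definition annihilator :: "('a, 'm) ring_scheme \<Rightarrow> ('a, 'c) module \<Rightarrow> 'a set"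
  where "annihilator A N = {a \<in> carrier A. \<forall>x\<in>carrier N. a \<odot>\<^bsub>N\<^esub> x = \<zero>\<^bsub>N\<^esub>}"

text \<open>
  The map \<open>e h\<close> factors through \<open>eN\<close> and takes values in \<open>eV\<close>, and \<open>g\<close> restricts to a surjection
  from \<open>eU\<close> onto \<open>eV\<close>.  So it lifts over \<open>B\<close>, and precomposition with \<open>\<pi>\<close> gives a map defined on
  \<open>N\<close>.
\<close>

lemma (in module_corner) idem_lift:
  assumes proj: "projective_module B N'"
    and U: "Module.module A U" and V: "Module.module A V" and g: "g \<in> mod_hom A U V"
    and surj: "g ` carrier U = carrier V" and h: "h \<in> mod_hom A N V"
  shows "\<exists>k\<in>mod_hom A N U. \<forall>x\<in>carrier N. g (k x) = e \<odot>\<^bsub>V\<^esub> h x"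
proof -
  define q where "q = inv_into (carrier A) p"
  have q: "q b \<in> carrier A \<and> p (q b) = b" if "b \<in> carrier B" for b
    using that proj_surj by (simp add: q_def inv_into_into f_inv_into_f)
  interpret U: Module.module A U by fact
  interpret V: Module.module A V by fact
  let ?U = "corner_module e q U" and ?V = "corner_module e q V"
  interpret U': module_corner A B e p U ?U "\<lambda>x. e \<odot>\<^bsub>U\<^esub> x"
    by (rule module_corner_corner_module[OF U q])
  interpret V': module_corner A B e p V ?V "\<lambda>x. e \<odot>\<^bsub>V\<^esub> x"
    by (rule module_corner_corner_module[OF V q])
  have ge: "g (e \<odot>\<^bsub>U\<^esub> x) = e \<odot>\<^bsub>V\<^esub> g x" if "x \<in> carrier U" for x
    using that by (rule mod_homD(3)[OF g idem_closed])
  have U_sub: "carrier ?U \<subseteq> carrier U" using idem_closed by (auto simp: corner_module_def)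
  have g': "g \<in> mod_hom B ?U ?V"
  proof (rule mod_homI)
    show "g x \<in> carrier ?V" if "x \<in> carrier ?U" for x
      using that mod_homD(1)[OF g] by (auto simp: corner_module_def ge)
  qed (use mod_homD[OF g] q U_sub in \<open>auto simp: corner_module_def subset_iff\<close>)
  have surj': "g ` carrier ?U = carrier ?V"
  proof -
    have "g ` carrier ?U = (\<lambda>x. e \<odot>\<^bsub>V\<^esub> x) ` (g ` carrier U)"
      unfolding corner_module_def by (auto simp: ge image_iff)
    then show ?thesis unfolding surj by (simp add: corner_module_def)
  qed
  have h': "h \<circ> sec \<in> mod_hom B N' ?V"
  proof (rule mod_homI)
    fix y assume y: "y \<in> carrier N'"
    then obtain x where x: "x \<in> carrier N" "y = \<pi> x" by (rule pi_preimage)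
    show "(h \<circ> sec) y \<in> carrier ?V"
      using x mod_homD(1)[OF h] by (simp add: sec_pi mod_homD(3)[OF h idem_closed] corner_module_def)
    show "(h \<circ> sec) (b \<odot>\<^bsub>N'\<^esub> y) = b \<odot>\<^bsub>?V\<^esub> (h \<circ> sec) y" if "b \<in> carrier B" for b
    proof -
      have "sec (b \<odot>\<^bsub>N'\<^esub> y) = q b \<odot>\<^bsub>N\<^esub> sec y"
        using q[OF that] y sec_smult[of "q b" y] by simp
      then show ?thesis using q[OF that] y sec_closed[OF y] mod_homD(3)[OF h]
        by (simp add: corner_module_def)
    qed
    fix z assume "z \<in> carrier N'"
    then show "(h \<circ> sec) (y \<oplus>\<^bsub>N'\<^esub> z) = (h \<circ> sec) y \<oplus>\<^bsub>?V\<^esub> (h \<circ> sec) z"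
      using y by (simp add: sec_add sec_closed mod_homD(2)[OF h] corner_module_def)
  qed
  obtain k where k: "k \<in> mod_hom B N' ?U" and lift: "\<And>y. y \<in> carrier N' \<Longrightarrow> g (k y) = h (sec y)"
    using projective_module_lift[OF proj U'.N'.module_axioms V'.N'.module_axioms g' surj' h'] by auto
  have "k \<circ> \<pi> \<in> mod_hom A N U"
  proof (rule mod_homI)
    fix x assume x: "x \<in> carrier N"
    have kx: "k (\<pi> x) \<in> carrier ?U" using mod_homD(1)[OF k] pi_closed[OF x] by blast
    show "(k \<circ> \<pi>) x \<in> carrier U" using kx U_sub by auto
    show "(k \<circ> \<pi>) (a \<odot>\<^bsub>N\<^esub> x) = a \<odot>\<^bsub>U\<^esub> (k \<circ> \<pi>) x" if a: "a \<in> carrier A" for a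
    proof -
      obtain u where u: "u \<in> carrier U" "k (\<pi> x) = e \<odot>\<^bsub>U\<^esub> u" using kx by (auto simp: corner_module_def)
      have "k (p a \<odot>\<^bsub>N'\<^esub> \<pi> x) = p a \<odot>\<^bsub>?U\<^esub> (e \<odot>\<^bsub>U\<^esub> u)"
        using mod_homD(3)[OF k proj_closed[OF a] pi_closed[OF x]] u by simp
      also have "\<dots> = e \<odot>\<^bsub>U\<^esub> (a \<odot>\<^bsub>U\<^esub> u)" using U'.pi_smult[OF a u(1)] by simp
      also have "\<dots> = a \<odot>\<^bsub>U\<^esub> (e \<odot>\<^bsub>U\<^esub> u)"
        using a u idem_closed by (simp add: U.smult_assoc1[symmetric] A.m_comm)
      finally show ?thesis using a x u by (simp add: pi_smult)
    qed
    fix y assume "y \<in> carrier N"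
    then show "(k \<circ> \<pi>) (x \<oplus>\<^bsub>N\<^esub> y) = (k \<circ> \<pi>) x \<oplus>\<^bsub>U\<^esub> (k \<circ> \<pi>) y"
      using x mod_homD(2)[OF k] by (simp add: pi_add pi_closed corner_module_def)
  qed
  moreover have "g ((k \<circ> \<pi>) x) = e \<odot>\<^bsub>V\<^esub> h x" if "x \<in> carrier N" for x
    using that by (simp add: lift pi_closed sec_pi mod_homD(3)[OF h idem_closed])
  ultimately show ?thesis by blast
qed

text \<open>
  For the sets \<open>J\<close> of scalars that make a given problem solvable: they are ideals, so once they contain
  generators of the unit ideal they contain \<open>1\<close>.
\<close>

lemma genideal_one_induct:
  assumes A: "cring A" and one: "\<one>\<^bsub>A\<^esub> \<in> genideal A E"
    and sub: "\<And>a. a \<in> J \<Longrightarrow> a \<in> carrier A"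
    and incl: "E \<subseteq> J" and zero: "\<zero>\<^bsub>A\<^esub> \<in> J"
    and add: "\<And>a b. a \<in> J \<Longrightarrow> b \<in> J \<Longrightarrow> a \<oplus>\<^bsub>A\<^esub> b \<in> J"
    and mult: "\<And>a c. a \<in> J \<Longrightarrow> c \<in> carrier A \<Longrightarrow> c \<otimes>\<^bsub>A\<^esub> a \<in> J"
  shows "\<one>\<^bsub>A\<^esub> \<in> J"
proof -
  interpret A: cring A by fact
  have "ideal J A"
  proof (rule idealI)
    show "ring A" by (rule A.ring_axioms)
    show "subgroup J (add_monoid A)"
    proof (rule subgroup.intro)
      fix a assume a: "a \<in> J"
      have "(\<ominus>\<^bsub>A\<^esub> \<one>\<^bsub>A\<^esub>) \<otimes>\<^bsub>A\<^esub> a \<in> J" using a by (rule mult) simp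
      then show "inv\<^bsub>add_monoid A\<^esub> a \<in> J"
        using sub[OF a] by (simp add: A.l_minus a_inv_def[symmetric])
    qed (use sub zero add in auto)
    fix a x assume ax: "a \<in> J" "x \<in> carrier A"
    show "x \<otimes>\<^bsub>A\<^esub> a \<in> J" by (rule mult[OF ax])
    then show "a \<otimes>\<^bsub>A\<^esub> x \<in> J" using ax sub[OF ax(1)] by (simp add: A.m_comm)
  qed
  then show ?thesis using A.genideal_minimal[OF _ incl] one by blast
qed

text \<open>
  The scalars \<open>a\<close> for which \<open>a h\<close> lifts along the given surjection form an ideal, since lifts can be
  added and multiplied by scalars.  On the annihilator of \<open>N\<close> the zero map is a lift.
\<close>

theorem projective_module_iff_corners:
  assumes N: "Module.module A N"
    and corner: "\<And>i. i \<in> I \<Longrightarrow> module_corner A (B i) (e i) (p i) N (N' i) (\<pi> i)"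
    and cover: "\<one>\<^bsub>A\<^esub> \<in> genideal A (e ` I \<union> annihilator A N)"
  shows "projective_module A N \<longleftrightarrow> (\<forall>i\<in>I. projective_module (B i) (N' i))"
proof (intro iffI ballI)
  fix i assume "projective_module A N" "i \<in> I"
  then show "projective_module (B i) (N' i)"
    using module_corner.projective_module_corner[OF corner] by blast
next
  assume proj: "\<forall>i\<in>I. projective_module (B i) (N' i)"
  interpret N: Module.module A N by fact
  show "projective_module A N"
    unfolding projective_module_def
  proof (intro conjI allI impI)
    show "Module.module A N" by fact
    fix U V :: "('a, ('c \<Rightarrow> 'a) set) module" and g h
    assume U: "Module.module A U" and V: "Module.module A V" and g: "g \<in> mod_hom A U V"
      and surj: "g ` carrier U = carrier V" and h: "h \<in> mod_hom A N V"
    interpret U: Module.module A U by fact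
    interpret V: Module.module A V by fact
    define J where "J = {a \<in> carrier A. \<exists>k\<in>mod_hom A N U. \<forall>x\<in>carrier N. g (k x) = a \<odot>\<^bsub>V\<^esub> h x}"
    have J_I: "a \<in> J" if "a \<in> carrier A" "k \<in> mod_hom A N U" "\<And>x. x \<in> carrier N \<Longrightarrow> g (k x) = a \<odot>\<^bsub>V\<^esub> h x" for a k
      unfolding J_def using that by blast
    have ann: "annihilator A N \<subseteq> J"
    proof
      fix a assume "a \<in> annihilator A N"
      then have a: "a \<in> carrier A" "\<And>x. x \<in> carrier N \<Longrightarrow> a \<odot>\<^bsub>N\<^esub> x = \<zero>\<^bsub>N\<^esub>"
        by (auto simp: annihilator_def)
      have "(\<lambda>_. \<zero>\<^bsub>U\<^esub>) \<in> mod_hom A N U" by (rule mod_homI) auto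
      moreover have "g \<zero>\<^bsub>U\<^esub> = a \<odot>\<^bsub>V\<^esub> h x" if "x \<in> carrier N" for x
        using mod_homD(3)[OF h a(1) that] a(2)[OF that] mod_hom_zero[OF N V h] mod_hom_zero[OF U V g]
        by simp
      ultimately show "a \<in> J" by (rule J_I[OF a(1)])
    qed
    have "\<one>\<^bsub>A\<^esub> \<in> J"
    proof (rule genideal_one_induct[OF N.R.cring_axioms cover])
      show "a \<in> carrier A" if "a \<in> J" for a using that by (simp add: J_def)
      have "e i \<in> J" if i: "i \<in> I" for i
      proof -
        interpret C: module_corner A "B i" "e i" "p i" N "N' i" "\<pi> i" by (rule corner[OF i])
        show ?thesis
          unfolding J_def using C.idem_closed C.idem_lift[OF _ U V g surj h] proj i by blast
      qed
      then show "e ` I \<union> annihilator A N \<subseteq> J" using ann by blast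
      show "\<zero>\<^bsub>A\<^esub> \<in> J" using ann by (auto simp: annihilator_def)
    next
      fix a b assume "a \<in> J" "b \<in> J"
      then obtain k l where a: "a \<in> carrier A" "k \<in> mod_hom A N U" "\<And>x. x \<in> carrier N \<Longrightarrow> g (k x) = a \<odot>\<^bsub>V\<^esub> h x"
        and b: "b \<in> carrier A" "l \<in> mod_hom A N U" "\<And>x. x \<in> carrier N \<Longrightarrow> g (l x) = b \<odot>\<^bsub>V\<^esub> h x"
        by (auto simp: J_def)
      note kl = mod_homD[OF a(2)] mod_homD[OF b(2)]
      have "(\<lambda>x. k x \<oplus>\<^bsub>U\<^esub> l x) \<in> mod_hom A N U"
        by (rule mod_homI) (simp_all add: kl U.M.a_ac U.smult_r_distr)
      moreover have "g (k x \<oplus>\<^bsub>U\<^esub> l x) = (a \<oplus>\<^bsub>A\<^esub> b) \<odot>\<^bsub>V\<^esub> h x" if "x \<in> carrier N" for x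
        using that a b kl by (simp add: mod_homD(2)[OF g] V.smult_l_distr mod_homD(1)[OF h])
      ultimately show "a \<oplus>\<^bsub>A\<^esub> b \<in> J" using a(1) b(1) by (intro J_I) auto
    next
      fix a c assume "a \<in> J" and c: "c \<in> carrier A"
      then obtain k where a: "a \<in> carrier A" "k \<in> mod_hom A N U" "\<And>x. x \<in> carrier N \<Longrightarrow> g (k x) = a \<odot>\<^bsub>V\<^esub> h x"
        by (auto simp: J_def)
      note k = mod_homD[OF a(2)]
      have "(\<lambda>x. c \<odot>\<^bsub>U\<^esub> k x) \<in> mod_hom A N U"
        by (rule mod_homI) (simp_all add: k c U.smult_r_distr U.smult_assoc1[symmetric] N.R.m_comm)
      moreover have "g (c \<odot>\<^bsub>U\<^esub> k x) = (c \<otimes>\<^bsub>A\<^esub> a) \<odot>\<^bsub>V\<^esub> h x" if "x \<in> carrier N" for x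
        using that a c k by (simp add: mod_homD(3)[OF g] V.smult_assoc1 mod_homD(1)[OF h])
      ultimately show "c \<otimes>\<^bsub>A\<^esub> a \<in> J" using a(1) c by (intro J_I) auto
    qed
    then obtain k where "k \<in> mod_hom A N U" "\<And>x. x \<in> carrier N \<Longrightarrow> g (k x) = \<one>\<^bsub>A\<^esub> \<odot>\<^bsub>V\<^esub> h x"
      by (auto simp: J_def)
    then show "\<exists>k\<in>mod_hom A N U. \<forall>x\<in>carrier N. g (k x) = h x"
      using mod_homD(1)[OF h] by auto
  qed
qed



section \<open>Flatness and idempotents\<close>

text \<open>
  The map \<open>f \<otimes> g\<close> on formal sums of pairs.  Passing to a piece \<open>eN\<close> changes both factors of the tensor
  product.
\<close>

definition tensor_push2 :: "('c \<Rightarrow> 'e) \<Rightarrow> ('d \<Rightarrow> 'f) \<Rightarrow> (('c \<times> 'd) \<Rightarrow>\<^sub>0 int) \<Rightarrow> (('e \<times> 'f) \<Rightarrow>\<^sub>0 int)"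
  where "tensor_push2 f g = frag_extend (\<lambda>(x, n). frag_of (f x, g n))"

lemma tensor_push2_simps [simp]:
  "tensor_push2 f g 0 = 0" "tensor_push2 f g (frag_of (x, n)) = frag_of (f x, g n)"
  "tensor_push2 f g (u + v) = tensor_push2 f g u + tensor_push2 f g v"
  "tensor_push2 f g (u - v) = tensor_push2 f g u - tensor_push2 f g v"
  "tensor_push2 f g (- u) = - tensor_push2 f g u"
  by (simp_all add: tensor_push2_def frag_extend_add frag_extend_diff frag_extend_minus)

lemma tensor_push_eq_push2: "tensor_push f = tensor_push2 f (\<lambda>n. n)"
  by (simp add: fun_eq_iff tensor_push_def tensor_push2_def)

lemma tensor_push2_comp:
  "tensor_push2 f' g' (tensor_push2 f g u) = tensor_push2 (\<lambda>x. f' (f x)) (\<lambda>n. g' (g n)) u"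
proof -
  have "Poly_Mapping.keys u \<subseteq> UNIV" by simp
  then show ?thesis
  proof (induction u rule: frag_induction)
    case (one p)
    then show ?case by (cases p) simp
  qed simp_all
qed

lemma tensor_push2_cong:
  assumes "Poly_Mapping.keys u \<subseteq> C \<times> D"
    and "\<And>x. x \<in> C \<Longrightarrow> f x = f' x" and "\<And>n. n \<in> D \<Longrightarrow> g n = g' n"
  shows "tensor_push2 f g u = tensor_push2 f' g' u"
  using assms(1)
proof (induction u rule: frag_induction)
  case (one p)
  then show ?case by (cases p) (simp add: assms(2,3))
qed simp_all

lemma tensor_push2_ident:
  assumes "Poly_Mapping.keys u \<subseteq> C \<times> D"
    and "\<And>x. x \<in> C \<Longrightarrow> f x = x" and "\<And>n. n \<in> D \<Longrightarrow> g n = n"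
  shows "tensor_push2 f g u = u"
  using assms(1)
proof (induction u rule: frag_induction)
  case (one p)
  then show ?case by (cases p) (simp add: assms(2,3))
qed simp_all

lemma tensor_push2_keys:
  assumes "Poly_Mapping.keys u \<subseteq> C \<times> D"
    and "\<And>x. x \<in> C \<Longrightarrow> f x \<in> C'" and "\<And>n. n \<in> D \<Longrightarrow> g n \<in> D'"
  shows "Poly_Mapping.keys (tensor_push2 f g u) \<subseteq> C' \<times> D'"
  using assms(1)
proof (induction u rule: frag_induction)
  case (one p)
  then show ?case by (cases p) (simp add: assms(2,3))
next
  case (diff a b)
  then show ?case
    unfolding tensor_push2_simps by (intro order_trans[OF keys_diff] Un_least)
qed simp

text \<open>
  The two modules may lie over different rings: the maps need only carry each scalar \<open>a\<close> to a common
  scalar \<open>b\<close>.  This covers the passage from \<open>A\<close> to \<open>eA\<close> as well as the way back.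
\<close>

lemma tensor_push2_rel:
  assumes K: "Module.module A K" and N: "Module.module A N"
    and K': "Module.module B K'" and N': "Module.module B N'"
    and f: "\<And>x. x \<in> carrier K \<Longrightarrow> f x \<in> carrier K'"
      "\<And>x y. \<lbrakk>x \<in> carrier K; y \<in> carrier K\<rbrakk> \<Longrightarrow> f (x \<oplus>\<^bsub>K\<^esub> y) = f x \<oplus>\<^bsub>K'\<^esub> f y"
    and g: "\<And>n. n \<in> carrier N \<Longrightarrow> g n \<in> carrier N'"
      "\<And>m n. \<lbrakk>m \<in> carrier N; n \<in> carrier N\<rbrakk> \<Longrightarrow> g (m \<oplus>\<^bsub>N\<^esub> n) = g m \<oplus>\<^bsub>N'\<^esub> g n"
    and smult: "\<And>a. a \<in> carrier A \<Longrightarrow> \<exists>b\<in>carrier B.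
      (\<forall>x\<in>carrier K. f (a \<odot>\<^bsub>K\<^esub> x) = b \<odot>\<^bsub>K'\<^esub> f x) \<and> (\<forall>n\<in>carrier N. g (a \<odot>\<^bsub>N\<^esub> n) = b \<odot>\<^bsub>N'\<^esub> g n)"
    and u: "u \<in> tensor_rel A K N"
  shows "tensor_push2 f g u \<in> tensor_rel B K' N'"
proof -
  note cl = tensor_rel_closed[OF K' N']
  from K N u show ?thesis
  proof (induction rule: tensor_rel_induct)
    case zero
    show ?case using cl(1) by simp
  next
    case (gen u)
    then consider
        x y n where "u = frag_of (x \<oplus>\<^bsub>K\<^esub> y, n) - frag_of (x, n) - frag_of (y, n)"
          "x \<in> carrier K" "y \<in> carrier K" "n \<in> carrier N"
      | x n p where "u = frag_of (x, n \<oplus>\<^bsub>N\<^esub> p) - frag_of (x, n) - frag_of (x, p)"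
          "x \<in> carrier K" "n \<in> carrier N" "p \<in> carrier N"
      | a x n where "u = frag_of (a \<odot>\<^bsub>K\<^esub> x, n) - frag_of (x, a \<odot>\<^bsub>N\<^esub> n)"
          "a \<in> carrier A" "x \<in> carrier K" "n \<in> carrier N"
      unfolding tensor_gens_def by blast
    then show ?case
    proof cases
      case 1
      then show ?thesis
        using cl(5)[OF tensor_gensI(1)[of "f x" K' "f y" "g n" N' B]] f g by simp
    next
      case 2
      then show ?thesis
        using cl(5)[OF tensor_gensI(2)[of "f x" K' "g n" N' "g p" B]] f g by simp
    next
      case 3
      obtain b where "b \<in> carrier B" "f (a \<odot>\<^bsub>K\<^esub> x) = b \<odot>\<^bsub>K'\<^esub> f x" "g (a \<odot>\<^bsub>N\<^esub> n) = b \<odot>\<^bsub>N'\<^esub> g n"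
        using smult[OF 3(2)] 3(3,4) by blast
      then show ?thesis
        using 3 cl(5)[OF tensor_gensI(3)[of b B "f x" K' "g n" N']] f g by simp
    qed
  qed (simp_all add: cl)
qed

text \<open>
  After restriction of scalars along \<open>p\<close>, the inclusion of \<open>eN\<close> turns a tensor over \<open>B\<close> into one over
  \<open>A\<close>, where flatness of \<open>N\<close> makes it zero; \<open>\<pi>\<close> brings this back to \<open>B\<close>.
\<close>

lemma (in module_corner) flat_module_corner:
  assumes flat: "flat_module A N"
  shows "flat_module B N'"
  unfolding flat_module_def
proof (intro conjI allI impI)
  show N': "Module.module B N'" by (rule N'.module_axioms)
  fix K L :: "('b, 'b list set) module" and f
  assume K: "Module.module B K" and L: "Module.module B L" and f: "f \<in> mod_hom B K L"
    and inj: "inj_on f (carrier K)"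
  let ?K = "restrict_scalars p K" and ?L = "restrict_scalars p L"
  have K0: "Module.module A ?K" and L0: "Module.module A ?L"
    using module_restrict_scalars[OF A.cring_axioms _ proj_hom] K L by blast+
  have f0: "f \<in> mod_hom A ?K ?L"
    using mod_homD[OF f] proj_closed by (intro mod_homI) (auto simp: restrict_scalars_def)
  have "inj_on (tensor_map A f ?K ?L N) (carrier (tensor_product A ?K N))"
    by (rule flat_module_inj[OF flat K0 L0 f0]) (use inj in \<open>simp add: restrict_scalars_def\<close>)
  then have key: "v \<in> tensor_rel A ?K N"
    if "Poly_Mapping.keys v \<subseteq> carrier K \<times> carrier N" "tensor_push f v \<in> tensor_rel A ?L N" for v
    using that unfolding inj_on_tensor_map_iff[OF K0 L0 N.module_axioms f0]
    by (simp add: restrict_scalars_def)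
  have "u \<in> tensor_rel B K N'"
    if ku: "Poly_Mapping.keys u \<subseteq> carrier K \<times> carrier N'" and u: "tensor_push f u \<in> tensor_rel B L N'" for u
  proof -
    have "tensor_push2 (\<lambda>x. x) sec (tensor_push f u) \<in> tensor_rel A ?L N"
    proof (rule tensor_push2_rel[OF L N' L0 N.module_axioms _ _ _ _ _ u])
      fix b assume "b \<in> carrier B"
      then obtain a where "a \<in> carrier A" "b = p a" by (rule proj_preimage)
      then show "\<exists>a\<in>carrier A. (\<forall>x\<in>carrier L. b \<odot>\<^bsub>L\<^esub> x = a \<odot>\<^bsub>?L\<^esub> x) \<and>
          (\<forall>n\<in>carrier N'. sec (b \<odot>\<^bsub>N'\<^esub> n) = a \<odot>\<^bsub>N\<^esub> sec n)"
        by (intro bexI[of _ a]) (simp_all add: restrict_scalars_def sec_smult)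
    qed (simp_all add: restrict_scalars_def sec_closed sec_add)
    then have "tensor_push f (tensor_push2 (\<lambda>x. x) sec u) \<in> tensor_rel A ?L N"
      by (simp add: tensor_push_eq_push2 tensor_push2_comp)
    moreover have "Poly_Mapping.keys (tensor_push2 (\<lambda>x. x) sec u) \<subseteq> carrier K \<times> carrier N"
      using ku by (rule tensor_push2_keys) (simp_all add: sec_closed)
    ultimately have "tensor_push2 (\<lambda>x. x) sec u \<in> tensor_rel A ?K N" by (intro key)
    then have "tensor_push2 (\<lambda>x. x) \<pi> (tensor_push2 (\<lambda>x. x) sec u) \<in> tensor_rel B K N'"
    proof (rule tensor_push2_rel[OF K0 N.module_axioms K N', rotated -1])
      fix a assume "a \<in> carrier A"
      then show "\<exists>b\<in>carrier B. (\<forall>x\<in>carrier ?K. a \<odot>\<^bsub>?K\<^esub> x = b \<odot>\<^bsub>K\<^esub> x) \<and>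
          (\<forall>n\<in>carrier N. \<pi> (a \<odot>\<^bsub>N\<^esub> n) = b \<odot>\<^bsub>N'\<^esub> \<pi> n)"
        by (intro bexI[of _ "p a"]) (simp_all add: restrict_scalars_def pi_smult proj_closed)
    qed (simp_all add: restrict_scalars_def pi_closed pi_add)
    then show ?thesis
      unfolding tensor_push2_comp using tensor_push2_ident[OF ku, of "\<lambda>x. x" "\<lambda>n. \<pi> (sec n)"]
      by (simp add: pi_sec)
  qed
  then show "inj_on (tensor_map B f K L N') (carrier (tensor_product B K N'))"
    unfolding inj_on_tensor_map_iff[OF K L N' f] by blast
qed

lemma tensor_rel_scalar_right:
  assumes K: "Module.module A K" and N: "Module.module A N" and a: "a \<in> carrier A"
    and u: "Poly_Mapping.keys u \<subseteq> carrier K \<times> carrier N"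
  shows "tensor_push (\<lambda>x. a \<odot>\<^bsub>K\<^esub> x) u - tensor_push2 (\<lambda>x. x) (\<lambda>n. a \<odot>\<^bsub>N\<^esub> n) u \<in> tensor_rel A K N"
  using u
proof (induction u rule: frag_induction)
  case (one z)
  then show ?case
    using tensor_rel_closed(5)[OF K N tensor_gensI(3)[OF a]] by (cases z) simp
next
  case (diff u v)
  show ?case
    using tensor_rel_closed(2)[OF K N diff(1) tensor_rel_closed(3)[OF K N diff(2)]]
    by (simp add: algebra_simps)
qed (simp add: tensor_rel_closed(1)[OF K N])

lemma tensor_rel_push_add:
  assumes K: "Module.module A K" and N: "Module.module A N" and a: "a \<in> carrier A" and b: "b \<in> carrier A"
    and u: "Poly_Mapping.keys u \<subseteq> carrier K \<times> carrier N"
  shows "tensor_push (\<lambda>x. (a \<oplus>\<^bsub>A\<^esub> b) \<odot>\<^bsub>K\<^esub> x) u -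
    tensor_push (\<lambda>x. a \<odot>\<^bsub>K\<^esub> x) u - tensor_push (\<lambda>x. b \<odot>\<^bsub>K\<^esub> x) u \<in> tensor_rel A K N"
  using u
proof (induction u rule: frag_induction)
  case (one z)
  interpret K: Module.module A K by fact
  obtain x n where z: "z = (x, n)" "x \<in> carrier K" "n \<in> carrier N" using one by (cases z) auto
  then show ?case
    using tensor_rel_closed(5)[OF K N tensor_gensI(1)[of "a \<odot>\<^bsub>K\<^esub> x" K "b \<odot>\<^bsub>K\<^esub> x" n N A]] a b
    by (simp add: K.smult_l_distr)
next
  case (diff u v)
  show ?case
    using tensor_rel_closed(2)[OF K N diff(1) tensor_rel_closed(3)[OF K N diff(2)]]
    by (simp add: algebra_simps)
qed (simp add: tensor_rel_closed(1)[OF K N])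

lemma tensor_rel_zero_right:
  assumes K: "Module.module A K" and N: "Module.module A N"
    and u: "Poly_Mapping.keys u \<subseteq> carrier K \<times> {\<zero>\<^bsub>N\<^esub>}"
  shows "u \<in> tensor_rel A K N"
  using u
proof (induction u rule: frag_induction)
  case (one z)
  interpret N: Module.module A N by fact
  obtain x where z: "z = (x, \<zero>\<^bsub>N\<^esub>)" "x \<in> carrier K" using one by (cases z) auto
  have "- frag_of z \<in> tensor_rel A K N"
    using tensor_rel_closed(5)[OF K N tensor_gensI(2)[of x K "\<zero>\<^bsub>N\<^esub>" N "\<zero>\<^bsub>N\<^esub>" A]] z by simp
  then show ?case using tensor_rel_closed(3)[OF K N] by fastforce
next
  case (diff u v)
  show ?case
    using tensor_rel_closed(2)[OF K N diff(1) tensor_rel_closed(3)[OF K N diff(2)]] by simp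
qed (simp add: tensor_rel_closed(1)[OF K N])

text \<open>
  The map \<open>x \<otimes> n \<mapsto> ex \<otimes> en\<close> factors through the tensor product of \<open>eK\<close> and \<open>eN\<close> over \<open>B\<close>, where the
  image of \<open>u\<close> vanishes because \<open>f\<close> restricts to an injection from \<open>eK\<close> into \<open>eL\<close> and \<open>eN\<close> is flat.
  Since \<open>e\<close> is idempotent, that map is multiplication by \<open>e\<close>.
\<close>

lemma (in module_corner) idem_tensor_rel:
  assumes flat: "flat_module B N'"
    and K: "Module.module A K" and L: "Module.module A L" and f: "f \<in> mod_hom A K L"
    and inj: "inj_on f (carrier K)"
    and ku: "Poly_Mapping.keys u \<subseteq> carrier K \<times> carrier N" and u: "tensor_push f u \<in> tensor_rel A L N"
  shows "tensor_push (\<lambda>x. e \<odot>\<^bsub>K\<^esub> x) u \<in> tensor_rel A K N"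
proof -
  define q where "q = inv_into (carrier A) p"
  have q: "q b \<in> carrier A \<and> p (q b) = b" if "b \<in> carrier B" for b
    using that proj_surj by (simp add: q_def inv_into_into f_inv_into_f)
  interpret K: Module.module A K by fact
  interpret L: Module.module A L by fact
  let ?K = "corner_module e q K" and ?L = "corner_module e q L"
  interpret K': module_corner A B e p K ?K "\<lambda>x. e \<odot>\<^bsub>K\<^esub> x"
    by (rule module_corner_corner_module[OF K q])
  interpret L': module_corner A B e p L ?L "\<lambda>x. e \<odot>\<^bsub>L\<^esub> x"
    by (rule module_corner_corner_module[OF L q])
  note N = N.module_axioms and N' = N'.module_axioms
  have fe: "f (e \<odot>\<^bsub>K\<^esub> x) = e \<odot>\<^bsub>L\<^esub> f x" if "x \<in> carrier K" for x
    using that by (rule mod_homD(3)[OF f idem_closed])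
  have K_sub: "carrier ?K \<subseteq> carrier K" using idem_closed by (auto simp: corner_module_def)
  have f': "f \<in> mod_hom B ?K ?L"
  proof (rule mod_homI)
    show "f x \<in> carrier ?L" if "x \<in> carrier ?K" for x
      using that mod_homD(1)[OF f] by (auto simp: corner_module_def fe)
  qed (use mod_homD[OF f] q K_sub in \<open>auto simp: corner_module_def subset_iff\<close>)
  have "inj_on (tensor_map B f ?K ?L N') (carrier (tensor_product B ?K N'))"
    by (rule flat_module_inj[OF flat K'.N'.module_axioms L'.N'.module_axioms f' inj_on_subset[OF inj K_sub]])
  then have key: "v \<in> tensor_rel B ?K N'"
    if "Poly_Mapping.keys v \<subseteq> carrier ?K \<times> carrier N'" "tensor_push f v \<in> tensor_rel B ?L N'" for v
    using that unfolding inj_on_tensor_map_iff[OF K'.N'.module_axioms L'.N'.module_axioms N' f'] by blast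
  have "tensor_push2 (\<lambda>x. e \<odot>\<^bsub>L\<^esub> x) \<pi> (tensor_push f u) \<in> tensor_rel B ?L N'"
  proof (rule tensor_push2_rel[OF L N L'.N'.module_axioms N' _ _ _ _ _ u])
    fix a assume a: "a \<in> carrier A"
    then show "\<exists>b\<in>carrier B. (\<forall>x\<in>carrier L. e \<odot>\<^bsub>L\<^esub> (a \<odot>\<^bsub>L\<^esub> x) = b \<odot>\<^bsub>?L\<^esub> (e \<odot>\<^bsub>L\<^esub> x)) \<and>
        (\<forall>n\<in>carrier N. \<pi> (a \<odot>\<^bsub>N\<^esub> n) = b \<odot>\<^bsub>N'\<^esub> \<pi> n)"
      using proj_closed pi_smult L'.pi_smult by blast
  qed (rule L'.pi_closed L'.pi_add pi_closed pi_add; assumption)+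
  also have "tensor_push2 (\<lambda>x. e \<odot>\<^bsub>L\<^esub> x) \<pi> (tensor_push f u) =
      tensor_push f (tensor_push2 (\<lambda>x. e \<odot>\<^bsub>K\<^esub> x) \<pi> u)"
    unfolding tensor_push_eq_push2 tensor_push2_comp
    by (rule tensor_push2_cong[OF ku]) (simp_all add: fe)
  finally have "tensor_push2 (\<lambda>x. e \<odot>\<^bsub>K\<^esub> x) \<pi> u \<in> tensor_rel B ?K N'"
    by (intro key tensor_push2_keys[OF ku] K'.pi_closed pi_closed)
  then have "tensor_push2 (\<lambda>x. x) sec (tensor_push2 (\<lambda>x. e \<odot>\<^bsub>K\<^esub> x) \<pi> u) \<in> tensor_rel A K N"
  proof (rule tensor_push2_rel[OF K'.N'.module_axioms N' K N, rotated -1])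
    fix b assume b: "b \<in> carrier B"
    show "\<exists>a\<in>carrier A. (\<forall>x\<in>carrier ?K. b \<odot>\<^bsub>?K\<^esub> x = a \<odot>\<^bsub>K\<^esub> x) \<and>
        (\<forall>n\<in>carrier N'. sec (b \<odot>\<^bsub>N'\<^esub> n) = a \<odot>\<^bsub>N\<^esub> sec n)"
      using q[OF b] sec_smult[of "q b"] by (intro bexI[of _ "q b"]) (simp_all add: corner_module_def)
  next
    show "x \<in> carrier K" if "x \<in> carrier ?K" for x using that K_sub by blast
  qed (simp_all add: sec_closed sec_add corner_module_def)
  also have "tensor_push2 (\<lambda>x. x) sec (tensor_push2 (\<lambda>x. e \<odot>\<^bsub>K\<^esub> x) \<pi> u) =
      tensor_push2 (\<lambda>x. x) (\<lambda>n. e \<odot>\<^bsub>N\<^esub> n) (tensor_push (\<lambda>x. e \<odot>\<^bsub>K\<^esub> x) u)"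
    unfolding tensor_push_eq_push2 tensor_push2_comp
    by (rule tensor_push2_cong[OF ku]) (simp_all add: sec_pi)
  finally have 1: "tensor_push2 (\<lambda>x. x) (\<lambda>n. e \<odot>\<^bsub>N\<^esub> n) (tensor_push (\<lambda>x. e \<odot>\<^bsub>K\<^esub> x) u) \<in> tensor_rel A K N" .
  have "Poly_Mapping.keys (tensor_push (\<lambda>x. e \<odot>\<^bsub>K\<^esub> x) u) \<subseteq> carrier K \<times> carrier N"
    using ku by (rule tensor_push_keys) (simp add: idem_closed)
  \<comment> \<open>Moving \<open>e\<close> across the tensor sign turns \<open>ex \<otimes> en\<close> into \<open>eex \<otimes> n = ex \<otimes> n\<close>.\<close>
  note 2 = tensor_rel_scalar_right[OF K N idem_closed this]
  have "tensor_push (\<lambda>x. e \<odot>\<^bsub>K\<^esub> x) (tensor_push (\<lambda>x. e \<odot>\<^bsub>K\<^esub> x) u) = tensor_push (\<lambda>x. e \<odot>\<^bsub>K\<^esub> x) u"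
    unfolding tensor_push_comp
    by (rule tensor_push_cong[OF ku]) (simp add: K.smult_assoc1[symmetric] idem_closed idem)
  then show ?thesis using tensor_rel_closed(2)[OF K N 2 1] by simp
qed

text \<open>
  The scalars that annihilate the class of \<open>u\<close> in the tensor product form an ideal.  It contains the
  annihilator of \<open>N\<close>, because a scalar can be moved to the second factor.
\<close>

theorem flat_module_iff_corners:
  assumes N: "Module.module A N"
    and corner: "\<And>i. i \<in> I \<Longrightarrow> module_corner A (B i) (e i) (p i) N (N' i) (\<pi> i)"
    and cover: "\<one>\<^bsub>A\<^esub> \<in> genideal A (e ` I \<union> annihilator A N)"
  shows "flat_module A N \<longleftrightarrow> (\<forall>i\<in>I. flat_module (B i) (N' i))"
proof (intro iffI ballI)
  fix i assume "flat_module A N" "i \<in> I"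
  then show "flat_module (B i) (N' i)"
    using module_corner.flat_module_corner[OF corner] by blast
next
  assume flat: "\<forall>i\<in>I. flat_module (B i) (N' i)"
  interpret N: Module.module A N by fact
  show "flat_module A N"
    unfolding flat_module_def
  proof (intro conjI allI impI)
    show "Module.module A N" by fact
    fix K L :: "('a, 'a list set) module" and f
    assume K: "Module.module A K" and L: "Module.module A L" and f: "f \<in> mod_hom A K L"
      and inj: "inj_on f (carrier K)"
    interpret K: Module.module A K by fact
    note cl = tensor_rel_closed[OF K N]
    have "u \<in> tensor_rel A K N"
      if ku: "Poly_Mapping.keys u \<subseteq> carrier K \<times> carrier N" and u: "tensor_push f u \<in> tensor_rel A L N" for u
    proof -
      define J where "J = {a \<in> carrier A. tensor_push (\<lambda>x. a \<odot>\<^bsub>K\<^esub> x) u \<in> tensor_rel A K N}"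
      have ann: "a \<in> J" if "a \<in> annihilator A N" for a
      proof -
        have a: "a \<in> carrier A" "\<And>n. n \<in> carrier N \<Longrightarrow> a \<odot>\<^bsub>N\<^esub> n = \<zero>\<^bsub>N\<^esub>"
          using that by (auto simp: annihilator_def)
        have "Poly_Mapping.keys (tensor_push2 (\<lambda>x. x) (\<lambda>n. a \<odot>\<^bsub>N\<^esub> n) u) \<subseteq> carrier K \<times> {\<zero>\<^bsub>N\<^esub>}"
          using ku by (rule tensor_push2_keys) (simp_all add: a)
        then have "tensor_push2 (\<lambda>x. x) (\<lambda>n. a \<odot>\<^bsub>N\<^esub> n) u \<in> tensor_rel A K N"
          by (rule tensor_rel_zero_right[OF K N])
        from cl(2)[OF tensor_rel_scalar_right[OF K N a(1) ku] this] a(1)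
        show ?thesis by (simp add: J_def)
      qed
      have "\<one>\<^bsub>A\<^esub> \<in> J"
      proof (rule genideal_one_induct[OF N.R.cring_axioms cover])
        show "a \<in> carrier A" if "a \<in> J" for a using that by (simp add: J_def)
        have "e i \<in> J" if i: "i \<in> I" for i
        proof -
          interpret C: module_corner A "B i" "e i" "p i" N "N' i" "\<pi> i" by (rule corner[OF i])
          have "flat_module (B i) (N' i)" using flat i by blast
          from C.idem_tensor_rel[OF this K L f inj ku u] C.idem_closed
          show ?thesis by (simp add: J_def)
        qed
        then show "e ` I \<union> annihilator A N \<subseteq> J" using ann by blast
        show "\<zero>\<^bsub>A\<^esub> \<in> J" by (rule ann) (simp add: annihilator_def)
      next
        fix a b assume "a \<in> J" "b \<in> J"
        then have ab: "a \<in> carrier A" "b \<in> carrier A"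
          and rel: "tensor_push (\<lambda>x. a \<odot>\<^bsub>K\<^esub> x) u \<in> tensor_rel A K N" "tensor_push (\<lambda>x. b \<odot>\<^bsub>K\<^esub> x) u \<in> tensor_rel A K N"
          by (auto simp: J_def)
        have "tensor_push (\<lambda>x. (a \<oplus>\<^bsub>A\<^esub> b) \<odot>\<^bsub>K\<^esub> x) u \<in> tensor_rel A K N"
          using cl(2)[OF tensor_rel_push_add[OF K N ab ku] cl(2)[OF rel]] by simp
        then show "a \<oplus>\<^bsub>A\<^esub> b \<in> J" using ab by (simp add: J_def)
      next
        fix a c assume "a \<in> J" and c: "c \<in> carrier A"
        then have a: "a \<in> carrier A" and rel: "tensor_push (\<lambda>x. a \<odot>\<^bsub>K\<^esub> x) u \<in> tensor_rel A K N"
          by (auto simp: J_def)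
        have "(\<lambda>x. c \<odot>\<^bsub>K\<^esub> x) \<in> mod_hom A K K"
          using c by (intro mod_homI) (simp_all add: K.smult_r_distr K.smult_assoc1[symmetric] N.R.m_comm)
        from tensor_push_rel[OF K K N this rel]
        have "tensor_push (\<lambda>x. c \<odot>\<^bsub>K\<^esub> (a \<odot>\<^bsub>K\<^esub> x)) u \<in> tensor_rel A K N"
          by (simp add: tensor_push_comp o_def)
        also have "tensor_push (\<lambda>x. c \<odot>\<^bsub>K\<^esub> (a \<odot>\<^bsub>K\<^esub> x)) u = tensor_push (\<lambda>x. (c \<otimes>\<^bsub>A\<^esub> a) \<odot>\<^bsub>K\<^esub> x) u"
          by (rule tensor_push_cong[OF ku]) (simp add: a c K.smult_assoc1)
        finally show "c \<otimes>\<^bsub>A\<^esub> a \<in> J" using a c by (simp add: J_def)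
      qed
      moreover have "tensor_push (\<lambda>x. \<one>\<^bsub>A\<^esub> \<odot>\<^bsub>K\<^esub> x) u = u"
        by (rule tensor_push_ident[OF ku]) simp
      ultimately show ?thesis by (simp add: J_def)
    qed
    then show "inj_on (tensor_map A f K L N) (carrier (tensor_product A K N))"
      unfolding inj_on_tensor_map_iff[OF K L N f] by blast
  qed
qed



section \<open>Localization and idempotents\<close>

text \<open>
  The map \<open>x / s \<mapsto> f x / p s\<close>, as the union of the classes obtained from all representatives; it is a
  single class when these classes agree.
\<close>

definition frac_push ::
    "('b, 'm) ring_scheme \<Rightarrow> 'b set \<Rightarrow> ('b, 'd) module \<Rightarrow> ('a \<Rightarrow> 'b) \<Rightarrow> ('c \<Rightarrow> 'd) \<Rightarrow>
     ('c \<times> 'a) set \<Rightarrow> ('d \<times> 'b) set"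
  where "frac_push B T' N' p f W = (\<Union>(x, s)\<in>W. fraction B T' N' (f x) (p s))"

lemma (in ring_corner) submonoid_image:
  assumes T: "submonoid T A"
  shows "submonoid (p ` T) B"
proof -
  interpret T: submonoid T A by (rule T)
  show ?thesis
  proof (rule submonoid.intro)
    show "p ` T \<subseteq> carrier B" using T.mem_carrier proj_closed by blast
    show "\<one>\<^bsub>B\<^esub> \<in> p ` T" using T.one_closed ring_hom_one[OF proj_hom] by (metis imageI)
    show "x \<otimes>\<^bsub>B\<^esub> y \<in> p ` T" if xy: "x \<in> p ` T" "y \<in> p ` T" for x y
    proof -
      obtain s t where st: "s \<in> T" "t \<in> T" "x = p s" "y = p t" using xy by blast
      then have "x \<otimes>\<^bsub>B\<^esub> y = p (s \<otimes>\<^bsub>A\<^esub> t)" by (simp add: ring_hom_mult[OF proj_hom] T.mem_carrier)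
      then show ?thesis using T.m_closed[OF st(1,2)] by blast
    qed
  qed
qed

context module_corner
begin

context
  fixes T
  assumes T: "submonoid T A"
begin

interpretation T: submonoid T A by (rule T)
interpretation T': submonoid "p ` T" B by (rule submonoid_image[OF T])

abbreviation loc_pi :: "('c \<times> 'a) set \<Rightarrow> ('d \<times> 'b) set"
  where "loc_pi \<equiv> frac_push B (p ` T) N' p \<pi>"

text \<open>
  Equality of two fractions over \<open>B\<close> with a witness \<open>p u\<close> means \<open>\<pi> (u t x) = \<pi> (u s y)\<close>, that is
  \<open>e u t x = e u s y\<close>, which says that \<open>u\<close> witnesses the equality of the two fractions multiplied by \<open>e\<close>.
  Hence localization keeps the kernel of \<open>\<pi>\<close> equal to that of multiplication by \<open>e\<close>.
\<close>

lemma loc_eq_iff: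
  assumes "x \<in> carrier N" "s \<in> T" "y \<in> carrier N" "t \<in> T"
  shows "fraction B (p ` T) N' (\<pi> x) (p s) = fraction B (p ` T) N' (\<pi> y) (p t) \<longleftrightarrow>
    fraction A T N (e \<odot>\<^bsub>N\<^esub> x) s = fraction A T N (e \<odot>\<^bsub>N\<^esub> y) t"
proof -
  have st: "s \<in> carrier A" "t \<in> carrier A" using assms T.mem_carrier by auto
  have "(p u \<otimes>\<^bsub>B\<^esub> p t) \<odot>\<^bsub>N'\<^esub> \<pi> x = (p u \<otimes>\<^bsub>B\<^esub> p s) \<odot>\<^bsub>N'\<^esub> \<pi> y \<longleftrightarrow>
      (u \<otimes>\<^bsub>A\<^esub> t) \<odot>\<^bsub>N\<^esub> (e \<odot>\<^bsub>N\<^esub> x) = (u \<otimes>\<^bsub>A\<^esub> s) \<odot>\<^bsub>N\<^esub> (e \<odot>\<^bsub>N\<^esub> y)" if "u \<in> T" for u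
  proof -
    have u: "u \<in> carrier A" using that T.mem_carrier by auto
    have "(p u \<otimes>\<^bsub>B\<^esub> p t) \<odot>\<^bsub>N'\<^esub> \<pi> x = (p u \<otimes>\<^bsub>B\<^esub> p s) \<odot>\<^bsub>N'\<^esub> \<pi> y \<longleftrightarrow>
        \<pi> ((u \<otimes>\<^bsub>A\<^esub> t) \<odot>\<^bsub>N\<^esub> x) = \<pi> ((u \<otimes>\<^bsub>A\<^esub> s) \<odot>\<^bsub>N\<^esub> y)"
      using assms st u by (simp add: pi_smult ring_hom_mult[OF proj_hom])
    also have "\<dots> \<longleftrightarrow> e \<odot>\<^bsub>N\<^esub> ((u \<otimes>\<^bsub>A\<^esub> t) \<odot>\<^bsub>N\<^esub> x) = e \<odot>\<^bsub>N\<^esub> ((u \<otimes>\<^bsub>A\<^esub> s) \<odot>\<^bsub>N\<^esub> y)"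
      using assms st u by (intro pi_eq_iff) simp_all
    also have "\<dots> \<longleftrightarrow> (u \<otimes>\<^bsub>A\<^esub> t) \<odot>\<^bsub>N\<^esub> (e \<odot>\<^bsub>N\<^esub> x) = (u \<otimes>\<^bsub>A\<^esub> s) \<odot>\<^bsub>N\<^esub> (e \<odot>\<^bsub>N\<^esub> y)"
      using assms st u idem_closed by (simp add: N.smult_assoc1[symmetric] A.m_comm)
    finally show ?thesis .
  qed
  then show ?thesis
    using assms by (simp add: frac_eq_iff[OF N'.module_axioms submonoid_image[OF T]]
        frac_eq_iff[OF N.module_axioms T] pi_closed idem_closed)
qed

lemma loc_pi_fraction:
  assumes x: "x \<in> carrier N" and s: "s \<in> T"
  shows "loc_pi (fraction A T N x s) = fraction B (p ` T) N' (\<pi> x) (p s)"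
proof -
  have "fraction B (p ` T) N' (\<pi> y) (p t) = fraction B (p ` T) N' (\<pi> x) (p s)"
    if yt: "(y, t) \<in> fraction A T N x s" for y t
  proof -
    obtain u where c: "y \<in> carrier N" "t \<in> T" "u \<in> T"
      and eq: "(u \<otimes>\<^bsub>A\<^esub> t) \<odot>\<^bsub>N\<^esub> x = (u \<otimes>\<^bsub>A\<^esub> s) \<odot>\<^bsub>N\<^esub> y"
      using yt by (auto simp: frac_mem[OF N.module_axioms T] frac_rel_iff[OF N.module_axioms T])
    have "(p u \<otimes>\<^bsub>B\<^esub> p s) \<odot>\<^bsub>N'\<^esub> \<pi> y = (p u \<otimes>\<^bsub>B\<^esub> p t) \<odot>\<^bsub>N'\<^esub> \<pi> x"
      using arg_cong[OF eq, of \<pi>] c x s by (simp add: pi_smult ring_hom_mult[OF proj_hom] T.mem_carrier)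
    then show ?thesis
      using c x s by (subst frac_eq_iff[OF N'.module_axioms submonoid_image[OF T]]) (auto simp: pi_closed)
  qed
  then show ?thesis
    unfolding frac_push_def using frac_self[OF N.module_axioms T x s] by blast
qed

lemma loc_cases:
  assumes "w \<in> carrier (localize_module A T N)"
  obtains x s where "x \<in> carrier N" "s \<in> T" "w = fraction A T N x s"
  using assms unfolding localize_module_simps by (rule frac_cases[OF N.module_axioms T])

lemma loc_pi_surj: "loc_pi ` carrier (localize_module A T N) = carrier (localize_module B (p ` T) N')"
proof (intro equalityI subsetI)
  fix w assume "w \<in> loc_pi ` carrier (localize_module A T N)"
  then obtain x s where "x \<in> carrier N" "s \<in> T" "w = loc_pi (fraction A T N x s)"
    by (auto elim: loc_cases)
  then show "w \<in> carrier (localize_module B (p ` T) N')"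
    using frac_closed[OF N'.module_axioms submonoid_image[OF T]]
    by (simp add: loc_pi_fraction localize_module_simps pi_closed)
next
  fix w assume "w \<in> carrier (localize_module B (p ` T) N')"
  then obtain y t where "y \<in> carrier N'" "t \<in> p ` T" "w = fraction B (p ` T) N' y t"
    unfolding localize_module_simps by (rule frac_cases[OF N'.module_axioms submonoid_image[OF T]])
  then obtain x s where "x \<in> carrier N" "s \<in> T" "w = loc_pi (fraction A T N x s)"
    by (auto simp: loc_pi_fraction elim: pi_preimage)
  then show "w \<in> loc_pi ` carrier (localize_module A T N)"
    using frac_closed[OF N.module_axioms T] by (auto simp: localize_module_simps)
qed

lemma loc_pi_add:
  assumes "v \<in> carrier (localize_module A T N)" "w \<in> carrier (localize_module A T N)"
  shows "loc_pi (v \<oplus>\<^bsub>localize_module A T N\<^esub> w) = loc_pi v \<oplus>\<^bsub>localize_module B (p ` T) N'\<^esub> loc_pi w"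
proof -
  from assms obtain x s y t where c: "x \<in> carrier N" "s \<in> T" "y \<in> carrier N" "t \<in> T"
    and vw: "v = fraction A T N x s" "w = fraction A T N y t"
    by (metis loc_cases)
  show ?thesis
    unfolding vw localize_module_simps using c
    by (simp add: loc_pi_fraction frac_add_frac[OF N.module_axioms T] T.mem_carrier pi_closed pi_add pi_smult
        frac_add_frac[OF N'.module_axioms submonoid_image[OF T]] ring_hom_mult[OF proj_hom])
qed

lemma loc_pi_eq_iff:
  assumes "v \<in> carrier (localize_module A T N)" "w \<in> carrier (localize_module A T N)"
  shows "loc_pi v = loc_pi w \<longleftrightarrow>
    localize_map A T e \<odot>\<^bsub>localize_module A T N\<^esub> v = localize_map A T e \<odot>\<^bsub>localize_module A T N\<^esub> w"
proof -
  from assms obtain x s y t where c: "x \<in> carrier N" "s \<in> T" "y \<in> carrier N" "t \<in> T"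
    and vw: "v = fraction A T N x s" "w = fraction A T N y t"
    by (metis loc_cases)
  show ?thesis
    unfolding vw localize_module_simps localize_map_def using c
    by (simp add: loc_pi_fraction loc_eq_iff frac_smult_frac[OF N.module_axioms T] idem_closed T.mem_carrier)
qed

lemma loc_pi_smult:
  assumes b: "b \<in> carrier A" "s \<in> T" and w: "w \<in> carrier (localize_module A T N)"
  shows "loc_pi (fraction A T (regular_module A) b s \<odot>\<^bsub>localize_module A T N\<^esub> w) =
    fraction B (p ` T) (regular_module B) (p b) (p s) \<odot>\<^bsub>localize_module B (p ` T) N'\<^esub> loc_pi w"
proof -
  from w obtain y t where c: "y \<in> carrier N" "t \<in> T" and w: "w = fraction A T N y t"
    by (rule loc_cases)
  show ?thesis
    unfolding w localize_module_simps using b c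
    by (simp add: loc_pi_fraction frac_smult_frac[OF N.module_axioms T] proj_closed pi_closed pi_smult
        frac_smult_frac[OF N'.module_axioms submonoid_image[OF T]] ring_hom_mult[OF proj_hom] T.mem_carrier)
qed

text \<open>
  The scalars stay \<open>A\<close> and \<open>B\<close> here, which is the setting of \<open>S\<close>-projectivity.
\<close>

lemma module_corner_localize_restrict:
  "module_corner A B e p (restrict_scalars (localize_map A T) (localize_module A T N))
    (restrict_scalars (localize_map B (p ` T)) (localize_module B (p ` T) N')) loc_pi"
proof -
  interpret L: Module.module A "restrict_scalars (localize_map A T) (localize_module A T N)"
    by (rule module_localize_restrict[OF N.module_axioms T])
  interpret L': Module.module B "restrict_scalars (localize_map B (p ` T)) (localize_module B (p ` T) N')"
    by (rule module_localize_restrict[OF N'.module_axioms submonoid_image[OF T]])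
  show ?thesis
    by unfold_locales
      (simp_all add: restrict_scalars_def loc_pi_surj loc_pi_add loc_pi_eq_iff,
        simp add: localize_map_def loc_pi_smult ring_hom_one[OF proj_hom])
qed

end

end

lemma (in ring_corner) module_corner_regular:
  "module_corner A B e p (regular_module A) (regular_module B) p"
proof -
  interpret A': Module.module A "regular_module A" by (rule module_regular_module[OF A.cring_axioms])
  interpret B': Module.module B "regular_module B" by (rule module_regular_module[OF B.cring_axioms])
  show ?thesis
    by unfold_locales
      (simp_all add: proj_surj proj_eq_iff ring_hom_add[OF proj_hom] ring_hom_mult[OF proj_hom])
qed

text \<open>
  Here the rings are localized too, which is the setting of \<open>S\<close>-flatness.  The localized rings are
  the localizations of the regular modules, so the ring part is the module part for \<open>p\<close> in place of
  \<open>\<pi>\<close>.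
\<close>

lemma (in module_corner) module_corner_localize:
  assumes T: "submonoid T A"
  shows "module_corner (localize_ring A T) (localize_ring B (p ` T)) (localize_map A T e)
    (frac_push B (p ` T) (regular_module B) p p)
    (localize_module A T N) (localize_module B (p ` T) N') (frac_push B (p ` T) N' p \<pi>)"
proof -
  interpret R: module_corner A B e p "regular_module A" "regular_module B" p
    by (rule module_corner_regular)
  interpret T: submonoid T A by (rule T)
  note T' = submonoid_image[OF T]
  interpret A': cring "localize_ring A T" by (rule cring_localize_ring[OF A.cring_axioms T])
  interpret B': cring "localize_ring B (p ` T)" by (rule cring_localize_ring[OF B.cring_axioms T'])
  interpret L: Module.module "localize_ring A T" "localize_module A T N"
    by (rule module_localize_module[OF N.module_axioms T])
  interpret L': Module.module "localize_ring B (p ` T)" "localize_module B (p ` T) N'"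
    by (rule module_localize_module[OF N'.module_axioms T'])
  \<comment> \<open>The localized ring and the localized regular module share carrier and operations.\<close>
  have eq: "carrier (localize_ring C S) = carrier (localize_module C S (regular_module C))"
    "add (localize_ring C S) = add (localize_module C S (regular_module C))"
    "monoid.mult (localize_ring C S) = smult (localize_module C S (regular_module C))"
    for C :: "('e, 'f) ring_scheme" and S
    by (simp_all add: localize_ring_simps localize_module_simps)
  let ?q = "frac_push B (p ` T) (regular_module B) p p"
  have q_smult: "frac_push B (p ` T) N' p \<pi> (a \<odot>\<^bsub>localize_module A T N\<^esub> w) =
      ?q a \<odot>\<^bsub>localize_module B (p ` T) N'\<^esub> frac_push B (p ` T) N' p \<pi> w"
    if a: "a \<in> carrier (localize_ring A T)" and w: "w \<in> carrier (localize_module A T N)" for a w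
  proof -
    obtain b s where b: "b \<in> carrier A" "s \<in> T" "a = fraction A T (regular_module A) b s"
      using a unfolding eq by (rule R.loc_cases[OF T]) simp
    then show ?thesis using loc_pi_smult[OF T b(1,2) w] R.loc_pi_fraction[OF T] by simp
  qed
  have q_mult: "?q (a \<otimes>\<^bsub>localize_ring A T\<^esub> c) = ?q a \<otimes>\<^bsub>localize_ring B (p ` T)\<^esub> ?q c"
    if a: "a \<in> carrier (localize_ring A T)" and c: "c \<in> carrier (localize_ring A T)" for a c
  proof -
    obtain b s where b: "b \<in> carrier A" "s \<in> T" "a = fraction A T (regular_module A) b s"
      using a unfolding eq by (rule R.loc_cases[OF T]) simp
    then show ?thesis
      using R.loc_pi_smult[OF T b(1,2) c[unfolded eq]] R.loc_pi_fraction[OF T] unfolding eq by simp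
  qed
  have q_hom: "?q \<in> ring_hom (localize_ring A T) (localize_ring B (p ` T))"
  proof (rule ring_hom_memI)
    show "?q a \<in> carrier (localize_ring B (p ` T))" if "a \<in> carrier (localize_ring A T)" for a
      using R.loc_pi_surj[OF T] that unfolding eq by blast
    show "?q (a \<oplus>\<^bsub>localize_ring A T\<^esub> c) = ?q a \<oplus>\<^bsub>localize_ring B (p ` T)\<^esub> ?q c"
      if "a \<in> carrier (localize_ring A T)" "c \<in> carrier (localize_ring A T)" for a c
      using R.loc_pi_add[OF T] that unfolding eq by blast
    show "?q \<one>\<^bsub>localize_ring A T\<^esub> = \<one>\<^bsub>localize_ring B (p ` T)\<^esub>"
      using R.loc_pi_fraction[OF T, of "\<one>\<^bsub>A\<^esub>" "\<one>\<^bsub>A\<^esub>"]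
      by (simp add: localize_ring_simps ring_hom_one[OF proj_hom])
  qed (rule q_mult)
  have "localize_map A T e \<otimes>\<^bsub>localize_ring A T\<^esub> localize_map A T e = localize_map A T (e \<otimes>\<^bsub>A\<^esub> e)"
    using ring_hom_mult[OF localize_map_hom[OF A.cring_axioms T] idem_closed idem_closed] by simp
  then have idem': "localize_map A T e \<otimes>\<^bsub>localize_ring A T\<^esub> localize_map A T e = localize_map A T e"
    by (simp add: idem)
  show ?thesis
  proof unfold_locales
    show "localize_map A T e \<in> carrier (localize_ring A T)"
      by (rule ring_hom_closed[OF localize_map_hom[OF A.cring_axioms T] idem_closed])
    show "?q ` carrier (localize_ring A T) = carrier (localize_ring B (p ` T))"
      unfolding eq by (rule R.loc_pi_surj[OF T])
    show "?q a = ?q c \<longleftrightarrow> localize_map A T e \<otimes>\<^bsub>localize_ring A T\<^esub> a = localize_map A T e \<otimes>\<^bsub>localize_ring A T\<^esub> c"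
      if "a \<in> carrier (localize_ring A T)" "c \<in> carrier (localize_ring A T)" for a c
      using R.loc_pi_eq_iff[OF T] that unfolding eq by blast
  qed (rule q_hom idem' q_smult loc_pi_surj[OF T] loc_pi_add[OF T] loc_pi_eq_iff[OF T]; assumption)+
qed

text \<open>
  The preimage in \<open>A\<close> of an ideal that contains the images of \<open>E\<close> is an ideal that contains \<open>E\<close>, hence
  also \<open>1\<close>.
\<close>

lemma genideal_localize:
  assumes A: "cring A" and T: "submonoid T A" and E: "E \<subseteq> carrier A" and one: "\<one>\<^bsub>A\<^esub> \<in> genideal A E"
    and sub: "localize_map A T ` E \<subseteq> E'"
  shows "\<one>\<^bsub>localize_ring A T\<^esub> \<in> genideal (localize_ring A T) E'"
proof -
  interpret A: cring A by fact
  interpret L: cring "localize_ring A T" by (rule cring_localize_ring[OF A T])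
  interpret h: ring_hom_ring A "localize_ring A T" "localize_map A T"
    by (rule ring_hom_ringI2) (use A.ring_axioms L.ring_axioms localize_map_hom[OF A T] in auto)
  have "\<one>\<^bsub>localize_ring A T\<^esub> \<in> J" if J: "ideal J (localize_ring A T)" "E' \<subseteq> J" for J
  proof -
    have "genideal A E \<subseteq> {a \<in> carrier A. localize_map A T a \<in> J}"
      by (rule A.genideal_minimal[OF h.ideal_vimage[OF J(1)]]) (use E sub J(2) in auto)
    then show ?thesis using one h.hom_one by auto
  qed
  then show ?thesis by (simp add: genideal_def)
qed


section \<open>Products of rings\<close>

context
  fixes Rs :: "'a ring list"
  assumes Rs: "\<And>i. i < length Rs \<Longrightarrow> cring (Rs ! i)"
    and R: "cring (RDirProd_list Rs)"
begin

interpretation R: cring "RDirProd_list Rs" by (rule R)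

lemma ring_corner_nth:
  assumes i: "i < length Rs"
  shows "ring_corner (RDirProd_list Rs) (Rs ! i) (factor_idem Rs i) (\<lambda>r. r ! i)"
proof -
  interpret Ri: cring "Rs ! i" by (rule Rs[OF i])
  note incl = factor_incl_carrier[OF Rs i]
  have e: "factor_idem Rs i \<in> carrier (RDirProd_list Rs)"
    unfolding factor_idem_def by (rule incl) simp_all
  have mult: "factor_idem Rs i \<otimes>\<^bsub>RDirProd_list Rs\<^esub> r = factor_incl Rs i (r ! i)"
    if r: "r \<in> carrier (RDirProd_list Rs)" for r
    unfolding RDirProd_list_ops(1)[OF e r]
  proof (rule nth_equalityI)
    fix k assume "k < length (map (\<lambda>k. factor_idem Rs i ! k \<otimes>\<^bsub>Rs ! k\<^esub> r ! k) [0..<length Rs])"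
    then have k: "k < length Rs" by simp
    interpret Rk: cring "Rs ! k" by (rule Rs[OF k])
    have "r ! k \<in> carrier (Rs ! k)" using RDirProd_list_carrier_mem(2)[OF r k] .
    then show "map (\<lambda>k. factor_idem Rs i ! k \<otimes>\<^bsub>Rs ! k\<^esub> r ! k) [0..<length Rs] ! k = factor_incl Rs i (r ! i) ! k"
      using k i by (auto simp: factor_idem_def factor_incl_def nth_list_update)
  qed (simp add: factor_incl_def)
  have nth: "factor_incl Rs i r ! i = r" for r using i by (simp add: factor_incl_def)
  show ?thesis
  proof unfold_locales
    show "(\<lambda>r. r ! i) \<in> ring_hom (RDirProd_list Rs) (Rs ! i)"
      by (rule ring_hom_memI)
        (use i in \<open>auto simp: RDirProd_list_ops(1,2) RDirProd_list_ops(3)[OF e e] RDirProd_list_carrier_mem(2)\<close>)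
    show "(\<lambda>r. r ! i) ` carrier (RDirProd_list Rs) = carrier (Rs ! i)"
    proof (intro equalityI subsetI)
      fix r assume "r \<in> carrier (Rs ! i)"
      then show "r \<in> (\<lambda>r. r ! i) ` carrier (RDirProd_list Rs)"
        using incl nth by (metis imageI)
    qed (use RDirProd_list_carrier_mem(2) i in auto)
    show "r ! i = s ! i \<longleftrightarrow> factor_idem Rs i \<otimes>\<^bsub>RDirProd_list Rs\<^esub> r = factor_idem Rs i \<otimes>\<^bsub>RDirProd_list Rs\<^esub> s"
      if "r \<in> carrier (RDirProd_list Rs)" "s \<in> carrier (RDirProd_list Rs)" for r s
      using mult that nth by metis
    show "factor_idem Rs i \<otimes>\<^bsub>RDirProd_list Rs\<^esub> factor_idem Rs i = factor_idem Rs i"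
      unfolding mult[OF e] by (simp add: factor_idem_def nth)
  qed (rule e)
qed

lemma module_corner_factor_module:
  assumes M: "Module.module (RDirProd_list Rs) M" and i: "i < length Rs"
  shows "module_corner (RDirProd_list Rs) (Rs ! i) (factor_idem Rs i) (\<lambda>r. r ! i)
    M (factor_module Rs i M) (\<lambda>x. factor_idem Rs i \<odot>\<^bsub>M\<^esub> x)"
proof -
  interpret ring_corner "RDirProd_list Rs" "Rs ! i" "factor_idem Rs i" "\<lambda>r. r ! i"
    by (rule ring_corner_nth[OF i])
  have "factor_module Rs i M = corner_module (factor_idem Rs i) (factor_incl Rs i) M"
    by (simp add: factor_module_def corner_module_def)
  then show ?thesis
    using module_corner_corner_module[OF M, of "factor_incl Rs i"] factor_incl_carrier[OF Rs i] i
    by (simp add: factor_incl_def)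
qed

lemma one_in_genideal_factor_idem:
  "\<one>\<^bsub>RDirProd_list Rs\<^esub> \<in> genideal (RDirProd_list Rs) (factor_idem Rs ` {..<length Rs})"
proof -
  let ?R = "RDirProd_list Rs"
  have "\<one>\<^bsub>?R\<^esub> \<in> J" if J: "ideal J ?R" "factor_idem Rs ` {..<length Rs} \<subseteq> J" for J
  proof -
    interpret J: ideal J ?R by (rule J(1))
    \<comment> \<open>The partial sums of the \<open>e\<^sub>i\<close>: the first \<open>k\<close> components are one, the others zero.\<close>
    define c where "c k = map (\<lambda>j. if j < k then \<one>\<^bsub>Rs ! j\<^esub> else \<zero>\<^bsub>Rs ! j\<^esub>) [0..<length Rs]" for k
    have "c k \<in> J" if "k \<le> length Rs" for k
      using that
    proof (induction k)
      case 0
      have "c 0 = \<zero>\<^bsub>?R\<^esub>"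
        unfolding RDirProd_list_ops(4)[OF R.zero_closed R.zero_closed] by (rule nth_equalityI) (simp_all add: c_def)
      then show ?case by simp
    next
      case (Suc k)
      then have k: "k < length Rs" and ck: "c k \<in> J" by auto
      have ek: "factor_idem Rs k \<in> J" using J(2) k by blast
      have "c k \<oplus>\<^bsub>?R\<^esub> factor_idem Rs k = c (Suc k)"
        unfolding RDirProd_list_ops(2)[OF J.Icarr[OF ck] J.Icarr[OF ek]]
      proof (rule nth_equalityI)
        fix j assume "j < length (map (\<lambda>i. c k ! i \<oplus>\<^bsub>Rs ! i\<^esub> factor_idem Rs k ! i) [0..<length Rs])"
        then have j: "j < length Rs" by simp
        interpret Rj: cring "Rs ! j" by (rule Rs[OF j])
        interpret Rk: cring "Rs ! k" by (rule Rs[OF k])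
        show "map (\<lambda>i. c k ! i \<oplus>\<^bsub>Rs ! i\<^esub> factor_idem Rs k ! i) [0..<length Rs] ! j = c (Suc k) ! j"
          using j k by (auto simp: c_def factor_idem_def factor_incl_def nth_list_update less_Suc_eq)
      qed (simp add: c_def)
      then show ?case using J.a_closed[OF ck ek] by simp
    qed
    moreover have "c (length Rs) = \<one>\<^bsub>?R\<^esub>"
      unfolding RDirProd_list_ops(3)[OF R.zero_closed R.zero_closed] by (rule nth_equalityI) (simp_all add: c_def)
    ultimately show ?thesis by (metis order_refl)
  qed
  then show ?thesis by (simp add: genideal_def)
qed

end

lemma localize_annihilator:
  assumes N: "Module.module A N" and T: "submonoid T A" and a: "a \<in> carrier A" and t: "t \<in> T"
    and zero: "t \<otimes>\<^bsub>A\<^esub> a = \<zero>\<^bsub>A\<^esub>"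
  shows "localize_map A T a \<in> annihilator (localize_ring A T) (localize_module A T N)"
proof -
  interpret N: Module.module A N by fact
  interpret T: submonoid T A by (rule T)
  have "localize_map A T a \<odot>\<^bsub>localize_module A T N\<^esub> w = \<zero>\<^bsub>localize_module A T N\<^esub>"
    if w': "w \<in> carrier (localize_module A T N)" for w
  proof -
    obtain x s where w: "x \<in> carrier N" "s \<in> T" "w = fraction A T N x s"
      using w' unfolding localize_module_simps by (rule frac_cases[OF N T])
    have "t \<odot>\<^bsub>N\<^esub> (a \<odot>\<^bsub>N\<^esub> x) = \<zero>\<^bsub>N\<^esub>"
      using w a t zero by (simp add: N.smult_assoc1[symmetric] T.mem_carrier)
    then have "fraction A T N (a \<odot>\<^bsub>N\<^esub> x) s = fraction A T N \<zero>\<^bsub>N\<^esub> \<one>\<^bsub>A\<^esub>"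
      using w a t by (subst frac_eq_iff[OF N T]) (auto intro!: bexI[of _ t] simp: T.mem_carrier)
    then show ?thesis
      unfolding localize_module_simps localize_map_def using w a
      by (simp add: frac_smult_frac[OF N T] T.mem_carrier)
  qed
  then show ?thesis
    using ring_hom_closed[OF localize_map_hom[OF N.R.cring_axioms T] a] by (simp add: annihilator_def)
qed

theorem corollary2p9:
  fixes Rs :: "'a ring list" and S :: "'a list set" and M :: "('a list, 'b) module"
  assumes "\<And>i. i < length Rs \<Longrightarrow> cring (Rs ! i)"
    and "multiplicative_subset (RDirProd_list Rs) S"
    and "module (RDirProd_list Rs) M"
  shows "(S_flat (RDirProd_list Rs) S M \<longleftrightarrow>
      (\<forall>i<length Rs. \<zero>\<^bsub>Rs ! i\<^esub> \<notin> factor_set i S \<longrightarrow>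
         S_flat (Rs ! i) (factor_set i S) (factor_module Rs i M))) \<and>
    (S_projective (RDirProd_list Rs) S M \<longleftrightarrow>
      (\<forall>i<length Rs. \<zero>\<^bsub>Rs ! i\<^esub> \<notin> factor_set i S \<longrightarrow>
         S_projective (Rs ! i) (factor_set i S) (factor_module Rs i M)))"
proof -
  let ?R = "RDirProd_list Rs" and ?M = "localize_module (RDirProd_list Rs) S M"
  have T: "submonoid S ?R" using assms(2) by (simp add: multiplicative_subset_def)
  interpret M: Module.module ?R M by (rule assms(3))
  note R = M.R.cring_axioms
  define I where "I = {i. i < length Rs \<and> \<zero>\<^bsub>Rs ! i\<^esub> \<notin> factor_set i S}"
  have corner: "module_corner ?R (Rs ! i) (factor_idem Rs i) (\<lambda>r. r ! i)
      M (factor_module Rs i M) (\<lambda>x. factor_idem Rs i \<odot>\<^bsub>M\<^esub> x)" if "i < length Rs" for i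
    by (rule module_corner_factor_module[OF assms(1) R assms(3) that])
  have E: "factor_idem Rs ` {..<length Rs} \<subseteq> carrier ?R"
    using ring_corner.idem_closed[OF ring_corner_nth[OF assms(1) R]] by auto
  have kill: "localize_map ?R S (factor_idem Rs i) \<in> annihilator (localize_ring ?R S) ?M"
    if i: "i < length Rs" and iI: "i \<notin> I" for i
  proof -
    interpret C: ring_corner ?R "Rs ! i" "factor_idem Rs i" "\<lambda>r. r ! i"
      by (rule ring_corner_nth[OF assms(1) R i])
    obtain t where t: "t \<in> S" "t ! i = \<zero>\<^bsub>Rs ! i\<^esub>"
      using i iI by (auto simp: I_def factor_set_def)
    have tc: "t \<in> carrier ?R" using t(1) submonoid.mem_carrier[OF T] by blast
    have "t ! i = \<zero>\<^bsub>?R\<^esub> ! i" using t i by (simp add: RDirProd_list_ops(4)[OF tc tc])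
    then have "factor_idem Rs i \<otimes>\<^bsub>?R\<^esub> t = \<zero>\<^bsub>?R\<^esub>"
      using C.proj_eq_iff[OF tc M.R.zero_closed] C.idem_closed by simp
    then have "t \<otimes>\<^bsub>?R\<^esub> factor_idem Rs i = \<zero>\<^bsub>?R\<^esub>"
      using tc C.idem_closed by (simp add: M.R.m_comm)
    then show ?thesis by (rule localize_annihilator[OF assms(3) T C.idem_closed t(1)])
  qed
  note one = one_in_genideal_factor_idem[OF assms(1) R]
  \<comment> \<open>By \<open>kill\<close>, the \<open>e\<^sub>i\<close> with \<open>i \<in> I\<close> generate the unit ideal together with the annihilator.\<close>
  have "S_flat ?R S M \<longleftrightarrow> (\<forall>i\<in>I. S_flat (Rs ! i) (factor_set i S) (factor_module Rs i M))"
    unfolding S_flat_def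
  proof (rule flat_module_iff_corners)
    show "Module.module (localize_ring ?R S) ?M" by (rule module_localize_module[OF assms(3) T])
    show "module_corner (localize_ring ?R S) (localize_ring (Rs ! i) (factor_set i S))
        (localize_map ?R S (factor_idem Rs i))
        (frac_push (Rs ! i) (factor_set i S) (regular_module (Rs ! i)) (\<lambda>r. r ! i) (\<lambda>r. r ! i))
        ?M (localize_module (Rs ! i) (factor_set i S) (factor_module Rs i M))
        (frac_push (Rs ! i) (factor_set i S) (factor_module Rs i M) (\<lambda>r. r ! i)
          (\<lambda>x. factor_idem Rs i \<odot>\<^bsub>M\<^esub> x))" if "i \<in> I" for i
      unfolding factor_set_def
      by (rule module_corner.module_corner_localize[OF corner T]) (use that in \<open>simp add: I_def\<close>)
    show "\<one>\<^bsub>localize_ring ?R S\<^esub> \<in> genideal (localize_ring ?R S)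
        ((\<lambda>i. localize_map ?R S (factor_idem Rs i)) ` I \<union> annihilator (localize_ring ?R S) ?M)"
      by (rule genideal_localize[OF R T E one]) (use kill in auto)
  qed
  moreover have "S_projective ?R S M \<longleftrightarrow>
      (\<forall>i\<in>I. S_projective (Rs ! i) (factor_set i S) (factor_module Rs i M))"
    unfolding S_projective_def
  proof (rule projective_module_iff_corners)
    let ?N = "restrict_scalars (localize_map ?R S) ?M"
    show "Module.module ?R ?N" by (rule module_localize_restrict[OF assms(3) T])
    show "module_corner ?R (Rs ! i) (factor_idem Rs i) (\<lambda>r. r ! i) ?N
        (restrict_scalars (localize_map (Rs ! i) (factor_set i S))
          (localize_module (Rs ! i) (factor_set i S) (factor_module Rs i M)))
        (frac_push (Rs ! i) (factor_set i S) (factor_module Rs i M) (\<lambda>r. r ! i)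
          (\<lambda>x. factor_idem Rs i \<odot>\<^bsub>M\<^esub> x))" if "i \<in> I" for i
      unfolding factor_set_def
      by (rule module_corner.module_corner_localize_restrict[OF corner T]) (use that in \<open>simp add: I_def\<close>)
    have "factor_idem Rs i \<in> annihilator ?R ?N" if "i < length Rs" "i \<notin> I" for i
      using kill[OF that] E that(1) by (auto simp: annihilator_def restrict_scalars_def)
    then have "factor_idem Rs ` {..<length Rs} \<subseteq> factor_idem Rs ` I \<union> annihilator ?R ?N"
      by blast
    moreover have "factor_idem Rs ` I \<union> annihilator ?R ?N \<subseteq> carrier ?R"
      using E by (auto simp: I_def annihilator_def)
    ultimately show "\<one>\<^bsub>?R\<^esub> \<in> genideal ?R (factor_idem Rs ` I \<union> annihilator ?R ?N)"
      using one M.R.genideal_self M.R.genideal_minimal[OF M.R.genideal_ideal] by (meson order_trans subsetD)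
  qed
  ultimately show ?thesis by (auto simp: I_def)
qed

end
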